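(* For each nonzero $b\in\mathbb{C}$ there exists on $\mathbb{C}P^1$ a structure of a commutative involutive regular algebraic four-valued coset group $\mathbb{G}_{4,b}(\mathbb{C}P^1)$ with neutral element $0$ and multiplication defined by the symmetric polynomial $$\begin{aligned}p_{4,b}(z;x,y)&=\sigma_1^4-8\sigma_1^2\sigma_2+16\sigma_2^2-128\sigma_1\sigma_3-112b\,\sigma_1^2\sigma_3-4b^2\sigma_1^3\sigma_3-64b\,\sigma_2\sigma_3\\&\quad-112b^2\sigma_1\sigma_2\sigma_3-64b^2\sigma_3^2-288b^3\sigma_1\sigma_3^2+6b^4\sigma_1^2\sigma_3^2-136b^4\sigma_2\sigma_3^2\\&\quad-112b^5\sigma_3^3-4b^6\sigma_1\sigma_3^3+b^8\sigma_3^4,\end{aligned}$$ where $\sigma_k$ denotes the $k$-th elementary symmetric function of $x,y,z$. All such four-valued groups ($b\neq0$) are coset-isomorphic.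
   Context: $\mathbb{C}P^1=\mathbb{C}\cup\{\infty\}$, $x=x_1/x_0$ for $(x_1:x_0)$, $\infty=(1:0)$. $\mathrm{Sym}^n(X)=X^n/\Sigma_n$; elements are multisets $[z_1,\dots,z_n]$. An algebraic $n$-valued group is an algebraic variety $X$ with a rational morphism $\ast:X\times X\to\mathrm{Sym}^n(X)$ which is associative (the $n^2$-multisets $[x\ast w\mid w\in y\ast z]$ and $[w\ast z\mid w\in x\ast y]$ coincide), a neutral element $e$ with $x\ast e=e\ast x=[x,\dots,x]$ for all $x$, and a rational morphism $\mathrm{inv}:X\to X$ such that, whenever $\mathrm{inv}(x)$ exists, $x\ast\mathrm{inv}(x)$ and $\mathrm{inv}(x)\ast x$ exist and contain $e$. It is regular if $\ast$ is defined on all of $X\times X$ and $\mathrm{inv}$ on all of $X$; commutative if $x\ast y=y\ast x$; involutive if $\mathrm{inv}$ is uniquely determined and $\mathrm{inv}(x)=x$ for all $x$. The multiplication on $\mathbb{C}P^1$ defined by a polynomial $P(z;x,y)$ of degree at most $n$ in each variable: $(x_1:x_0)\ast(y_1:y_0)$ is the multiset of $n$ zeros (with multiplicity) in $(z_1:z_0)$ of the form $(x_0y_0z_0)^nP(z_1/z_0;x_1/x_0,y_1/y_0)$. Coset construction: for a (1-valued) group $G$ and a subgroup $H\subset\mathrm{Aut}(G)$ of order $n$, with projection $\pi:G\to G/H$, the coset $n$-valued group $G_H$ is $G/H$ with $\pi(u)\ast\pi(v)=[\pi(u\cdot h(v))\mid h\in H]$, neutral element $\pi(e)$, $\mathrm{inv}(\pi(u))=\pi(u^{-1})$.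 Here the coset structure on $\mathbb{G}_{4,b}(\mathbb{C}P^1)$ is that of the group of points of the elliptic curve $\mathcal{E}=\{\eta^2=\zeta^3+b\zeta\}$ (neutral element the point $\infty$) and the order-$4$ group generated by $\phi_4:(\zeta,\eta)\mapsto(-\zeta,i\eta)$, $\infty\mapsto\infty$, the orbit space being identified with $\mathbb{C}P^1$ by $(\zeta,\eta)\mapsto1/\zeta^2$, $\infty\mapsto0$. Coset groups $M_A$ and $N_B$ ($A\subset\mathrm{Aut}(M)$, $B\subset\mathrm{Aut}(N)$ of order $n$) are coset-isomorphic if there exist isomorphisms $\widetilde\varphi:M\to N$ (of algebraic groups) and $\varphi:M/A\to N/B$ compatible with the projections $M\to M/A$, $N\to N/B$, with the maps $M\times M\to\mathrm{Sym}^n(M)$, $(m_1,m_2)\mapsto[m_1\cdot a(m_2)\mid a\in A]$ (and likewise for $N$), and with the $n$-valued multiplications on $M/A$, $N/B$. *)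

theory Defs
  imports
    "HOL-Analysis.Cartesian_Space"
    "HOL-Algebra.Generated_Groups"
    "HOL-Algebra.Bij"
    "HOL-Library.Multiset"
begin

text \<open>
  Homogeneous polynomials of degree \<open>d\<close>, and multihomogeneous polynomials of multidegree
  \<open>(\<delta> 0, \<dots>, \<delta> (k - 1))\<close> in \<open>k\<close> vectors, are taken as polynomial functions, which is harmless
  over the infinite field of complex numbers.
\<close>

definition form :: "nat \<Rightarrow> (complex^'n \<Rightarrow> complex) \<Rightarrow> bool" where
  "form d F \<longleftrightarrow> (\<exists>c :: ('n \<Rightarrow> nat) \<Rightarrow> complex.
     F = (\<lambda>v. \<Sum>\<alpha> | (\<Sum>i\<in>UNIV. \<alpha> i) = d. c \<alpha> * (\<Prod>i\<in>UNIV. v $ i ^ \<alpha> i)))"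

definition multiform :: "nat \<Rightarrow> (nat \<Rightarrow> nat) \<Rightarrow> ((nat \<Rightarrow> complex^'n) \<Rightarrow> complex) \<Rightarrow> bool" where
  "multiform k \<delta> F \<longleftrightarrow> (\<exists>(N::nat) f. (\<forall>i<N. \<forall>j<k. form (\<delta> j) (f i j)) \<and>
     F = (\<lambda>v. \<Sum>i<N. \<Prod>j<k. f i j (v j)))"

text \<open>
  Spaces with functions (sheaves of complex-valued functions): in \<open>regular X U\<close> only the values
  on \<open>U\<close> matter.
\<close>

record 'a fun_space =
  points :: "'a set"
  opens :: "'a set set"
  regular :: "'a set \<Rightarrow> ('a \<Rightarrow> complex) set"

definition morphism :: "'a fun_space \<Rightarrow> 'b fun_space \<Rightarrow> ('a \<Rightarrow> 'b) \<Rightarrow> bool" where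
  "morphism X Y f \<longleftrightarrow>
     f \<in> points X \<rightarrow> points Y \<and>
     (\<forall>V\<in>opens Y. {x \<in> points X. f x \<in> V} \<in> opens X \<and>
        (\<forall>g\<in>regular Y V. g \<circ> f \<in> regular X {x \<in> points X. f x \<in> V}))"

definition isomorphism :: "'a fun_space \<Rightarrow> 'b fun_space \<Rightarrow> ('a \<Rightarrow> 'b) \<Rightarrow> bool" where
  "isomorphism X Y f \<longleftrightarrow>
     morphism X Y f \<and>
     (\<exists>g. morphism Y X g \<and> (\<forall>x\<in>points X. g (f x) = x) \<and> (\<forall>y\<in>points Y. f (g y) = y))"

text \<open>
  The space with functions on a set \<open>A\<close> embedded in a product of \<open>k\<close> projective spaces, where
  \<open>r p j\<close> is a vector of homogeneous coordinates of the \<open>j\<close>-th component of \<open>p\<close>: Zariski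
  topology, and functions that are locally quotients of multihomogeneous polynomials of equal
  multidegree.  All conditions are independent of the choice of homogeneous coordinates.
\<close>

definition zariski_opens :: "nat \<Rightarrow> 'a set \<Rightarrow> ('a \<Rightarrow> nat \<Rightarrow> complex^'n) \<Rightarrow> 'a set set" where
  "zariski_opens k A r =
     {U. \<exists>\<F>. (\<forall>F\<in>\<F>. \<exists>\<delta>. multiform k \<delta> F) \<and> U = {p \<in> A. \<exists>F\<in>\<F>. F (r p) \<noteq> 0}}"

definition zariski_space :: "nat \<Rightarrow> 'a set \<Rightarrow> ('a \<Rightarrow> nat \<Rightarrow> complex^'n) \<Rightarrow> 'a fun_space" where
  "zariski_space k A r =
     \<lparr>points = A,
      opens = zariski_opens k A r,
      regular = (\<lambda>U. {f. \<forall>p\<in>U. \<exists>W\<in>zariski_opens k A r. p \<in> W \<and> W \<subseteq> U \<and>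
        (\<exists>\<delta> F G. multiform k \<delta> F \<and> multiform k \<delta> G \<and>
           (\<forall>q\<in>W. G (r q) \<noteq> 0 \<and> f q = F (r q) / G (r q)))})\<rparr>"

text \<open>
  A projective variety is given by a set of points (of any type) together with a choice of
  homogeneous coordinates for each point; the nonzero multiples of the coordinate vectors must
  be the nonzero zeros of a family of homogeneous polynomials.  Irreducibility is not required.
\<close>

record ('a, 'n) proj_set =
  pset :: "'a set"
  hcoord :: "'a \<Rightarrow> (complex, 'n::finite) vec"

definition projective_variety :: "('a, 'n::finite) proj_set \<Rightarrow> bool" where
  "projective_variety X \<longleftrightarrow>
     (\<forall>p\<in>pset X. hcoord X p \<noteq> 0) \<and>
     (\<forall>p\<in>pset X. \<forall>q\<in>pset X. (\<exists>c. hcoord X p = c *s hcoord X q) \<longrightarrow> p = q) \<and>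
     (\<exists>\<F>. (\<forall>F\<in>\<F>. \<exists>d. form d F) \<and>
        {v. v \<noteq> 0 \<and> (\<forall>F\<in>\<F>. F v = 0)} = {c *s hcoord X p | c p. c \<noteq> 0 \<and> p \<in> pset X})"

definition power_space :: "nat \<Rightarrow> ('a, 'n::finite) proj_set \<Rightarrow> 'a list fun_space" where
  "power_space k X =
     zariski_space k {ps. length ps = k \<and> set ps \<subseteq> pset X} (\<lambda>ps j. hcoord X (ps ! j))"

definition variety_space :: "('a, 'n::finite) proj_set \<Rightarrow> 'a fun_space" where
  "variety_space X = zariski_space 1 (pset X) (\<lambda>p j. hcoord X p)"

text \<open>
  \<open>Sym\<^sup>n(X) = X\<^sup>n / \<Sigma>\<^sub>n\<close> as a quotient: points are multisets of size \<open>n\<close>; a set is open, and a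
  function is regular, iff its pullback along \<open>X\<^sup>n \<rightarrow> Sym\<^sup>n(X)\<close> is.
\<close>

definition sym_space :: "nat \<Rightarrow> ('a, 'n::finite) proj_set \<Rightarrow> 'a multiset fun_space" where
  "sym_space n X =
     \<lparr>points = {M. size M = n \<and> set_mset M \<subseteq> pset X},
      opens = {V. V \<subseteq> {M. size M = n \<and> set_mset M \<subseteq> pset X} \<and>
                  {ps \<in> points (power_space n X). mset ps \<in> V} \<in> opens (power_space n X)},
      regular = (\<lambda>V. {g. g \<circ> mset \<in>
                  regular (power_space n X) {ps \<in> points (power_space n X). mset ps \<in> V}})\<rparr>"

record 'a nvgroup =
  nmult :: "'a \<Rightarrow> 'a \<Rightarrow> 'a multiset"
  neutral :: 'a
  ninv :: "'a \<Rightarrow> 'a"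

text \<open>
  Regularity means that the multiplication and the inverse, which in general are rational, are
  defined everywhere, i.e. are morphisms; \<open>X \<times> X\<close> is the space of lists of length 2.
\<close>

definition regular_algebraic_nvgroup ::
    "nat \<Rightarrow> ('a, 'n::finite) proj_set \<Rightarrow> 'a nvgroup \<Rightarrow> bool" where
  "regular_algebraic_nvgroup n X G \<longleftrightarrow>
     projective_variety X \<and>
     morphism (power_space 2 X) (sym_space n X) (\<lambda>p. nmult G (p ! 0) (p ! 1)) \<and>
     morphism (variety_space X) (variety_space X) (ninv G) \<and>
     (\<forall>x\<in>pset X. \<forall>y\<in>pset X. \<forall>z\<in>pset X.
        (\<Sum>w\<in>#nmult G y z. nmult G x w) = (\<Sum>w\<in>#nmult G x y. nmult G w z)) \<and>
     neutral G \<in> pset X \<and>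
     (\<forall>x\<in>pset X. nmult G x (neutral G) = replicate_mset n x \<and>
                 nmult G (neutral G) x = replicate_mset n x) \<and>
     (\<forall>x\<in>pset X. neutral G \<in># nmult G x (ninv G x) \<and> neutral G \<in># nmult G (ninv G x) x)"

definition nv_commutative :: "('a, 'n::finite) proj_set \<Rightarrow> 'a nvgroup \<Rightarrow> bool" where
  "nv_commutative X G \<longleftrightarrow> (\<forall>x\<in>pset X. \<forall>y\<in>pset X. nmult G x y = nmult G y x)"

definition nv_involutive :: "('a, 'n::finite) proj_set \<Rightarrow> 'a nvgroup \<Rightarrow> bool" where
  "nv_involutive X G \<longleftrightarrow>
     (\<forall>x\<in>pset X. \<forall>y\<in>pset X.
        neutral G \<in># nmult G x y \<and> neutral G \<in># nmult G y x \<longrightarrow> y = ninv G x) \<and>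
     (\<forall>x\<in>pset X. ninv G x = x)"

text \<open>
  \<open>V\<close> is the projective variety underlying the group \<open>G\<close>, and \<open>X\<close> is identified with the orbit
  space of \<open>H\<close> by the map \<open>\<pi>\<close>, whose fibres are the orbits.
\<close>

definition coset_nvgroup ::
    "nat \<Rightarrow> 'g monoid \<Rightarrow> ('g, 'm::finite) proj_set \<Rightarrow> ('g \<Rightarrow> 'g) set \<Rightarrow> ('g \<Rightarrow> 'a) \<Rightarrow>
     ('a, 'n::finite) proj_set \<Rightarrow> 'a nvgroup \<Rightarrow> bool" where
  "coset_nvgroup n G V H \<pi> X N \<longleftrightarrow>
     group G \<and> projective_variety V \<and> pset V = carrier G \<and>
     subgroup H (AutoGroup G) \<and> finite H \<and> card H = n \<and>
     (\<forall>h\<in>H. isomorphism (variety_space V) (variety_space V) h) \<and>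
     \<pi> ` carrier G = pset X \<and> morphism (variety_space V) (variety_space X) \<pi> \<and>
     (\<forall>u\<in>carrier G. \<forall>v\<in>carrier G. \<pi> u = \<pi> v \<longleftrightarrow> (\<exists>h\<in>H. v = h u)) \<and>
     (\<forall>u\<in>carrier G. \<forall>v\<in>carrier G.
        nmult N (\<pi> u) (\<pi> v) = {#\<pi> (u \<otimes>\<^bsub>G\<^esub> h v). h \<in># mset_set H#}) \<and>
     neutral N = \<pi> \<one>\<^bsub>G\<^esub> \<and>
     (\<forall>u\<in>carrier G. ninv N (\<pi> u) = \<pi> (inv\<^bsub>G\<^esub> u))"

definition coset_isomorphic ::
    "'g monoid \<Rightarrow> ('g, 'm::finite) proj_set \<Rightarrow> ('g \<Rightarrow> 'g) set \<Rightarrow> ('g \<Rightarrow> 'a) \<Rightarrow>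
     ('a, 'n::finite) proj_set \<Rightarrow> 'a nvgroup \<Rightarrow>
     'h monoid \<Rightarrow> ('h, 'k::finite) proj_set \<Rightarrow> ('h \<Rightarrow> 'h) set \<Rightarrow> ('h \<Rightarrow> 'b) \<Rightarrow>
     ('b, 'l::finite) proj_set \<Rightarrow> 'b nvgroup \<Rightarrow> bool" where
  "coset_isomorphic M V A \<pi> X G M' V' A' \<pi>' X' G' \<longleftrightarrow>
     (\<exists>\<psi> \<phi>.
        \<psi> \<in> iso M M' \<and> isomorphism (variety_space V) (variety_space V') \<psi> \<and>
        isomorphism (variety_space X) (variety_space X') \<phi> \<and>
        (\<forall>m\<in>carrier M. \<phi> (\<pi> m) = \<pi>' (\<psi> m)) \<and>
        (\<forall>m\<in>carrier M. \<forall>m'\<in>carrier M.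
           image_mset \<psi> {#m \<otimes>\<^bsub>M\<^esub> a m'. a \<in># mset_set A#} =
           {#\<psi> m \<otimes>\<^bsub>M'\<^esub> a (\<psi> m'). a \<in># mset_set A'#}) \<and>
        (\<forall>x\<in>pset X. \<forall>y\<in>pset X.
           image_mset \<phi> (nmult G x y) = nmult G' (\<phi> x) (\<phi> y)))"

datatype 'a with_infty = Fin 'a | Infty

primrec coord1 :: "complex with_infty \<Rightarrow> complex" where
  "coord1 (Fin x) = x"
| "coord1 Infty = 1"

primrec coord0 :: "complex with_infty \<Rightarrow> complex" where
  "coord0 (Fin x) = 1"
| "coord0 Infty = 0"

definition CP1 :: "(complex with_infty, 2) proj_set" where
  "CP1 = \<lparr>pset = UNIV, hcoord = (\<lambda>p. vector [coord1 p, coord0 p])\<rparr>"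

text \<open>
  Zeros of a binary form counted with multiplicity: up to a nonzero constant, the form is the
  product of the linear forms \<open>z\<^sub>1 a\<^sub>0 - z\<^sub>0 a\<^sub>1\<close> vanishing at the listed points \<open>(a\<^sub>1:a\<^sub>0)\<close>.
\<close>

definition zeros_mset ::
    "nat \<Rightarrow> (complex \<Rightarrow> complex \<Rightarrow> complex) \<Rightarrow> complex with_infty multiset \<Rightarrow> bool" where
  "zeros_mset n f M \<longleftrightarrow> size M = n \<and>
     (\<exists>c\<noteq>0. \<forall>z1 z0. f z1 z0 = c * (\<Prod>a\<in>#M. z1 * coord0 a - z0 * coord1 a))"

text \<open>
  The inner sum with \<open>z1\<close>, \<open>z0\<close> is the homogenization \<open>(x\<^sub>0 y\<^sub>0 z\<^sub>0)\<^sup>n P(z\<^sub>1/z\<^sub>0; x\<^sub>1/x\<^sub>0, y\<^sub>1/y\<^sub>0)\<close>.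
\<close>

definition multiplication_defined_by ::
    "nat \<Rightarrow> (complex \<Rightarrow> complex \<Rightarrow> complex \<Rightarrow> complex) \<Rightarrow>
     (complex with_infty \<Rightarrow> complex with_infty \<Rightarrow> complex with_infty multiset) \<Rightarrow> bool" where
  "multiplication_defined_by n P \<mu> \<longleftrightarrow>
     (\<exists>c :: nat \<Rightarrow> nat \<Rightarrow> nat \<Rightarrow> complex.
        (\<forall>z x y. P z x y = (\<Sum>i\<le>n. \<Sum>j\<le>n. \<Sum>k\<le>n. c i j k * z^i * x^j * y^k)) \<and>
        (\<forall>x y. zeros_mset n
           (\<lambda>z1 z0. \<Sum>i\<le>n. \<Sum>j\<le>n. \<Sum>k\<le>n. c i j k * (z1^i * z0^(n - i)) *
              (coord1 x^j * coord0 x^(n - j)) * (coord1 y^k * coord0 y^(n - k)))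
           (\<mu> x y)))"

definition p4 :: "complex \<Rightarrow> complex \<Rightarrow> complex \<Rightarrow> complex \<Rightarrow> complex" where
  "p4 b z x y =
     (let s1 = x + y + z; s2 = x * y + y * z + z * x; s3 = x * y * z in
        s1^4 - 8 * s1^2 * s2 + 16 * s2^2 - 128 * s1 * s3 - 112 * b * s1^2 * s3
        - 4 * b^2 * s1^3 * s3 - 64 * b * s2 * s3 - 112 * b^2 * s1 * s2 * s3
        - 64 * b^2 * s3^2 - 288 * b^3 * s1 * s3^2 + 6 * b^4 * s1^2 * s3^2
        - 136 * b^4 * s2 * s3^2 - 112 * b^5 * s3^3 - 4 * b^6 * s1 * s3^3 + b^8 * s3^4)"

type_synonym ell_point = "(complex \<times> complex) with_infty"

definition ell_points :: "complex \<Rightarrow> ell_point set" where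
  "ell_points b = insert Infty {Fin (\<zeta>, \<eta>) | \<zeta> \<eta>. \<eta>^2 = \<zeta>^3 + b * \<zeta>}"

fun ell_add :: "complex \<Rightarrow> ell_point \<Rightarrow> ell_point \<Rightarrow> ell_point" where
  "ell_add b Infty Q = Q"
| "ell_add b P Infty = P"
| "ell_add b (Fin (x1, y1)) (Fin (x2, y2)) =
     (if x1 = x2 \<and> y1 = - y2 then Infty
      else let l = (if x1 = x2 then (3 * x1^2 + b) / (2 * y1) else (y2 - y1) / (x2 - x1));
               x3 = l^2 - x1 - x2
           in Fin (x3, l * (x1 - x3) - y1))"

definition ell_group :: "complex \<Rightarrow> ell_point monoid" where
  "ell_group b = \<lparr>carrier = ell_points b, monoid.mult = ell_add b, one = Infty\<rparr>"

primrec ell_hcoord :: "ell_point \<Rightarrow> complex^3" where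
  "ell_hcoord (Fin u) = vector [fst u, snd u, 1]"
| "ell_hcoord Infty = vector [0, 1, 0]"

definition ell_curve :: "complex \<Rightarrow> (ell_point, 3) proj_set" where
  "ell_curve b = \<lparr>pset = ell_points b, hcoord = ell_hcoord\<rparr>"

primrec phi4 :: "ell_point \<Rightarrow> ell_point" where
  "phi4 (Fin u) = Fin (- fst u, \<i> * snd u)"
| "phi4 Infty = Infty"

text \<open>The library's automorphisms are functions that are \<open>undefined\<close> outside the carrier.\<close>

definition phi4_group :: "complex \<Rightarrow> (ell_point \<Rightarrow> ell_point) set" where
  "phi4_group b = generate (AutoGroup (ell_group b)) {restrict phi4 (ell_points b)}"

primrec orbit_map :: "ell_point \<Rightarrow> complex with_infty" where
  "orbit_map (Fin u) = (if fst u = 0 then Infty else Fin (1 / fst u^2))"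
| "orbit_map Infty = Fin 0"

end

theory Submission
  imports Defs
    "HOL-Library.Set_Algebras"
    "HOL-Combinatorics.Permutations"
    "HOL-Computational_Algebra.Fundamental_Theorem_Algebra"
begin

text \<open>
  The four-valued group is the coset group of the elliptic curve
  \<open>\<eta>\<^sup>2 = \<zeta>\<^sup>3 + b\<zeta>\<close> by its automorphisms of order dividing four, read off in the coordinate
  \<open>x = 1 / \<zeta>\<^sup>2\<close>. Three points need an argument.

  \<^emph>\<open>The chord-and-tangent law is a group law.\<close> Associativity is derived from the ideal class group of
  the coordinate ring of the affine curve: sending a point to the class of its maximal ideal turns
  the addition into the multiplication of ideals (\<open>same_class_ell_add\<close>), because the ideals of three
  collinear points multiply to the principal ideal of the line (\<open>span_collinear_points\<close>). The map is
  injective, since the ideal of an affine point is not principal: the norm of a generator would have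
  degree at most two, so the generator could not involve \<open>\<eta>\<close> (\<open>same_class_point_gens_one\<close>). The curves for all \<open>b\<close> are
  isomorphic to the one for \<open>b = 1\<close> by \<open>(\<zeta>, \<eta>) \<mapsto> (t\<^sup>2\<zeta>, t\<^sup>3\<eta>)\<close> with \<open>t\<^sup>4 = b\<close>, so only that one is
  treated. The same maps, for \<open>t\<^sup>4 = 1\<close>, are the group generated by \<open>\<phi>\<^sub>4\<close>, and for \<open>t\<^sup>4 = b' / b\<close>
  they give the coset isomorphisms. Everything about the coset construction (independence of the
  representatives, associativity, commutativity, involutivity) is then reindexing along this group.

  \<^emph>\<open>The multiplication is given by the polynomial.\<close> The \<open>\<zeta>\<close>-coordinates of \<open>P + Q\<close> and \<open>P - Q\<close> are the
  zeros of an explicit quadratic form whose coefficients are polynomials in the \<open>\<zeta>\<close>-coordinates of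
  \<open>P\<close> and \<open>Q\<close> (\<open>xquad_sum_difference\<close>). Written in \<open>1 / \<zeta>\<close> this relation is symmetric in
  the three points, and \<open>p4\<close>, evaluated at squares, is the product of the relation over all changes of
  signs (\<open>p4_hom_squares\<close>). The signs account for the automorphisms and for the passage from
  \<open>1 / \<zeta>\<close> to its square. Homogeneous coordinates make all special positions instances of
  one formula.

  \<^emph>\<open>The multiplication is a morphism to the symmetric power.\<close> Let a multivalued map be given by the zeros
  of a binary form \<open>L\<close> whose coefficients are forms in the arguments. A regular function near a
  point of the symmetric power is a quotient of two multihomogeneous forms, and these can be made
  symmetric by averaging. By polarization a symmetric form is a combination of products
  \<open>f(v\<^sub>1) \<cdots> f(v\<^sub>n)\<close> with a single binary form \<open>f\<close>, and \<open>f\<close> splits into linear forms. For a linear form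
  with zero \<open>z\<close> this product is, up to a factor, the value of \<open>L\<close> at \<open>z\<close>. Hence a symmetric form in the
  zeros is a form in the arguments (\<open>symmetrization_descends\<close>, \<open>morphism_to_sym_CP1\<close>).
\<close>

section \<open>Forms and multihomogeneous forms\<close>

lemma finite_exponents: "finite {\<alpha> :: 'n::finite \<Rightarrow> nat. (\<Sum>i\<in>UNIV. \<alpha> i) = d}"
proof (rule finite_subset)
  show "{\<alpha> :: 'n \<Rightarrow> nat. (\<Sum>i\<in>UNIV. \<alpha> i) = d} \<subseteq> Pi\<^sub>E UNIV (\<lambda>_. {..d})"
    by (auto intro: member_le_sum)
  show "finite (Pi\<^sub>E (UNIV :: 'n set) (\<lambda>_. {..d}))"
    by (intro finite_PiE) auto
qed

lemma form_zero: "form d (\<lambda>v. 0)"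
  unfolding form_def by (intro exI[of _ "\<lambda>_. 0"]) simp

lemma form_add:
  assumes "form d F" "form d G"
  shows "form d (\<lambda>v. F v + G v)"
proof -
  from assms obtain c c' where "F = (\<lambda>v. \<Sum>\<alpha> | (\<Sum>i\<in>UNIV. \<alpha> i) = d. c \<alpha> * (\<Prod>i\<in>UNIV. v $ i ^ \<alpha> i))"
    "G = (\<lambda>v. \<Sum>\<alpha> | (\<Sum>i\<in>UNIV. \<alpha> i) = d. c' \<alpha> * (\<Prod>i\<in>UNIV. v $ i ^ \<alpha> i))"
    unfolding form_def by blast
  then show ?thesis
    unfolding form_def
    by (intro exI[of _ "\<lambda>\<alpha>. c \<alpha> + c' \<alpha>"]) (simp add: sum.distrib distrib_right)
qed

lemma form_cmult:
  assumes "form d F"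
  shows "form d (\<lambda>v. a * F v)"
proof -
  from assms obtain c where "F = (\<lambda>v. \<Sum>\<alpha> | (\<Sum>i\<in>UNIV. \<alpha> i) = d. c \<alpha> * (\<Prod>i\<in>UNIV. v $ i ^ \<alpha> i))"
    unfolding form_def by blast
  then show ?thesis
    unfolding form_def
    by (intro exI[of _ "\<lambda>\<alpha>. a * c \<alpha>"]) (simp add: sum_distrib_left mult.assoc)
qed

lemma form_sum: "(\<And>i. i \<in> I \<Longrightarrow> form d (F i)) \<Longrightarrow> form d (\<lambda>v. \<Sum>i\<in>I. F i v)"
  by (induction I rule: infinite_finite_induct) (auto intro: form_zero form_add)

lemma form_monomial:
  fixes \<alpha> :: "'n::finite \<Rightarrow> nat"
  assumes "(\<Sum>i\<in>UNIV. \<alpha> i) = d"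
  shows "form d (\<lambda>v. \<Prod>i\<in>UNIV. v $ i ^ \<alpha> i)"
proof -
  have "(\<Sum>\<beta> | (\<Sum>i\<in>UNIV. \<beta> i) = d. (if \<beta> = \<alpha> then 1 else 0) * (\<Prod>i\<in>UNIV. v $ i ^ \<beta> i))
      = (\<Prod>i\<in>UNIV. v $ i ^ \<alpha> i)" for v :: "(complex, 'n) vec"
    using assms by (simp add: if_distrib[of "\<lambda>x. x * _"] finite_exponents cong: if_cong)
  then show ?thesis
    unfolding form_def by (intro exI[of _ "\<lambda>\<beta>. if \<beta> = \<alpha> then 1 else 0"]) simp
qed

lemma form_mult:
  fixes F G :: "complex^'n::finite \<Rightarrow> complex"
  assumes "form d F" "form e G"
  shows "form (d + e) (\<lambda>v. F v * G v)"
proof -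
  from assms obtain c c' where F: "F = (\<lambda>v. \<Sum>\<alpha> | (\<Sum>i\<in>UNIV. \<alpha> i) = d. c \<alpha> * (\<Prod>i\<in>UNIV. v $ i ^ \<alpha> i))"
    and G: "G = (\<lambda>v. \<Sum>\<alpha> | (\<Sum>i\<in>UNIV. \<alpha> i) = e. c' \<alpha> * (\<Prod>i\<in>UNIV. v $ i ^ \<alpha> i))"
    unfolding form_def by blast
  have FG: "(\<lambda>v. F v * G v) = (\<lambda>v. \<Sum>\<alpha> | (\<Sum>i\<in>UNIV. \<alpha> i) = d. \<Sum>\<beta> | (\<Sum>i\<in>UNIV. \<beta> i) = e.
      c \<alpha> * c' \<beta> * (\<Prod>i\<in>UNIV. v $ i ^ (\<alpha> i + \<beta> i)))"
    unfolding F G sum_product by (intro ext sum.cong refl) (simp add: power_add prod.distrib)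
  show ?thesis
    unfolding FG by (intro form_sum form_cmult form_monomial) (simp add: sum.distrib)
qed

lemma form_const: "form 0 (\<lambda>v :: complex^'n::finite. a)"
  using form_cmult[OF form_monomial[of "\<lambda>_ :: 'n. 0" 0], of a] by simp

lemma form_coord: "form 1 (\<lambda>v :: complex^'n::finite. v $ i)"
proof -
  have "(\<Prod>j\<in>UNIV. v $ j ^ (if j = i then 1 else 0)) = v $ i" for v :: "complex^'n"
    by (simp add: if_distrib[of "\<lambda>n. _ ^ n"] cong: if_cong)
  then show ?thesis
    using form_monomial[of "\<lambda>j. if j = i then 1 else 0" 1] by simp
qed

lemma form_power: "form d F \<Longrightarrow> form (d * n) (\<lambda>v. F v ^ n)"
proof (induction n)
  case (Suc n)
  then show ?case
    using form_mult[of d F "d * n" "\<lambda>v. F v ^ n"] by simp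
qed (use form_const in simp)

lemma form_prod:
  "finite I \<Longrightarrow> (\<And>i. i \<in> I \<Longrightarrow> form (d i) (F i)) \<Longrightarrow> form (\<Sum>i\<in>I. d i) (\<lambda>v. \<Prod>i\<in>I. F i v)"
  by (induction I rule: finite_induct) (auto intro: form_const form_mult)

text \<open>
  Substituting forms of degree \<open>e\<close> into a form of degree \<open>d\<close> multiplies the degrees; this is what
  pulls functions back along maps given by forms.
\<close>

lemma form_comp:
  fixes F :: "complex^'n::finite \<Rightarrow> complex" and A :: "'n \<Rightarrow> complex^'m::finite \<Rightarrow> complex"
  assumes "form d F" "\<And>i. form e (A i)"
  shows "form (e * d) (\<lambda>v. F (\<chi> i. A i v))"
proof -
  from assms(1) obtain c where F: "F = (\<lambda>v. \<Sum>\<alpha> | (\<Sum>i\<in>UNIV. \<alpha> i) = d. c \<alpha> * (\<Prod>i\<in>UNIV. v $ i ^ \<alpha> i))"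
    unfolding form_def by blast
  have "form (e * d) (\<lambda>v. \<Prod>i\<in>UNIV. A i v ^ \<alpha> i)" if "(\<Sum>i\<in>UNIV. \<alpha> i) = d" for \<alpha> :: "'n \<Rightarrow> nat"
    using form_prod[of UNIV "\<lambda>i. e * \<alpha> i" "\<lambda>i v. A i v ^ \<alpha> i"] form_power[OF assms(2)] that
    by (simp flip: sum_distrib_left)
  then show ?thesis
    unfolding F by (intro form_sum form_cmult) simp
qed

lemma form_homogeneous:
  assumes "form d F"
  shows "F (a *s v) = a ^ d * F v"
proof -
  from assms obtain c where F: "F = (\<lambda>v. \<Sum>\<alpha> | (\<Sum>i\<in>UNIV. \<alpha> i) = d. c \<alpha> * (\<Prod>i\<in>UNIV. v $ i ^ \<alpha> i))"
    unfolding form_def by blast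
  show ?thesis
    unfolding F sum_distrib_left
  proof (rule sum.cong[OF refl])
    fix \<alpha> :: "'a \<Rightarrow> nat"
    assume "\<alpha> \<in> {\<alpha>. (\<Sum>i\<in>UNIV. \<alpha> i) = d}"
    then have "a ^ d = (\<Prod>i\<in>UNIV. a ^ \<alpha> i)"
      by (simp add: power_sum[symmetric])
    then show "c \<alpha> * (\<Prod>i\<in>UNIV. (a *s v) $ i ^ \<alpha> i) = a ^ d * (c \<alpha> * (\<Prod>i\<in>UNIV. v $ i ^ \<alpha> i))"
      by (simp add: power_mult_distrib prod.distrib)
  qed
qed

text \<open>
  Sums over an arbitrary finite index set are allowed here, so that sums and products of multiforms
  can be indexed by disjoint unions and products of the index sets.
\<close>

lemma multiformI:
  fixes f :: "'i \<Rightarrow> nat \<Rightarrow> (complex^'n::finite) \<Rightarrow> complex"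
  assumes "finite I" "\<And>i j. i \<in> I \<Longrightarrow> j < k \<Longrightarrow> form (\<delta> j) (f i j)"
    and F: "\<And>v. F v = (\<Sum>i\<in>I. \<Prod>j<k. f i j (v j))"
  shows "multiform k \<delta> F"
proof -
  obtain h where h: "bij_betw h {..<card I} I"
    using ex_bij_betw_nat_finite[OF assms(1)] by (auto simp: atLeast0LessThan)
  then have "\<forall>i<card I. \<forall>j<k. form (\<delta> j) (f (h i) j)"
    using assms(2) bij_betwE by blast
  moreover have "F = (\<lambda>v. \<Sum>i<card I. \<Prod>j<k. f (h i) j (v j))"
    unfolding F sum.reindex_bij_betw[OF h, symmetric] by blast
  ultimately show ?thesis
    unfolding multiform_def by (intro exI[of _ "card I"] exI[of _ "\<lambda>i. f (h i)"] conjI)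
qed

lemma multiformE:
  assumes "multiform k \<delta> F"
  obtains N :: nat and f where "\<And>i j. i < N \<Longrightarrow> j < k \<Longrightarrow> form (\<delta> j) (f i j)"
    "\<And>v. F v = (\<Sum>i<N. \<Prod>j<k. f i j (v j))"
  using assms unfolding multiform_def by auto

lemma multiform_zero: "multiform k \<delta> (\<lambda>v. 0)"
  by (rule multiformI[of "{}"]) auto

lemma multiform_add:
  fixes F G :: "(nat \<Rightarrow> complex^'n::finite) \<Rightarrow> complex"
  assumes "multiform k \<delta> F" "multiform k \<delta> G"
  shows "multiform k \<delta> (\<lambda>v. F v + G v)"
proof -
  obtain N f where f: "\<And>i j. i < N \<Longrightarrow> j < k \<Longrightarrow> form (\<delta> j) (f i j)"
    and F: "\<And>v. F v = (\<Sum>i<(N::nat). \<Prod>j<k. f i j (v j))"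
    by (rule multiformE[OF assms(1)]) (rule that)
  obtain N' g where g: "\<And>i j. i < N' \<Longrightarrow> j < k \<Longrightarrow> form (\<delta> j) (g i j)"
    and G: "\<And>v. G v = (\<Sum>i<(N'::nat). \<Prod>j<k. g i j (v j))"
    by (rule multiformE[OF assms(2)]) (rule that)
  show ?thesis
  proof (rule multiformI[of "{..<N} <+> {..<N'}"])
    show "form (\<delta> j) (case_sum f g i j)" if "i \<in> {..<N} <+> {..<N'}" "j < k" for i j
      using that f g by auto
    show "F v + G v = (\<Sum>i\<in>{..<N} <+> {..<N'}. \<Prod>j<k. case_sum f g i j (v j))" for v
      by (simp add: sum.Plus F G)
  qed simp
qed

lemma multiform_mult:
  fixes F G :: "(nat \<Rightarrow> complex^'n::finite) \<Rightarrow> complex"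
  assumes "multiform k \<delta> F" "multiform k \<epsilon> G"
  shows "multiform k (\<lambda>j. \<delta> j + \<epsilon> j) (\<lambda>v. F v * G v)"
proof -
  obtain N f where f: "\<And>i j. i < N \<Longrightarrow> j < k \<Longrightarrow> form (\<delta> j) (f i j)"
    and F: "\<And>v. F v = (\<Sum>i<(N::nat). \<Prod>j<k. f i j (v j))"
    by (rule multiformE[OF assms(1)]) (rule that)
  obtain N' g where g: "\<And>i j. i < N' \<Longrightarrow> j < k \<Longrightarrow> form (\<epsilon> j) (g i j)"
    and G: "\<And>v. G v = (\<Sum>i<(N'::nat). \<Prod>j<k. g i j (v j))"
    by (rule multiformE[OF assms(2)]) (rule that)
  show ?thesis
  proof (rule multiformI[of "{..<N} \<times> {..<N'}"])
    show "form (\<delta> j + \<epsilon> j) (\<lambda>u. f (fst i) j u * g (snd i) j u)"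
      if "i \<in> {..<N} \<times> {..<N'}" "j < k" for i j
      using that by (intro form_mult f g) auto
    show "F v * G v = (\<Sum>i\<in>{..<N} \<times> {..<N'}. \<Prod>j<k. f (fst i) j (v j) * g (snd i) j (v j))" for v
      by (simp add: F G sum_product sum.cartesian_product prod.distrib case_prod_unfold)
  qed simp
qed

lemma multiform_cong:
  assumes "multiform k \<delta> F" "\<And>j. j < k \<Longrightarrow> \<delta> j = \<epsilon> j"
  shows "multiform k \<epsilon> F"
  using assms by (elim multiformE) (rule multiformI[of "{..<N}" for N]; auto)

lemma multiform_depends:
  assumes "multiform k \<delta> F" "\<And>j. j < k \<Longrightarrow> v j = w j"
  shows "F v = F w"
  using assms by (elim multiformE) (auto intro!: sum.cong prod.cong)

lemma multiform_component:
  assumes "form e g" "j < k"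
  shows "multiform k (\<lambda>i. if i = j then e else 0) (\<lambda>v. g (v j))"
proof (rule multiformI[of "{()}"])
  show "form (if i = j then e else 0) (if i = j then g else (\<lambda>_. 1))" for i
    using assms form_const by auto
  show "g (v j) = (\<Sum>x\<in>{()}. \<Prod>i<k. (if i = j then g else (\<lambda>_. 1)) (v i))" for v
    using assms(2) by (simp add: if_distrib[of "\<lambda>f. f _"] cong: if_cong)
qed simp

lemma multiform_one: "multiform k (\<lambda>_. 0) (\<lambda>v :: nat \<Rightarrow> complex^'n::finite. 1)"
  by (rule multiformI[of "{()}" k _ "\<lambda>_ _ _. 1"]) (auto intro: form_const)

lemma multiform_prod:
  "finite I \<Longrightarrow> (\<And>i. i \<in> I \<Longrightarrow> multiform k (\<delta> i) (F i)) \<Longrightarrow>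
     multiform k (\<lambda>j. \<Sum>i\<in>I. \<delta> i j) (\<lambda>v. \<Prod>i\<in>I. F i v)"
  by (induction I rule: finite_induct) (auto intro: multiform_one multiform_mult)

lemma multiform_sum:
  "(\<And>i. i \<in> I \<Longrightarrow> multiform k \<delta> (F i)) \<Longrightarrow> multiform k \<delta> (\<lambda>v. \<Sum>i\<in>I. F i v)"
  by (induction I rule: infinite_finite_induct) (auto intro: multiform_zero multiform_add)

lemma multiform_single: "multiform 1 \<delta> F \<longleftrightarrow> (\<exists>g. form (\<delta> 0) g \<and> F = (\<lambda>v. g (v 0)))"
proof
  assume *: "multiform 1 \<delta> F"
  obtain N f where f: "\<And>i j. i < N \<Longrightarrow> j < 1 \<Longrightarrow> form (\<delta> j) (f i j)"
    and F: "\<And>v. F v = (\<Sum>i<(N::nat). \<Prod>j<1. f i j (v j))"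
    by (rule multiformE[OF *]) (rule that)
  have "form (\<delta> 0) (\<lambda>u. \<Sum>i<N. f i 0 u)"
    by (intro form_sum f) auto
  moreover have "F = (\<lambda>v. \<Sum>i<N. f i 0 (v 0))"
    by (rule ext) (simp add: F)
  ultimately show "\<exists>g. form (\<delta> 0) g \<and> F = (\<lambda>v. g (v 0))"
    by (intro exI[of _ "\<lambda>u. \<Sum>i<N. f i 0 u"] conjI)
next
  assume "\<exists>g. form (\<delta> 0) g \<and> F = (\<lambda>v. g (v 0))"
  then obtain g where g: "form (\<delta> 0) g" "F = (\<lambda>v. g (v 0))"
    by (elim exE conjE)
  show "multiform 1 \<delta> F"
    unfolding g(2) by (rule multiform_cong[OF multiform_component[OF g(1)]]) simp_all
qed

lemma multiform_cmult: 
  assumes "multiform k \<delta> F" "0 < k"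
  shows "multiform k \<delta> (\<lambda>v. a * F v)"
  using multiform_mult[OF multiform_component[OF form_const[of a] assms(2)] assms(1)]
  by (simp cong: if_cong)

section \<open>Zariski opens, regular functions and morphisms\<close>

lemma zariski_opensE:
  assumes "U \<in> zariski_opens k A r" "p \<in> U"
  obtains \<delta> F where "multiform k \<delta> F" "F (r p) \<noteq> 0" "\<And>q. q \<in> A \<Longrightarrow> F (r q) \<noteq> 0 \<Longrightarrow> q \<in> U"
proof -
  obtain \<F> where \<F>: "\<forall>F\<in>\<F>. \<exists>\<delta>. multiform k \<delta> F" "U = {p \<in> A. \<exists>F\<in>\<F>. F (r p) \<noteq> 0}"
    using assms(1) unfolding zariski_opens_def mem_Collect_eq by (elim exE conjE) (rule that)
  obtain F where F: "F \<in> \<F>" "F (r p) \<noteq> 0"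
    using assms(2) unfolding \<F>(2) mem_Collect_eq by (elim conjE bexE) (rule that)
  obtain \<delta> where "multiform k \<delta> F"
    using bspec[OF \<F>(1) F(1)] by (elim exE) (rule that)
  then show thesis
    by (rule that) (use F \<F>(2) in auto)
qed

lemma zariski_opensI:
  assumes "U \<subseteq> A"
    and loc: "\<And>p. p \<in> U \<Longrightarrow> \<exists>\<delta> F. multiform k \<delta> F \<and> F (r p) \<noteq> 0 \<and> (\<forall>q\<in>A. F (r q) \<noteq> 0 \<longrightarrow> q \<in> U)"
  shows "U \<in> zariski_opens k A r"
proof -
  define \<F> where "\<F> = {F. (\<exists>\<delta>. multiform k \<delta> F) \<and> (\<forall>q\<in>A. F (r q) \<noteq> 0 \<longrightarrow> q \<in> U)}"
  have iff: "p \<in> U \<longleftrightarrow> p \<in> A \<and> (\<exists>F\<in>\<F>. F (r p) \<noteq> 0)" for p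
  proof
    assume p: "p \<in> U"
    obtain \<delta> F where F: "multiform k \<delta> F" "F (r p) \<noteq> 0" "\<forall>q\<in>A. F (r q) \<noteq> 0 \<longrightarrow> q \<in> U"
      using loc[OF p] by (elim exE conjE) (rule that)
    then have "F \<in> \<F>"
      unfolding \<F>_def mem_Collect_eq by (intro conjI exI[of _ \<delta>])
    then show "p \<in> A \<and> (\<exists>F\<in>\<F>. F (r p) \<noteq> 0)"
      using assms(1) p F(2) by (intro conjI bexI[of _ F]) auto
  next
    assume "p \<in> A \<and> (\<exists>F\<in>\<F>. F (r p) \<noteq> 0)"
    then obtain F where "p \<in> A" "F \<in> \<F>" "F (r p) \<noteq> 0"
      by (elim conjE bexE) (rule that)
    then show "p \<in> U"
      unfolding \<F>_def mem_Collect_eq by (elim conjE) simp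
  qed
  have "U = {p \<in> A. \<exists>F\<in>\<F>. F (r p) \<noteq> 0}"
    by (rule Set.set_eqI) (unfold mem_Collect_eq, rule iff)
  moreover have "\<forall>F\<in>\<F>. \<exists>\<delta>. multiform k \<delta> F"
    unfolding \<F>_def by (intro ballI) (simp only: mem_Collect_eq)
  ultimately show ?thesis
    unfolding zariski_opens_def mem_Collect_eq by (intro exI[of _ \<F>] conjI)
qed

lemma basic_open:
  assumes "multiform k \<delta> F"
  shows "{q \<in> A. F (r q) \<noteq> 0} \<in> zariski_opens k A r"
  by (rule zariski_opensI; (intro exI[of _ \<delta>] exI[of _ F])?) (use assms in auto)

text \<open>
  A regular function can be written near a point so that the nonvanishing of the denominator alone
  marks out a neighbourhood inside \<open>U\<close>: numerator and denominator are multiplied by a form that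
  is nonzero only inside the neighbourhood on which the given quotient is valid.
\<close>

lemma regularE:
  assumes "f \<in> regular (zariski_space k A r) U" "p \<in> U"
  obtains \<delta> F G where "multiform k \<delta> F" "multiform k \<delta> G" "G (r p) \<noteq> 0"
    "\<And>q. q \<in> A \<Longrightarrow> G (r q) \<noteq> 0 \<Longrightarrow> q \<in> U" "\<And>q. q \<in> A \<Longrightarrow> G (r q) \<noteq> 0 \<Longrightarrow> f q = F (r q) / G (r q)"
proof -
  have "\<exists>W\<in>zariski_opens k A r. p \<in> W \<and> W \<subseteq> U \<and>
        (\<exists>\<delta> F G. multiform k \<delta> F \<and> multiform k \<delta> G \<and>
           (\<forall>q\<in>W. G (r q) \<noteq> 0 \<and> f q = F (r q) / G (r q)))"
    using assms unfolding zariski_space_def fun_space.simps mem_Collect_eq by (elim bspec)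
  then obtain W \<delta> F G where W: "W \<in> zariski_opens k A r" "p \<in> W" "W \<subseteq> U"
    and FG: "multiform k \<delta> F" "multiform k \<delta> G" "\<forall>q\<in>W. G (r q) \<noteq> 0 \<and> f q = F (r q) / G (r q)"
    by (elim exE bexE conjE) (rule that)
  obtain \<epsilon> H where H: "multiform k \<epsilon> H" "H (r p) \<noteq> 0" "\<And>q. q \<in> A \<Longrightarrow> H (r q) \<noteq> 0 \<Longrightarrow> q \<in> W"
    by (rule zariski_opensE[OF W(1,2)]) (rule that)
  show thesis
  proof (rule that)
    show "multiform k (\<lambda>j. \<delta> j + \<epsilon> j) (\<lambda>v. F v * H v)" "multiform k (\<lambda>j. \<delta> j + \<epsilon> j) (\<lambda>v. G v * H v)"
      by (intro multiform_mult FG H)+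
    show "G (r p) * H (r p) \<noteq> 0"
      using FG(3) W(2) H(2) by auto
    show "q \<in> U" if "q \<in> A" "G (r q) * H (r q) \<noteq> 0" for q
      using that H(3)[of q] W(3) by auto
    show "f q = (F (r q) * H (r q)) / (G (r q) * H (r q))" if "q \<in> A" "G (r q) * H (r q) \<noteq> 0" for q
      using that H(3)[of q] FG(3) by auto
  qed
qed

lemma regularI:
  assumes "U \<subseteq> A"
    and loc: "\<And>p. p \<in> U \<Longrightarrow> \<exists>\<delta> F G. multiform k \<delta> F \<and> multiform k \<delta> G \<and> G (r p) \<noteq> 0 \<and>
        (\<forall>q\<in>A. G (r q) \<noteq> 0 \<longrightarrow> q \<in> U \<and> f q = F (r q) / G (r q))"
  shows "f \<in> regular (zariski_space k A r) U"
proof -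
  have "\<exists>W\<in>zariski_opens k A r. p \<in> W \<and> W \<subseteq> U \<and>
        (\<exists>\<delta> F G. multiform k \<delta> F \<and> multiform k \<delta> G \<and>
           (\<forall>q\<in>W. G (r q) \<noteq> 0 \<and> f q = F (r q) / G (r q)))" if p: "p \<in> U" for p
  proof -
    obtain \<delta> F G where FG: "multiform k \<delta> F" "multiform k \<delta> G" "G (r p) \<noteq> 0"
      "\<forall>q\<in>A. G (r q) \<noteq> 0 \<longrightarrow> q \<in> U \<and> f q = F (r q) / G (r q)"
      using loc[OF p] by (elim exE conjE) (rule that)
    show ?thesis
    proof (intro bexI conjI exI)
      show "{q \<in> A. G (r q) \<noteq> 0} \<in> zariski_opens k A r"
        by (rule basic_open[OF FG(2)])
      show "p \<in> {q \<in> A. G (r q) \<noteq> 0}" "{q \<in> A. G (r q) \<noteq> 0} \<subseteq> U"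
        "\<forall>q\<in>{q \<in> A. G (r q) \<noteq> 0}. G (r q) \<noteq> 0 \<and> f q = F (r q) / G (r q)"
        using p assms(1) FG(3,4) by auto
    qed (rule FG)+
  qed
  then show ?thesis
    unfolding zariski_space_def fun_space.simps mem_Collect_eq by (intro ballI)
qed

text \<open>
  A map between projective varieties is a morphism if near every point it is given by forms of one
  degree. The forms may vanish simultaneously at some other points \<open>q\<close>, whence the possibly zero
  factor \<open>c\<close>; multiplying the pulled back forms by a component that is nonzero at \<open>p\<close> removes such
  \<open>q\<close> from the neighbourhood.
\<close>

lemma morphism_by_forms:
  fixes X :: "('a, 'n::finite) proj_set" and Y :: "('b, 'm::finite) proj_set"
  assumes maps: "f \<in> pset X \<rightarrow> pset Y"
    and loc: "\<And>p. p \<in> pset X \<Longrightarrow> \<exists>e A. (\<forall>i. form e (A i)) \<and> (\<exists>i. A i (hcoord X p) \<noteq> 0) \<and>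
       (\<forall>q\<in>pset X. \<exists>c. \<forall>i. A i (hcoord X q) = c * hcoord Y (f q) $ i)"
  shows "morphism (variety_space X) (variety_space Y) f"
proof -
  let ?rX = "\<lambda>p (j::nat). hcoord X p" and ?rY = "\<lambda>p (j::nat). hcoord Y p"
  have key: "\<exists>\<epsilon> F' G'. multiform 1 \<epsilon> F' \<and> multiform 1 \<epsilon> G' \<and> G' (?rX p) \<noteq> 0 \<and>
      (\<forall>q\<in>pset X. G' (?rX q) \<noteq> 0 \<longrightarrow> G (?rY (f q)) \<noteq> 0 \<and> F (?rY (f q)) / G (?rY (f q)) = F' (?rX q) / G' (?rX q))"
    if p: "p \<in> pset X" and FG: "multiform 1 \<delta> F" "multiform 1 \<delta> G" "G (?rY (f p)) \<noteq> 0" for p \<delta> F G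
  proof -
    obtain e A i where A: "\<forall>i. form e (A i)" and i: "A i (hcoord X p) \<noteq> 0"
      and c: "\<forall>q\<in>pset X. \<exists>c. \<forall>i. A i (hcoord X q) = c * hcoord Y (f q) $ i"
      using loc[OF p] by (elim exE conjE) (rule that)
    obtain g where g: "form (\<delta> 0) g" "F = (\<lambda>v. g (v 0))"
      using FG(1) unfolding multiform_single by (elim exE conjE) (rule that)
    obtain h where h: "form (\<delta> 0) h" "G = (\<lambda>v. h (v 0))"
      using FG(2) unfolding multiform_single by (elim exE conjE) (rule that)
    define P where "P = (\<lambda>g (v :: nat \<Rightarrow> complex^'n). A i (v 0) * g (\<chi> i. A i (v 0)))"
    have mf: "multiform 1 (\<lambda>_. e + e * \<delta> 0) (P g)" if "form (\<delta> 0) g" for g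
      unfolding multiform_single P_def
      by (intro exI[of _ "\<lambda>v. A i v * g (\<chi> i. A i v)"] conjI refl form_mult form_comp that)
        (use A in auto)
    have val: "\<exists>c. P g (?rX q) = c * g (hcoord Y (f q)) \<and> P h (?rX q) = c * h (hcoord Y (f q)) \<and>
        (q = p \<longrightarrow> c \<noteq> 0)" if q: "q \<in> pset X" for q
    proof -
      obtain c where c: "\<forall>i. A i (hcoord X q) = c * hcoord Y (f q) $ i"
        using bspec[OF c q] by (elim exE) (rule that)
      have "(\<chi> i. A i (hcoord X q)) = c *s hcoord Y (f q)"
        by (simp add: c vec_eq_iff)
      then have "P g (?rX q) = (A i (hcoord X q) * c ^ \<delta> 0) * g (hcoord Y (f q))"
        "P h (?rX q) = (A i (hcoord X q) * c ^ \<delta> 0) * h (hcoord Y (f q))"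
        unfolding P_def using form_homogeneous[OF g(1)] form_homogeneous[OF h(1)] by simp_all
      moreover have "A i (hcoord X q) * c ^ \<delta> 0 \<noteq> 0" if "q = p"
        using i c that by auto
      ultimately show ?thesis
        by (intro exI[of _ "A i (hcoord X q) * c ^ \<delta> 0"] conjI impI)
    qed
    show ?thesis
    proof (intro exI conjI ballI impI)
      show "multiform 1 (\<lambda>_. e + e * \<delta> 0) (P g)" "multiform 1 (\<lambda>_. e + e * \<delta> 0) (P h)"
        by (intro mf g h)+
      show "P h (?rX p) \<noteq> 0"
        using val[OF p] FG(3) h(2) by auto
      fix q assume q: "q \<in> pset X" "P h (?rX q) \<noteq> 0"
      then show "G (?rY (f q)) \<noteq> 0" "F (?rY (f q)) / G (?rY (f q)) = P g (?rX q) / P h (?rX q)"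
        using val[OF q(1)] h(2) g(2) by auto
    qed
  qed
  have op: "{x \<in> pset X. f x \<in> V} \<in> zariski_opens 1 (pset X) ?rX" if V: "V \<in> zariski_opens 1 (pset Y) ?rY" for V
  proof (rule zariski_opensI)
    fix p assume "p \<in> {x \<in> pset X. f x \<in> V}"
    then have p: "p \<in> pset X" "f p \<in> V"
      by auto
    obtain \<delta> G where G: "multiform 1 \<delta> G" "G (?rY (f p)) \<noteq> 0" "\<And>q. q \<in> pset Y \<Longrightarrow> G (?rY q) \<noteq> 0 \<Longrightarrow> q \<in> V"
      by (rule zariski_opensE[OF V p(2)]) (rule that)
    obtain \<epsilon> F' G' where G': "multiform 1 \<epsilon> G'" "G' (?rX p) \<noteq> 0"
      "\<forall>q\<in>pset X. G' (?rX q) \<noteq> 0 \<longrightarrow> G (?rY (f q)) \<noteq> 0 \<and> G (?rY (f q)) / G (?rY (f q)) = F' (?rX q) / G' (?rX q)"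
      using key[OF p(1) G(1,1,2)] by (elim exE conjE) (rule that)
    then show "\<exists>\<delta> F. multiform 1 \<delta> F \<and> F (?rX p) \<noteq> 0 \<and> (\<forall>q\<in>pset X. F (?rX q) \<noteq> 0 \<longrightarrow> q \<in> {x \<in> pset X. f x \<in> V})"
      using G(3) maps by (intro exI[of _ \<epsilon>] exI[of _ G'] conjI) auto
  qed auto
  have reg: "g \<circ> f \<in> regular (variety_space X) {x \<in> pset X. f x \<in> V}"
    if V: "V \<in> zariski_opens 1 (pset Y) ?rY" and g: "g \<in> regular (variety_space Y) V" for V g
    unfolding variety_space_def
  proof (rule regularI)
    fix p assume "p \<in> {x \<in> pset X. f x \<in> V}"
    then have p: "p \<in> pset X" "f p \<in> V"
      by auto
    obtain \<delta> F G where FG: "multiform 1 \<delta> F" "multiform 1 \<delta> G" "G (?rY (f p)) \<noteq> 0"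
      "\<And>q. q \<in> pset Y \<Longrightarrow> G (?rY q) \<noteq> 0 \<Longrightarrow> q \<in> V"
      "\<And>q. q \<in> pset Y \<Longrightarrow> G (?rY q) \<noteq> 0 \<Longrightarrow> g q = F (?rY q) / G (?rY q)"
      by (rule regularE[OF g[unfolded variety_space_def] p(2)]) (rule that)
    obtain \<epsilon> F' G' where FG': "multiform 1 \<epsilon> F'" "multiform 1 \<epsilon> G'" "G' (?rX p) \<noteq> 0"
      "\<forall>q\<in>pset X. G' (?rX q) \<noteq> 0 \<longrightarrow> G (?rY (f q)) \<noteq> 0 \<and> F (?rY (f q)) / G (?rY (f q)) = F' (?rX q) / G' (?rX q)"
      using key[OF p(1) FG(1-3)] by (elim exE conjE) (rule that)
    have "f q \<in> V \<and> g (f q) = F' (?rX q) / G' (?rX q)" if "q \<in> pset X" "G' (?rX q) \<noteq> 0" for q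
      using FG'(4) FG(4,5)[of "f q"] that maps by auto
    then show "\<exists>\<delta> F G. multiform 1 \<delta> F \<and> multiform 1 \<delta> G \<and> G (?rX p) \<noteq> 0 \<and>
        (\<forall>q\<in>pset X. G (?rX q) \<noteq> 0 \<longrightarrow> q \<in> {x \<in> pset X. f x \<in> V} \<and> (g \<circ> f) q = F (?rX q) / G (?rX q))"
      by (intro exI[of _ \<epsilon>] exI[of _ F'] exI[of _ G'] conjI FG') simp
  qed auto
  show ?thesis
    unfolding morphism_def using maps op reg
    by (simp add: variety_space_def zariski_space_def)
qed

section \<open>Symmetric multihomogeneous forms on the projective line\<close>

lemma binary_form_expand:
  assumes "form d f"
  obtains c where "\<And>v. f v = (\<Sum>k\<le>d. c k * v $ (1::2) ^ k * v $ 2 ^ (d - k))"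
proof -
  obtain c where f: "f = (\<lambda>v. \<Sum>\<alpha> | (\<Sum>i\<in>UNIV. \<alpha> i) = d. c \<alpha> * (\<Prod>i\<in>UNIV. v $ i ^ \<alpha> i))"
    using assms unfolding form_def by (elim exE) (rule that)
  let ?h = "\<lambda>k (i::2). if i = 1 then k else d - k"
  have bij: "bij_betw ?h {..d} {\<alpha>. (\<Sum>i\<in>UNIV. \<alpha> i) = d}"
  proof (rule bij_betwI[where g = "\<lambda>\<alpha>. \<alpha> 1"])
    show "?h \<in> {..d} \<rightarrow> {\<alpha>. (\<Sum>i\<in>UNIV. \<alpha> i) = d}"
      by (auto simp: sum_2)
    show "(\<lambda>\<alpha>. \<alpha> 1) \<in> {\<alpha> :: 2 \<Rightarrow> nat. (\<Sum>i\<in>UNIV. \<alpha> i) = d} \<rightarrow> {..d}"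
      by (auto simp: sum_2)
    show "?h (\<alpha> 1) = \<alpha>" if "\<alpha> \<in> {\<alpha> :: 2 \<Rightarrow> nat. (\<Sum>i\<in>UNIV. \<alpha> i) = d}" for \<alpha>
    proof
      fix i :: 2
      show "?h (\<alpha> 1) i = \<alpha> i"
        using that exhaust_2[of i] by (auto simp: sum_2)
    qed
  qed simp
  have "f v = (\<Sum>k\<le>d. c (?h k) * v $ 1 ^ k * v $ 2 ^ (d - k))" for v
    unfolding f sum.reindex_bij_betw[OF bij, symmetric]
    by (simp add: UNIV_2 mult.assoc)
  then show thesis
    by (rule that)
qed

text \<open>
  A form in two variables is a product of linear forms: the fundamental theorem of algebra for the
  dehomogenized polynomial, with the zero \<open>(1:0)\<close> making up for a drop of its degree.
\<close>

lemma binary_form_factor: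
  fixes f :: "complex^2 \<Rightarrow> complex"
  assumes "form d f"
  obtains \<kappa> and z :: "nat \<Rightarrow> complex^2"
    where "\<And>v. f v = \<kappa> * (\<Prod>l<d. z l $ 1 * v $ 2 - z l $ 2 * v $ 1)"
proof -
  obtain c where f: "\<And>v. f v = (\<Sum>k\<le>d. c k * v $ 1 ^ k * v $ 2 ^ (d - k))"
    by (rule binary_form_expand[OF assms]) (rule that)
  define p where "p = (\<Sum>k\<le>d. monom (c k) k)"
  have cp: "coeff p k = (if k \<le> d then c k else 0)" for k
    by (simp add: p_def coeff_sum coeff_monom if_distrib cong: if_cong)
  have deg: "degree p \<le> d"
    by (rule degree_le) (simp add: cp)
  obtain root where root: "smult (lead_coeff p) (\<Prod>i<degree p. [:- root i, 1:]) = p"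
    by (rule complex_poly_decompose')
  define z where "z = (\<lambda>l. if l < degree p then vector [- root l, - 1] else vector [1, 0] :: complex^2)"
  have "f v = lead_coeff p * (\<Prod>l<d. z l $ 1 * v $ 2 - z l $ 2 * v $ 1)" for v
  proof -
    have "(\<Prod>l<d. z l $ 1 * v $ 2 - z l $ 2 * v $ 1)
        = (\<Prod>l<degree p. z l $ 1 * v $ 2 - z l $ 2 * v $ 1) * (\<Prod>l=degree p..<d. z l $ 1 * v $ 2 - z l $ 2 * v $ 1)"
      using deg by (simp add: prod.atLeastLessThan_concat flip: atLeast0LessThan)
    also have "\<dots> = (\<Prod>l<degree p. v $ 1 - root l * v $ 2) * v $ 2 ^ (d - degree p)"
      by (simp add: z_def)
    finally have R: "(\<Prod>l<d. z l $ 1 * v $ 2 - z l $ 2 * v $ 1)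
        = (\<Prod>l<degree p. v $ 1 - root l * v $ 2) * v $ 2 ^ (d - degree p)" .
    show ?thesis
    proof (cases "v $ 2 = 0")
      case True
      have "f v = c d * v $ 1 ^ d"
        unfolding f by (subst sum.remove[of _ d]) (auto simp: True intro!: sum.neutral)
      then show ?thesis
        unfolding R using deg coeff_eq_0[of p d] cp[of d] by (cases "degree p = d") (auto simp: True cp)
    next
      case False
      have "poly p (v $ 1 / v $ 2) = lead_coeff p * (\<Prod>l<degree p. v $ 1 / v $ 2 - root l)"
        by (subst root[symmetric]) (simp add: poly_prod)
      also have "(\<Prod>l<degree p. v $ 1 / v $ 2 - root l) = (\<Prod>l<degree p. (v $ 1 - root l * v $ 2) / v $ 2)"
        using False by (intro prod.cong) (auto simp: field_simps)
      also have "\<dots> = (\<Prod>l<degree p. v $ 1 - root l * v $ 2) / v $ 2 ^ degree p"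
        by (simp add: prod_dividef)
      finally have "v $ 2 ^ d * poly p (v $ 1 / v $ 2)
          = lead_coeff p * ((\<Prod>l<degree p. v $ 1 - root l * v $ 2) * (v $ 2 ^ d / v $ 2 ^ degree p))"
        by simp
      moreover have "v $ 2 ^ d / v $ 2 ^ degree p = v $ 2 ^ (d - degree p)"
        using deg False by (simp add: power_diff)
      moreover have "v $ 2 ^ d * poly p (v $ 1 / v $ 2) = f v"
        unfolding f p_def poly_sum poly_monom sum_distrib_left
      proof (rule sum.cong[OF refl])
        fix k assume "k \<in> {..d}"
        then have "v $ 2 ^ d = v $ 2 ^ (d - k) * v $ 2 ^ k"
          by (simp flip: power_add)
        then show "v $ 2 ^ d * (c k * (v $ 1 / v $ 2) ^ k) = c k * v $ 1 ^ k * v $ 2 ^ (d - k)"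
          using False by (simp add: power_divide)
      qed
      ultimately show ?thesis
        unfolding R by simp
    qed
  qed
  then show thesis
    by (rule that)
qed

lemma sum_alternating_supersets:
  assumes "finite N" "T \<subseteq> N"
  shows "(\<Sum>S | T \<subseteq> S \<and> S \<subseteq> N. (- 1) ^ card S) = (if T = N then (- 1) ^ card N else (0 :: complex))"
proof (cases "T = N")
  case True
  then have "{S. T \<subseteq> S \<and> S \<subseteq> N} = {N}"
    by auto
  then show ?thesis
    using True by simp
next
  case False
  have "{S \<in> {S. T \<subseteq> S \<and> S \<subseteq> N}. P S} = {S. S \<subseteq> N \<and> T \<subseteq> S \<and> P S}" for P
    by auto
  then have "(\<Sum>S | T \<subseteq> S \<and> S \<subseteq> N. (- 1) ^ card S) = (0 :: complex)"
    using assms False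
    by (intro sum_alternating_cancels) (auto intro: card_subsupersets_even_odd finite_subset[of _ "Pow N"])
  then show ?thesis
    using False by simp
qed

text \<open>
  Ryser's formula for the permanent. Expanding the products of sums on the right gives a sum over all
  maps \<open>\<phi>\<close> of the index set to itself, each weighted by the alternating sum over the sets
  containing the image of \<open>\<phi>\<close>, which is zero unless \<open>\<phi>\<close> is onto.
\<close>

lemma permanent_polarization:
  fixes g :: "nat \<Rightarrow> nat \<Rightarrow> complex"
  shows "(\<Sum>\<sigma> | \<sigma> permutes {..<n}. \<Prod>j<n. g (\<sigma> j) j)
    = (\<Sum>S\<in>Pow {..<n}. (- 1) ^ (n + card S) * (\<Prod>j<n. \<Sum>s\<in>S. g s j))"
proof -
  let ?N = "{..<n}"
  let ?E = "Pi\<^sub>E ?N (\<lambda>_. ?N)"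
  let ?t = "\<lambda>\<phi>. \<Prod>j<n. g (\<phi> j) j"
  have fin: "finite ?E"
    by (intro finite_PiE) auto
  have "(\<Sum>S\<in>Pow ?N. (- 1) ^ (n + card S) * (\<Prod>j<n. \<Sum>s\<in>S. g s j))
      = (\<Sum>S\<in>Pow ?N. \<Sum>\<phi> | \<phi> \<in> ?E \<and> \<phi> ` ?N \<subseteq> S. (- 1) ^ (n + card S) * ?t \<phi>)"
  proof (rule sum.cong[OF refl])
    fix S assume S: "S \<in> Pow ?N"
    have "(\<Prod>j<n. \<Sum>s\<in>S. g s j) = (\<Sum>\<phi>\<in>Pi\<^sub>E ?N (\<lambda>_. S). \<Prod>j<n. g (\<phi> j) j)"
      by (rule prod_sum_PiE) (use S in \<open>auto intro: finite_subset\<close>)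
    also have "Pi\<^sub>E ?N (\<lambda>_. S) = {\<phi>. \<phi> \<in> ?E \<and> \<phi> ` ?N \<subseteq> S}"
      using S by (fastforce simp: PiE_def)
    finally show "(- 1) ^ (n + card S) * (\<Prod>j<n. \<Sum>s\<in>S. g s j)
        = (\<Sum>\<phi> | \<phi> \<in> ?E \<and> \<phi> ` ?N \<subseteq> S. (- 1) ^ (n + card S) * ?t \<phi>)"
      by (simp add: sum_distrib_left)
  qed
  also have "\<dots> = (\<Sum>\<phi>\<in>?E. \<Sum>S | S \<in> Pow ?N \<and> \<phi> ` ?N \<subseteq> S. (- 1) ^ (n + card S) * ?t \<phi>)"
    by (rule sum.swap_restrict) (use fin in auto)
  also have "\<dots> = (\<Sum>\<phi>\<in>?E. if \<phi> ` ?N = ?N then ?t \<phi> else 0)"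
  proof (rule sum.cong[OF refl])
    fix \<phi> assume "\<phi> \<in> ?E"
    then have sub: "\<phi> ` ?N \<subseteq> ?N"
      by auto
    have "{S. S \<in> Pow ?N \<and> \<phi> ` ?N \<subseteq> S} = {S. \<phi> ` ?N \<subseteq> S \<and> S \<subseteq> ?N}"
      by auto
    then have "(\<Sum>S | S \<in> Pow ?N \<and> \<phi> ` ?N \<subseteq> S. (- 1) ^ (n + card S) * ?t \<phi>)
        = (- 1) ^ n * (\<Sum>S | \<phi> ` ?N \<subseteq> S \<and> S \<subseteq> ?N. (- 1) ^ card S) * ?t \<phi>"
      by (simp add: power_add sum_distrib_left sum_distrib_right)
    also have "\<dots> = (if \<phi> ` ?N = ?N then ?t \<phi> else 0)"
      unfolding sum_alternating_supersets[OF finite_lessThan sub] by (simp flip: power_add)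
    finally show "(\<Sum>S | S \<in> Pow ?N \<and> \<phi> ` ?N \<subseteq> S. (- 1) ^ (n + card S) * ?t \<phi>)
        = (if \<phi> ` ?N = ?N then ?t \<phi> else 0)" .
  qed
  also have "\<dots> = (\<Sum>\<phi> | \<phi> \<in> ?E \<and> \<phi> ` ?N = ?N. ?t \<phi>)"
    using fin by (simp add: sum.inter_filter)
  also have "\<dots> = (\<Sum>\<sigma> | \<sigma> permutes ?N. ?t \<sigma>)"
  proof (rule sum.reindex_bij_witness[of _ "\<lambda>\<sigma>. restrict \<sigma> ?N" "\<lambda>\<phi> j. if j \<in> ?N then \<phi> j else j"])
    fix \<phi> assume a: "\<phi> \<in> {\<phi>. \<phi> \<in> ?E \<and> \<phi> ` ?N = ?N}"
    then show "restrict (\<lambda>j. if j \<in> ?N then \<phi> j else j) ?N = \<phi>"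
      by (auto simp: fun_eq_iff PiE_def extensional_def)
    have "inj_on \<phi> ?N"
      using a by (simp add: eq_card_imp_inj_on)
    then have "bij_betw (\<lambda>j. if j \<in> ?N then \<phi> j else j) ?N ?N"
      using a by (auto simp: bij_betw_def inj_on_def)
    then show "(\<lambda>j. if j \<in> ?N then \<phi> j else j) \<in> {\<sigma>. \<sigma> permutes ?N}"
      by (simp only: mem_Collect_eq) (rule bij_imp_permutes, auto)
  next
    fix \<sigma> assume "\<sigma> \<in> {\<sigma>. \<sigma> permutes ?N}"
    then have \<sigma>: "\<sigma> permutes ?N"
      by simp
    show "(\<lambda>j. if j \<in> ?N then restrict \<sigma> ?N j else j) = \<sigma>"
      using permutes_not_in[OF \<sigma>] by (auto simp: fun_eq_iff)
    have "\<sigma> ` ?N = ?N"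
      by (rule permutes_image[OF \<sigma>])
    then show "restrict \<sigma> ?N \<in> {\<phi>. \<phi> \<in> ?E \<and> \<phi> ` ?N = ?N}"
      by auto
  qed auto
  finally show ?thesis
    by simp
qed

lemma prod_mset_nth: "(\<Prod>a\<in>#mset ps. f a) = (\<Prod>j<length ps. f (ps ! j))"
  by (simp add: prod.list_conv_set_nth atLeast0LessThan prod_mset_prod_list flip: mset_map)

text \<open>
  A symmetric form in the zeros \<open>v\<^sub>j\<close> of the binary form \<open>z \<mapsto> L z w\<close> is itself a form in \<open>w\<close>; this replaces
  the fundamental theorem on symmetric polynomials. By polarization it is enough to consider
  \<open>f(v\<^sub>1) \<cdots> f(v\<^sub>n)\<close> for one binary form \<open>f\<close>, which is the resultant of \<open>f\<close> and \<open>L\<close> up to a constant: if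
  \<open>f\<close> has the zeros \<open>z\<^sub>1, \<dots>, z\<^sub>d\<close>, it equals the product of the \<open>L z\<^sub>l w\<close> up to a constant. The scalar
  \<open>c\<close> varies with \<open>w\<close>, but its power \<open>c\<^sup>d\<close> is the same for all \<open>F\<close> of degree \<open>d\<close> and cancels in quotients.
\<close>

lemma symmetrization_descends:
  fixes F :: "(nat \<Rightarrow> complex^2) \<Rightarrow> complex" and L :: "complex^2 \<Rightarrow> (nat \<Rightarrow> complex^'n::finite) \<Rightarrow> complex"
  assumes F: "multiform n (\<lambda>_. d) F" and L: "\<And>z. multiform k \<epsilon> (L z)" and k: "0 < k"
  obtains T where "multiform k (\<lambda>j. d * \<epsilon> j) T"
    "\<And>w c v. \<forall>z. L z w = c * (\<Prod>j<n. z $ 1 * v j $ 2 - z $ 2 * v j $ 1) \<Longrightarrow>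
       T w = c ^ d * (\<Sum>\<sigma> | \<sigma> permutes {..<n}. F (v \<circ> \<sigma>))"
proof -
  obtain N f where f: "\<And>i j. i < N \<Longrightarrow> j < n \<Longrightarrow> form d (f i j)"
    and Ff: "\<And>v. F v = (\<Sum>i<(N::nat). \<Prod>j<n. f i j (v j))"
    by (rule multiformE[OF F]) (rule that)
  \<comment> \<open>the forms to which polarization reduces the symmetrization of \<open>F\<close>\<close>
  have factor: "\<exists>\<kappa> (z :: nat \<Rightarrow> complex^2). \<forall>v. (\<Sum>s\<in>S. f i s v) = \<kappa> * (\<Prod>l<d. z l $ 1 * v $ 2 - z l $ 2 * v $ 1)"
    if iS: "i < N" "S \<subseteq> {..<n}" for i S
  proof -
    have "form d (\<lambda>v. \<Sum>s\<in>S. f i s v)"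
      using iS by (intro form_sum f) auto
    then obtain \<kappa> and z :: "nat \<Rightarrow> complex^2"
      where "\<And>v. (\<Sum>s\<in>S. f i s v) = \<kappa> * (\<Prod>l<d. z l $ 1 * v $ 2 - z l $ 2 * v $ 1)"
      by (rule binary_form_factor) (rule that)
    note factor = this
    show ?thesis
      by (intro exI[of _ \<kappa>] exI[of _ z] allI factor)
  qed
  have "\<forall>i S. \<exists>\<kappa> (z :: nat \<Rightarrow> complex^2). i < N \<longrightarrow> S \<subseteq> {..<n} \<longrightarrow>
      (\<forall>v. (\<Sum>s\<in>S. f i s v) = \<kappa> * (\<Prod>l<d. z l $ 1 * v $ 2 - z l $ 2 * v $ 1))"
  proof (intro allI)
    fix i S
    show "\<exists>\<kappa> (z :: nat \<Rightarrow> complex^2). i < N \<longrightarrow> S \<subseteq> {..<n} \<longrightarrow>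
      (\<forall>v. (\<Sum>s\<in>S. f i s v) = \<kappa> * (\<Prod>l<d. z l $ 1 * v $ 2 - z l $ 2 * v $ 1))"
      using factor[of i S] by (cases "i < N \<and> S \<subseteq> {..<n}") (auto simp only: simp_thms)
  qed
  then obtain \<kappa> and z :: "nat \<Rightarrow> nat set \<Rightarrow> nat \<Rightarrow> complex^2" where
    "\<forall>i S. i < N \<longrightarrow> S \<subseteq> {..<n} \<longrightarrow>
      (\<forall>v. (\<Sum>s\<in>S. f i s v) = \<kappa> i S * (\<Prod>l<d. z i S l $ 1 * v $ 2 - z i S l $ 2 * v $ 1))"
    unfolding choice_iff by (elim exE) (rule that)
  then have \<kappa>z: "(\<Sum>s\<in>S. f i s v) = \<kappa> i S * (\<Prod>l<d. z i S l $ 1 * v $ 2 - z i S l $ 2 * v $ 1)"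
    if "i < N" "S \<subseteq> {..<n}" for i S v
    using that by (elim allE[of _ i] allE[of _ S] impE allE[of _ v])
  define T where "T = (\<lambda>w. \<Sum>i<N. \<Sum>S\<in>Pow {..<n}. (- 1) ^ (n + card S) * (\<kappa> i S ^ n * (\<Prod>l<d. L (z i S l) w)))"
  show thesis
  proof (rule that)
    have "multiform k (\<lambda>j. d * \<epsilon> j) (\<lambda>w. \<Prod>l<d. L (z i S l) w)" for i S
      using multiform_prod[of "{..<d}" k "\<lambda>_. \<epsilon>" "\<lambda>l. L (z i S l)"] L by simp
    then show "multiform k (\<lambda>j. d * \<epsilon> j) T"
      unfolding T_def by (intro multiform_sum multiform_cmult k)
  next
    fix w c and v :: "nat \<Rightarrow> complex^2"
    assume Lw: "\<forall>z. L z w = c * (\<Prod>j<n. z $ 1 * v j $ 2 - z $ 2 * v j $ 1)"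
    have norm: "\<kappa> i S ^ n * (\<Prod>l<d. L (z i S l) w) = c ^ d * (\<Prod>j<n. \<Sum>s\<in>S. f i s (v j))"
      if "i < N" "S \<subseteq> {..<n}" for i S
    proof -
      have "(\<Prod>j<n. \<Sum>s\<in>S. f i s (v j))
          = \<kappa> i S ^ n * (\<Prod>j<n. \<Prod>l<d. z i S l $ 1 * v j $ 2 - z i S l $ 2 * v j $ 1)"
        using \<kappa>z[OF that] by (simp add: prod.distrib)
      also have "\<dots> = \<kappa> i S ^ n * (\<Prod>l<d. \<Prod>j<n. z i S l $ 1 * v j $ 2 - z i S l $ 2 * v j $ 1)"
        by (subst prod.swap) simp
      finally show ?thesis
        by (simp add: Lw prod.distrib)
    qed
    have perm: "(\<Sum>\<sigma> | \<sigma> permutes {..<n}. \<Prod>j<n. f i j (v (\<sigma> j)))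
        = (\<Sum>S\<in>Pow {..<n}. (- 1) ^ (n + card S) * (\<Prod>j<n. \<Sum>s\<in>S. f i s (v j)))" for i
    proof -
      have "(\<Sum>\<sigma> | \<sigma> permutes {..<n}. \<Prod>j<n. f i j (v (\<sigma> j)))
          = (\<Sum>\<sigma> | \<sigma> permutes {..<n}. \<Prod>j<n. f i j (v (inv_into UNIV \<sigma> j)))"
        by (rule sum_permutations_inverse)
      also have "\<dots> = (\<Sum>\<sigma> | \<sigma> permutes {..<n}. \<Prod>j<n. f i (\<sigma> j) (v j))"
      proof (rule sum.cong[OF refl])
        fix \<sigma> assume "\<sigma> \<in> {\<sigma>. \<sigma> permutes {..<n}}"
        then have \<sigma>: "\<sigma> permutes {..<n}"
          by simp
        show "(\<Prod>j<n. f i j (v (inv_into UNIV \<sigma> j))) = (\<Prod>j<n. f i (\<sigma> j) (v j))"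
          by (subst prod.permute[OF \<sigma>]) (simp add: permutes_inverses[OF \<sigma>] o_def)
      qed
      also have "\<dots> = (\<Sum>S\<in>Pow {..<n}. (- 1) ^ (n + card S) * (\<Prod>j<n. \<Sum>s\<in>S. f i s (v j)))"
        by (rule permanent_polarization[of "\<lambda>s j. f i s (v j)"])
      finally show ?thesis .
    qed
    have "(\<Sum>\<sigma> | \<sigma> permutes {..<n}. F (v \<circ> \<sigma>)) = (\<Sum>i<N. \<Sum>\<sigma> | \<sigma> permutes {..<n}. \<Prod>j<n. f i j (v (\<sigma> j)))"
      unfolding Ff by (subst sum.swap) simp
    note sumF = this
    have "T w = (\<Sum>i<N. c ^ d * (\<Sum>S\<in>Pow {..<n}. (- 1) ^ (n + card S) * (\<Prod>j<n. \<Sum>s\<in>S. f i s (v j))))"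
      unfolding T_def sum_distrib_left by (intro sum.cong refl) (simp add: norm)
    then show "T w = c ^ d * (\<Sum>\<sigma> | \<sigma> permutes {..<n}. F (v \<circ> \<sigma>))"
      by (simp only: sumF perm sum_distrib_left[of "c ^ d" _ "{..<N}"])
  qed
qed

lemma CP1_coords:
  "hcoord CP1 a $ 1 = coord1 a" "hcoord CP1 a $ 2 = coord0 a"
  by (simp_all add: CP1_def)

lemma CP1_proportional: "coord1 a * coord0 b = coord0 a * coord1 b \<Longrightarrow> a = b"
  by (cases a; cases b) auto

text \<open>
  Multiplication by \<open>B\<close> serves two purposes: it removes the finitely many points of \<open>Q\<close> from the
  locus where a form of multidegree \<open>\<delta>\<close> is nonzero, and it makes the multidegree constant, as is
  necessary for permuting the arguments.
\<close>

lemma separating_multiform: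
  fixes ps :: "complex with_infty list"
  defines "r \<equiv> \<lambda>ps j. hcoord CP1 (ps ! j)"
  assumes len: "length ps = n" and Q: "finite Q" "\<And>q. q \<in> Q \<Longrightarrow> length q = n \<and> q \<noteq> ps"
  obtains d \<gamma> B where "multiform n \<gamma> B" "\<And>j. j < n \<Longrightarrow> \<delta> j + \<gamma> j = d" "B (r ps) \<noteq> 0" "\<And>q. q \<in> Q \<Longrightarrow> B (r q) = 0"
proof -
  have "\<exists>\<gamma> B. multiform n \<gamma> B \<and> B (r ps) \<noteq> 0 \<and> B (r q) = 0" if "q \<in> Q" for q
  proof -
    obtain j where j: "j < n" "q ! j \<noteq> ps ! j"
      using Q(2)[OF \<open>q \<in> Q\<close>] len nth_equalityI by metis
    let ?g = "\<lambda>v :: complex^2. coord0 (q ! j) * v $ 1 + (- coord1 (q ! j)) * v $ 2"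
    have "form 1 ?g"
      by (intro form_add form_cmult form_coord)
    then have "multiform n (\<lambda>i. if i = j then 1 else 0) (\<lambda>v. ?g (v j))"
      by (rule multiform_component) (rule j)
    moreover have "?g (r ps j) \<noteq> 0" "?g (r q j) = 0"
      using j(2) CP1_proportional[of "ps ! j" "q ! j"] by (auto simp: r_def CP1_coords mult.commute)
    ultimately show ?thesis
      by (intro exI conjI)
  qed
  then obtain \<gamma> B where \<gamma>B: "\<And>q. q \<in> Q \<Longrightarrow> multiform n (\<gamma> q) (B q)" "\<And>q. q \<in> Q \<Longrightarrow> B q (r ps) \<noteq> 0"
    "\<And>q. q \<in> Q \<Longrightarrow> B q (r q) = 0"
    by metis
  define \<gamma>' where "\<gamma>' = (\<lambda>j. \<Sum>q\<in>Q. \<gamma> q j)"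
  define B' where "B' = (\<lambda>v. \<Prod>q\<in>Q. B q v)"
  define d where "d = (\<Sum>j<n. \<delta> j + \<gamma>' j)"
  have d: "\<delta> j + \<gamma>' j \<le> d" if "j < n" for j
    unfolding d_def using that by (intro member_le_sum) auto
  have "\<exists>g. form 1 g \<and> g (r ps j) \<noteq> 0" for j
  proof (cases "ps ! j")
    case (Fin x)
    then show ?thesis
      by (intro exI[of _ "\<lambda>v. v $ 2"] conjI form_coord) (simp add: r_def CP1_coords)
  next
    case Infty
    then show ?thesis
      by (intro exI[of _ "\<lambda>v. v $ 1"] conjI form_coord) (simp add: r_def CP1_coords)
  qed
  then obtain g where g: "\<And>j. form 1 (g j)" "\<And>j. g j (r ps j) \<noteq> 0"
    by metis
  define C where "C = (\<lambda>v :: nat \<Rightarrow> complex^2. \<Prod>j<n. g j (v j) ^ (d - (\<delta> j + \<gamma>' j)))"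
  have "multiform n (\<lambda>j. d - (\<delta> j + \<gamma>' j)) C"
  proof (rule multiformI[of "{()}"])
    show "form (d - (\<delta> j + \<gamma>' j)) (\<lambda>v. g j v ^ (d - (\<delta> j + \<gamma>' j)))" for j
      using form_power[OF g(1)] by simp
  qed (simp_all add: C_def)
  moreover have "multiform n \<gamma>' B'"
    unfolding \<gamma>'_def B'_def by (intro multiform_prod Q \<gamma>B)
  ultimately have "multiform n (\<lambda>j. \<gamma>' j + (d - (\<delta> j + \<gamma>' j))) (\<lambda>v. B' v * C v)"
    by (intro multiform_mult)
  then show thesis
  proof (rule that)
    show "\<delta> j + (\<gamma>' j + (d - (\<delta> j + \<gamma>' j))) = d" if "j < n" for j
      using d[OF that] by simp
    show "B' (r ps) * C (r ps) \<noteq> 0"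
      using Q(1) \<gamma>B(2) g(2) by (simp add: B'_def C_def)
    show "B' (r q) * C (r q) = 0" if "q \<in> Q" for q
      using that Q(1) \<gamma>B(3) by (auto simp: B'_def)
  qed
qed


text \<open>
  Every open set and every regular function on the symmetric power is given by forms on the \<open>n\<close>-fold
  product. Averaging such a form over the permutations could produce zero at the point under
  consideration; this is prevented by first multiplying it with a form that vanishes at all other
  points of the orbit, so that only the stabilizer contributes to the average.
\<close>

lemma morphism_to_sym_CP1:
  fixes \<mu> :: "'a \<Rightarrow> complex with_infty multiset" and r :: "'a \<Rightarrow> nat \<Rightarrow> complex^'n::finite"
    and L :: "complex^2 \<Rightarrow> (nat \<Rightarrow> complex^'n) \<Rightarrow> complex"
  assumes L: "\<And>z. multiform k \<epsilon> (L z)" and k: "0 < k"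
    and \<mu>: "\<And>p. p \<in> A \<Longrightarrow> size (\<mu> p) = n"
    and zeros: "\<And>p. p \<in> A \<Longrightarrow> \<exists>c. c \<noteq> 0 \<and>
       (\<forall>z. L z (r p) = c * (\<Prod>a\<in>#\<mu> p. z $ 1 * coord0 a - z $ 2 * coord1 a))"
  shows "morphism (zariski_space k A r) (sym_space n CP1) \<mu>"
proof -
  define X where "X = {ps :: complex with_infty list. length ps = n \<and> set ps \<subseteq> pset CP1}"
  define s where "s = (\<lambda>(ps :: complex with_infty list) (j::nat). hcoord CP1 (ps ! j))"
  have space: "power_space n CP1 = zariski_space n X s"
    unfolding power_space_def X_def s_def ..
  have X: "ps \<in> X \<longleftrightarrow> length ps = n" for ps
    by (auto simp: X_def CP1_def)
  have permute: "F (s (permute_list \<sigma> ps)) = F (s ps \<circ> \<sigma>)"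
    if "\<sigma> permutes {..<n}" "length ps = n" "multiform n \<delta> F" for \<sigma> ps \<delta> F
    by (rule multiform_depends[OF that(3)]) (use that in \<open>simp add: s_def permute_list_nth\<close>)
  \<comment> \<open>the relation \<open>F = g G\<close> with a symmetric \<open>g\<close> survives averaging over the permutations once it
    holds everywhere, which is achieved by the additional factor \<open>G\<close> in \<open>F'\<close> and \<open>G'\<close>\<close>
  have descend: "\<exists>\<epsilon>' S T. multiform k \<epsilon>' S \<and> multiform k \<epsilon>' T \<and> T (r p) \<noteq> 0 \<and>
      (\<forall>q\<in>A. T (r q) \<noteq> 0 \<longrightarrow> (\<exists>qs. mset qs = \<mu> q \<and> G (s qs) \<noteq> 0) \<and> g (\<mu> q) = S (r q) / T (r q))"
    if p: "p \<in> A" and ps: "mset ps = \<mu> p" and F: "multiform n \<delta> F" and G: "multiform n \<delta> G"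
      and Gps: "G (s ps) \<noteq> 0"
      and g: "\<forall>qs. length qs = n \<and> G (s qs) \<noteq> 0 \<longrightarrow> F (s qs) = g (mset qs) * G (s qs)"
    for p ps \<delta> F G g
  proof -
    have len: "length qs = n" if "mset qs = \<mu> q" "q \<in> A" for qs q
      using that \<mu> by (metis size_mset)
    define Q where "Q = {permute_list \<sigma> ps | \<sigma>. \<sigma> permutes {..<n} \<and> permute_list \<sigma> ps \<noteq> ps}"
    have "Q \<subseteq> (\<lambda>\<sigma>. permute_list \<sigma> ps) ` {\<sigma>. \<sigma> permutes {..<n}}"
      unfolding Q_def by auto
    then have fQ: "finite Q"
      by (rule finite_subset) (simp add: finite_permutations)
    have Q: "length q = n \<and> q \<noteq> ps" if "q \<in> Q" for q
      using that len[OF ps p] by (auto simp: Q_def)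
    obtain d \<gamma> B where B: "multiform n \<gamma> B" "\<And>j. j < n \<Longrightarrow> (\<delta> j + \<delta> j) + \<gamma> j = d"
      "B (s ps) \<noteq> 0" "\<And>q. q \<in> Q \<Longrightarrow> B (s q) = 0"
      unfolding s_def by (rule separating_multiform[OF len[OF ps p] fQ Q]) (assumption, rule that[unfolded s_def])
    define F' where "F' = (\<lambda>v. F v * G v * B v)"
    define G' where "G' = (\<lambda>v. G v * G v * B v)"
    have F': "multiform n (\<lambda>_. d) F'" and G': "multiform n (\<lambda>_. d) G'"
      unfolding F'_def G'_def
      by (rule multiform_cong[OF multiform_mult[OF multiform_mult[OF _ G] B(1)]], rule F G, simp add: B(2))+
    obtain S where S: "multiform k (\<lambda>j. d * \<epsilon> j) S"
      "\<And>w c v. \<forall>z. L z w = c * (\<Prod>j<n. z $ 1 * v j $ 2 - z $ 2 * v j $ 1) \<Longrightarrow>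
         S w = c ^ d * (\<Sum>\<sigma> | \<sigma> permutes {..<n}. F' (v \<circ> \<sigma>))"
      by (rule symmetrization_descends[OF F' L k]) (rule that)
    obtain T where T: "multiform k (\<lambda>j. d * \<epsilon> j) T"
      "\<And>w c v. \<forall>z. L z w = c * (\<Prod>j<n. z $ 1 * v j $ 2 - z $ 2 * v j $ 1) \<Longrightarrow>
         T w = c ^ d * (\<Sum>\<sigma> | \<sigma> permutes {..<n}. G' (v \<circ> \<sigma>))"
      by (rule symmetrization_descends[OF G' L k]) (rule that)
    have ST: "\<exists>c. c \<noteq> 0 \<and> S (r q) = c * (\<Sum>\<sigma> | \<sigma> permutes {..<n}. F' (s (permute_list \<sigma> qs)))
        \<and> T (r q) = c * (\<Sum>\<sigma> | \<sigma> permutes {..<n}. G' (s (permute_list \<sigma> qs)))"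
      if q: "q \<in> A" "mset qs = \<mu> q" for q qs
    proof -
      obtain c where c: "c \<noteq> 0" "\<forall>z. L z (r q) = c * (\<Prod>a\<in>#\<mu> q. z $ 1 * coord0 a - z $ 2 * coord1 a)"
        using zeros[OF q(1)] by (elim exE conjE) (rule that)
      have Lz: "\<forall>z. L z (r q) = c * (\<Prod>j<n. z $ 1 * s qs j $ 2 - z $ 2 * s qs j $ 1)"
        unfolding c(2)[rule_format] q(2)[symmetric] prod_mset_nth len[OF q(2,1)] s_def CP1_coords by simp
      have "(\<Sum>\<sigma> | \<sigma> permutes {..<n}. H (s qs \<circ> \<sigma>)) = (\<Sum>\<sigma> | \<sigma> permutes {..<n}. H (s (permute_list \<sigma> qs)))"
        if "multiform n (\<lambda>_. d) H" for H
        by (intro sum.cong refl, rule permute[symmetric, OF _ len[OF q(2,1)] that]) simp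
      then show ?thesis
        using S(2)[OF Lz] T(2)[OF Lz] c(1) F' G' by (intro exI[of _ "c ^ d"]) simp
    qed
    have F'G': "F' (s qs) = g (mset qs) * G' (s qs)" if "length qs = n" for qs
      using g that by (cases "G (s qs) = 0") (auto simp: F'_def G'_def)
    have "T (r p) \<noteq> 0"
    proof -
      have G'ps: "G' (s ps) \<noteq> 0"
        using Gps B(3) by (simp add: G'_def)
      have "G' (s (permute_list \<sigma> ps)) = (if permute_list \<sigma> ps = ps then G' (s ps) else 0)"
        if "\<sigma> permutes {..<n}" for \<sigma>
        using B(4)[of "permute_list \<sigma> ps"] that by (auto simp: Q_def G'_def)
      then have "(\<Sum>\<sigma> | \<sigma> permutes {..<n}. G' (s (permute_list \<sigma> ps)))
          = (\<Sum>\<sigma> | \<sigma> permutes {..<n}. if permute_list \<sigma> ps = ps then G' (s ps) else 0)"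
        by simp
      also have "\<dots> = of_nat (card {\<sigma>. \<sigma> permutes {..<n} \<and> permute_list \<sigma> ps = ps}) * G' (s ps)"
        by (simp add: sum.inter_filter[symmetric] finite_permutations)
      also have "\<dots> \<noteq> 0"
      proof -
        have "id \<in> {\<sigma>. \<sigma> permutes {..<n} \<and> permute_list \<sigma> ps = ps}"
          by (simp add: permutes_id)
        moreover have "finite {\<sigma>. \<sigma> permutes {..<n} \<and> permute_list \<sigma> ps = ps}"
          by (rule finite_subset[OF _ finite_permutations[of "{..<n}"]]) auto
        ultimately have "card {\<sigma>. \<sigma> permutes {..<n} \<and> permute_list \<sigma> ps = ps} \<noteq> 0"
          using card_gt_0_iff by blast
        then show ?thesis
          using G'ps by simp
      qed
      finally show ?thesis
        using ST[OF p ps] by auto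
    qed
    moreover have "(\<exists>qs. mset qs = \<mu> q \<and> G (s qs) \<noteq> 0) \<and> g (\<mu> q) = S (r q) / T (r q)"
      if q: "q \<in> A" "T (r q) \<noteq> 0" for q
    proof -
      obtain qs where qs: "mset qs = \<mu> q"
        using ex_mset by blast
      obtain c where c: "c \<noteq> 0" "S (r q) = c * (\<Sum>\<sigma> | \<sigma> permutes {..<n}. F' (s (permute_list \<sigma> qs)))"
        "T (r q) = c * (\<Sum>\<sigma> | \<sigma> permutes {..<n}. G' (s (permute_list \<sigma> qs)))"
        using ST[OF q(1) qs] by (elim exE conjE) (rule that)
      have mset: "mset (permute_list \<sigma> qs) = \<mu> q" if "\<sigma> permutes {..<n}" for \<sigma>
        using mset_permute_list[of \<sigma> qs] that len[OF qs q(1)] qs by simp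
      have "(\<Sum>\<sigma> | \<sigma> permutes {..<n}. G' (s (permute_list \<sigma> qs))) \<noteq> 0"
        using c(3) q(2) by auto
      then obtain \<sigma> where \<sigma>: "\<sigma> permutes {..<n}" "G' (s (permute_list \<sigma> qs)) \<noteq> 0"
        by (metis (mono_tags, lifting) mem_Collect_eq sum.neutral)
      have "G (s (permute_list \<sigma> qs)) \<noteq> 0"
        using \<sigma>(2) by (auto simp: G'_def)
      moreover have "S (r q) = g (\<mu> q) * T (r q)"
      proof -
        have "(\<Sum>\<sigma> | \<sigma> permutes {..<n}. F' (s (permute_list \<sigma> qs)))
            = (\<Sum>\<sigma> | \<sigma> permutes {..<n}. g (\<mu> q) * G' (s (permute_list \<sigma> qs)))"
          by (rule sum.cong[OF refl]) (use F'G' mset len[OF qs q(1)] in auto)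
        then show ?thesis
          by (simp add: c sum_distrib_left mult_ac)
      qed
      ultimately show ?thesis
        using q(2) mset[OF \<sigma>(1)] by (intro conjI exI[of _ "permute_list \<sigma> qs"]) auto
    qed
    ultimately show ?thesis
      by (intro exI[of _ "\<lambda>j. d * \<epsilon> j"] exI[of _ S] exI[of _ T] conjI ballI impI S T) auto
  qed
  show ?thesis
    unfolding morphism_def
  proof (intro conjI ballI)
    show "\<mu> \<in> points (zariski_space k A r) \<rightarrow> points (sym_space n CP1)"
      using \<mu> by (auto simp: zariski_space_def sym_space_def CP1_def)
    fix V assume "V \<in> opens (sym_space n CP1)"
    then have V: "{ps \<in> X. mset ps \<in> V} \<in> zariski_opens n X s"
      by (simp add: sym_space_def space) (simp add: zariski_space_def)
    have "{x \<in> A. \<mu> x \<in> V} \<in> zariski_opens k A r"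
    proof (rule zariski_opensI)
      fix p assume "p \<in> {x \<in> A. \<mu> x \<in> V}"
      then have p: "p \<in> A" "\<mu> p \<in> V"
        by auto
      obtain ps where ps: "mset ps = \<mu> p"
        using ex_mset by blast
      have "ps \<in> {ps \<in> X. mset ps \<in> V}"
        using p ps \<mu> X by (metis (mono_tags, lifting) mem_Collect_eq size_mset)
      then obtain \<delta> G where G: "multiform n \<delta> G" "G (s ps) \<noteq> 0"
        "\<And>q. q \<in> X \<Longrightarrow> G (s q) \<noteq> 0 \<Longrightarrow> q \<in> {ps \<in> X. mset ps \<in> V}"
        by (rule zariski_opensE[OF V]) (rule that)
      obtain \<epsilon>' S T where T: "multiform k \<epsilon>' S" "multiform k \<epsilon>' T" "T (r p) \<noteq> 0"
        "\<forall>q\<in>A. T (r q) \<noteq> 0 \<longrightarrow> (\<exists>qs. mset qs = \<mu> q \<and> G (s qs) \<noteq> 0) \<and> 1 = S (r q) / T (r q)"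
      proof -
        have "\<forall>qs. length qs = n \<and> G (s qs) \<noteq> 0 \<longrightarrow> G (s qs) = 1 * G (s qs)"
          by simp
        from descend[OF p(1) ps G(1) G(1) G(2), of "\<lambda>_. 1", OF this] show thesis
          by (elim exE conjE) (rule that)
      qed
      have "q \<in> {x \<in> A. \<mu> x \<in> V}" if q: "q \<in> A" "T (r q) \<noteq> 0" for q
      proof -
        obtain qs where qs: "mset qs = \<mu> q" "G (s qs) \<noteq> 0"
          using T(4) q by blast
        then have "qs \<in> X"
          using X \<mu>[OF q(1)] by (metis size_mset)
        then show ?thesis
          using G(3)[OF _ qs(2)] qs(1) q(1) by auto
      qed
      then show "\<exists>\<delta> F. multiform k \<delta> F \<and> F (r p) \<noteq> 0 \<and> (\<forall>q\<in>A. F (r q) \<noteq> 0 \<longrightarrow> q \<in> {x \<in> A. \<mu> x \<in> V})"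
        by (intro exI[of _ \<epsilon>'] exI[of _ T] conjI T) blast
    qed auto
    then show "{x \<in> points (zariski_space k A r). \<mu> x \<in> V} \<in> opens (zariski_space k A r)"
      by (simp add: zariski_space_def)
    fix g assume "g \<in> regular (sym_space n CP1) V"
    then have g: "g \<circ> mset \<in> regular (zariski_space n X s) {ps \<in> X. mset ps \<in> V}"
      by (simp add: sym_space_def space) (simp add: zariski_space_def)
    have "g \<circ> \<mu> \<in> regular (zariski_space k A r) {x \<in> A. \<mu> x \<in> V}"
    proof (rule regularI)
      fix p assume "p \<in> {x \<in> A. \<mu> x \<in> V}"
      then have p: "p \<in> A" "\<mu> p \<in> V"
        by auto
      obtain ps where ps: "mset ps = \<mu> p"
        using ex_mset by blast
      have "ps \<in> {ps \<in> X. mset ps \<in> V}"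
        using p ps \<mu> X by (metis (mono_tags, lifting) mem_Collect_eq size_mset)
      then obtain \<delta> F G where FG: "multiform n \<delta> F" "multiform n \<delta> G" "G (s ps) \<noteq> 0"
        "\<And>q. q \<in> X \<Longrightarrow> G (s q) \<noteq> 0 \<Longrightarrow> q \<in> {ps \<in> X. mset ps \<in> V}"
        "\<And>q. q \<in> X \<Longrightarrow> G (s q) \<noteq> 0 \<Longrightarrow> (g \<circ> mset) q = F (s q) / G (s q)"
        by (rule regularE[OF g]) (rule that)
      have "\<forall>qs. length qs = n \<and> G (s qs) \<noteq> 0 \<longrightarrow> F (s qs) = g (mset qs) * G (s qs)"
        using FG(5) X by simp
      from descend[OF p(1) ps FG(1-3), of g, OF this]
      obtain \<epsilon>' S T where T: "multiform k \<epsilon>' S" "multiform k \<epsilon>' T" "T (r p) \<noteq> 0"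
        "\<forall>q\<in>A. T (r q) \<noteq> 0 \<longrightarrow> (\<exists>qs. mset qs = \<mu> q \<and> G (s qs) \<noteq> 0) \<and> g (\<mu> q) = S (r q) / T (r q)"
        by (elim exE conjE) (rule that)
      have "q \<in> {x \<in> A. \<mu> x \<in> V}" if q: "q \<in> A" "T (r q) \<noteq> 0" for q
      proof -
        obtain qs where qs: "mset qs = \<mu> q" "G (s qs) \<noteq> 0"
          using T(4) q by blast
        then have "qs \<in> X"
          using X \<mu>[OF q(1)] by (metis size_mset)
        then show ?thesis
          using FG(4)[OF _ qs(2)] qs(1) q(1) by auto
      qed
      then show "\<exists>\<delta> F G. multiform k \<delta> F \<and> multiform k \<delta> G \<and> G (r p) \<noteq> 0 \<and>
          (\<forall>q\<in>A. G (r q) \<noteq> 0 \<longrightarrow> q \<in> {x \<in> A. \<mu> x \<in> V} \<and> (g \<circ> \<mu>) q = F (r q) / G (r q))"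
        using T(4) by (intro exI[of _ \<epsilon>'] exI[of _ S] exI[of _ T] conjI T) auto
    qed auto
    then show "g \<circ> \<mu> \<in> regular (zariski_space k A r) {x \<in> points (zariski_space k A r). \<mu> x \<in> V}"
      by (simp add: zariski_space_def)
  qed
qed

section \<open>Associativity of the chord-and-tangent law\<close>

text \<open>
  The coordinate ring \<open>\<complex>[X,Y] / (Y\<^sup>2 - X\<^sup>3 - X)\<close> of the affine curve for \<open>b = 1\<close>: the element
  \<open>CF f g\<close> stands for \<open>f(X) + g(X) Y\<close>. Fixing \<open>b\<close> allows the ring to be a type.
\<close>

definition cubic :: "complex poly" where
  "cubic = [:0, 1, 0, 1:]"

datatype curve_fun = CF (cpart: "complex poly") (ypart: "complex poly")

instantiation curve_fun :: comm_ring_1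
begin
definition "0 = CF 0 0"
definition "1 = CF 1 0"
definition "f + g = CF (cpart f + cpart g) (ypart f + ypart g)"
definition "f - g = CF (cpart f - cpart g) (ypart f - ypart g)"
definition "- f = CF (- cpart f) (- ypart f)" for f :: curve_fun
definition "f * g = CF (cpart f * cpart g + cubic * ypart f * ypart g)
                       (cpart f * ypart g + ypart f * cpart g)"
instance
  by standard
    (simp_all add: zero_curve_fun_def one_curve_fun_def plus_curve_fun_def minus_curve_fun_def
      uminus_curve_fun_def times_curve_fun_def algebra_simps)
end

lemmas curve_fun_defs = zero_curve_fun_def one_curve_fun_def plus_curve_fun_def
  minus_curve_fun_def uminus_curve_fun_def times_curve_fun_def

definition curve_norm :: "curve_fun \<Rightarrow> complex poly" where
  "curve_norm f = cpart f ^ 2 - cubic * ypart f ^ 2"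

lemma curve_norm_mult: "curve_norm (f * g) = curve_norm f * curve_norm g"
  by (simp add: curve_norm_def times_curve_fun_def power2_eq_square algebra_simps)

text \<open>
  The degrees of \<open>a\<^sup>2\<close> and \<open>(X\<^sup>3 + X) c\<^sup>2\<close> have different parities, so their leading terms cannot cancel.
  Hence the ring is a domain, and a norm of degree less than three comes from a polynomial in \<open>X\<close> alone.
\<close>

lemma degree_square_minus_cubic:
  assumes "c \<noteq> 0"
  shows "degree (a ^ 2 - cubic * c ^ 2) \<ge> 3" "a ^ 2 - cubic * c ^ 2 \<noteq> 0"
proof -
  have cub: "cubic \<noteq> 0" "degree cubic = 3"
    by (simp_all add: cubic_def)
  have dc: "degree (cubic * c ^ 2) = 3 + 2 * degree c"
    using assms cub by (simp add: degree_mult_eq degree_power_eq)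
  have da: "degree (a ^ 2) = 2 * degree a"
    by (cases "a = 0") (simp_all add: degree_power_eq)
  have "degree (a ^ 2) \<noteq> degree (cubic * c ^ 2)"
    unfolding dc da by presburger
  then consider "degree (a ^ 2) < degree (- (cubic * c ^ 2))" | "degree (- (cubic * c ^ 2)) < degree (a ^ 2)"
    by fastforce
  then show "degree (a ^ 2 - cubic * c ^ 2) \<ge> 3"
  proof cases
    case 1
    then show ?thesis
      using degree_add_eq_right[OF 1] dc by simp
  next
    case 2
    then show ?thesis
      using degree_add_eq_left[OF 2] dc by simp
  qed
  then show "a ^ 2 - cubic * c ^ 2 \<noteq> 0"
    by auto
qed

lemma curve_norm_eq_0 [simp]: "curve_norm f = 0 \<longleftrightarrow> f = 0"
proof
  assume "curve_norm f = 0"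
  then show "f = 0"
    using degree_square_minus_cubic(2)[of "ypart f" "cpart f"]
    by (cases f) (fastforce simp: curve_norm_def zero_curve_fun_def)
qed (simp add: curve_norm_def zero_curve_fun_def)

instance curve_fun :: idom
proof
  fix f g :: curve_fun
  assume "f \<noteq> 0" "g \<noteq> 0"
  then show "f * g \<noteq> 0"
    by (metis curve_norm_eq_0 curve_norm_mult mult_eq_0_iff)
qed

definition eval_at :: "complex \<times> complex \<Rightarrow> curve_fun \<Rightarrow> complex" where
  "eval_at p f = poly (cpart f) (fst p) + poly (ypart f) (fst p) * snd p"

lemma eval_at_simps:
  assumes "y ^ 2 = x ^ 3 + x"
  shows "eval_at (x, y) (f + g) = eval_at (x, y) f + eval_at (x, y) g"
    "eval_at (x, y) (f * g) = eval_at (x, y) f * eval_at (x, y) g"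
proof -
  have "poly cubic x = y * y"
    using assms by (simp add: cubic_def power2_eq_square power3_eq_cube algebra_simps)
  then show "eval_at (x, y) (f * g) = eval_at (x, y) f * eval_at (x, y) g"
    by (simp add: eval_at_def times_curve_fun_def algebra_simps)
qed (simp add: eval_at_def plus_curve_fun_def algebra_simps)

text \<open>
  A commutative ring as a module over itself: the submodules are the ideals, and the ideal generated by
  \<open>A\<close> is \<open>idl.span A\<close>. The product of the ideals generated by \<open>A\<close> and \<open>B\<close> is generated by the set
  \<open>A * B\<close> of products, so ideals can be multiplied through their generators.
\<close>

interpretation idl: module "(*) :: 'a::comm_ring_1 \<Rightarrow> 'a \<Rightarrow> 'a"
  by standard (simp_all add: algebra_simps)

declare idl.scale_scale [simp del]

lemma span_times_left:
  fixes A :: "'a::comm_ring_1 set"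
  assumes "a \<in> idl.span A" "b \<in> B"
  shows "a * b \<in> idl.span (A * B)"
  using assms(1)
proof (induction rule: idl.span_induct_alt)
  case (step c x y)
  have "x * b \<in> idl.span (A * B)"
    using step.hyps assms(2) by (intro idl.span_base) (auto simp: set_times_def)
  then have "c * (x * b) \<in> idl.span (A * B)"
    by (rule idl.span_scale)
  then have "c * (x * b) + y * b \<in> idl.span (A * B)"
    using step.IH by (rule idl.span_add)
  moreover have "(c * x + y) * b = c * (x * b) + y * b"
    by (simp only: distrib_right mult.assoc)
  ultimately show ?case
    by simp
qed (simp add: idl.span_zero)

lemma span_times_cong:
  fixes A :: "'a::comm_ring_1 set"
  assumes "idl.span A = idl.span A'"
  shows "idl.span (A * B) = idl.span (A' * B)"
proof -
  have "idl.span (A * B) \<subseteq> idl.span (A' * B)" if "idl.span A = idl.span A'" for A A' :: "'a set"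
  proof (rule idl.span_minimal)
    show "A * B \<subseteq> idl.span (A' * B)"
      using that idl.span_base span_times_left by (fastforce simp: set_times_def)
  qed simp
  then show ?thesis
    using assms by blast
qed

text \<open>
  Equality of the classes of the generated ideals in the ideal class group.
\<close>

definition same_class :: "'a::idom set \<Rightarrow> 'a set \<Rightarrow> bool" where
  "same_class A B \<longleftrightarrow> (\<exists>f g. f \<noteq> 0 \<and> g \<noteq> 0 \<and> idl.span ({f} * A) = idl.span ({g} * B))"

lemma same_class_sym: "same_class A B \<Longrightarrow> same_class B A"
  unfolding same_class_def by metis

lemma same_class_trans:
  assumes "same_class A B" "same_class B C"
  shows "same_class A C"
proof -
  obtain f g f' g' where nz: "f \<noteq> 0" "g \<noteq> 0" "f' \<noteq> 0" "g' \<noteq> 0"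
    and AB: "idl.span ({f} * A) = idl.span ({g} * B)"
    and BC: "idl.span ({f'} * B) = idl.span ({g'} * C)"
    using assms unfolding same_class_def by metis
  have s: "{a * b} = {a} * {b}" for a b :: 'a
    by (simp add: set_times_def)
  have "idl.span ({f * f'} * A) = idl.span (({f} * A) * {f'})"
    unfolding s by (simp only: ac_simps)
  also have "\<dots> = idl.span (({f'} * B) * {g})"
    unfolding span_times_cong[OF AB] by (simp only: ac_simps)
  also have "\<dots> = idl.span ({g * g'} * C)"
    unfolding span_times_cong[OF BC] s by (simp only: ac_simps)
  finally show ?thesis
    unfolding same_class_def using nz by (metis mult_eq_0_iff)
qed

lemma same_class_mult:
  assumes "same_class A B"
  shows "same_class (A * C) (B * C)"
proof -
  obtain f g where nz: "f \<noteq> 0" "g \<noteq> 0" and AB: "idl.span ({f} * A) = idl.span ({g} * B)"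
    using assms unfolding same_class_def by metis
  have "idl.span ({f} * (A * C)) = idl.span ({g} * (B * C))"
    using span_times_cong[OF AB, of C] by (simp only: ac_simps)
  then show ?thesis
    unfolding same_class_def using nz by metis
qed

text \<open>
  Generators of the maximal ideal of an affine point; the point at infinity corresponds to the unit
  ideal.
\<close>

primrec point_gens :: "ell_point \<Rightarrow> curve_fun set" where
  "point_gens (Fin p) = {CF [:- fst p, 1:] 0, CF [:- snd p:] 1}"
| "point_gens Infty = {1}"

text \<open>
  The ideal of an affine point is not principal. If it were generated by \<open>h\<close>, the norm of \<open>h\<close> would
  divide that of \<open>X - x\<close>, so it would have degree at most two and \<open>h\<close> would be a polynomial in
  \<open>X\<close> alone. But \<open>h\<close> also divides \<open>Y - y\<close>, so it is constant, although it vanishes at the point.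
\<close>

lemma same_class_point_gens_one:
  assumes P: "P \<in> ell_points 1" and "same_class (point_gens P) {1}"
  shows "P = Infty"
proof (rule ccontr)
  assume "P \<noteq> Infty"
  then obtain x y where Pxy: "P = Fin (x, y)" and E: "y ^ 2 = x ^ 3 + x"
    using P by (auto simp: ell_points_def)
  define A where "A = CF [:- x, 1:] 0"
  define B where "B = CF [:- y:] 1"
  have "{f} * point_gens P = {f * A, f * B}" "{f} * {1} = {f}" for f
    by (auto simp: set_times_def A_def B_def Pxy)
  then obtain f g where nz: "f \<noteq> 0" "g \<noteq> 0"
    and eq: "idl.span ({f * A, f * B}) = idl.span {g}"
    using assms(2) unfolding same_class_def by metis
  have "g \<in> idl.span {f * A, f * B}"
    using eq idl.span_base by blast
  then obtain u where "g - u * (f * A) \<in> idl.span {f * B}"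
    by (auto simp: idl.span_breakdown_eq)
  then obtain v where "g - u * (f * A) = v * (f * B)"
    by (auto simp: idl.span_singleton)
  then have "g = f * (u * A + v * B)"
    by (simp only: diff_eq_eq) (simp only: distrib_left ac_simps)
  then obtain h where h: "g = f * h" "h = u * A + v * B"
    by blast
  have "f * A \<in> idl.span {g}" "f * B \<in> idl.span {g}"
    using eq idl.span_base by blast+
  then obtain k k' where "f * A = k * g" "f * B = k' * g"
    by (auto simp: idl.span_singleton)
  then have k: "A = k * h" "B = k' * h"
    using nz unfolding h(1) by (metis mult.left_commute mult_cancel_left)+
  have A0: "A \<noteq> 0"
    by (simp add: A_def zero_curve_fun_def)
  have "curve_norm A = curve_norm k * curve_norm h"
    by (simp add: k(1) curve_norm_mult)
  moreover have "degree (curve_norm A) = 2"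
    by (simp add: A_def curve_norm_def degree_power_eq)
  moreover have "curve_norm A \<noteq> 0"
    using A0 by simp
  ultimately have "degree (curve_norm h) \<le> 2"
    by (metis degree_mult_eq le_add2 mult_eq_0_iff)
  then have yh: "ypart h = 0"
    using degree_square_minus_cubic(1)[of "ypart h" "cpart h"]
    by (fastforce simp: curve_norm_def)
  then have "ypart B = ypart k' * cpart h"
    by (simp add: k(2) times_curve_fun_def)
  then have "cpart h dvd 1"
    by (metis B_def curve_fun.sel(2) dvd_triv_right)
  then obtain c where c: "cpart h = [:c:]" "c \<noteq> 0"
    unfolding is_unit_poly_iff using dvd_0_left zero_neq_one by metis
  have "eval_at (x, y) h = 0"
    unfolding h(2) eval_at_simps[OF E] by (simp add: eval_at_def A_def B_def)
  then show False
    using c yh by (simp add: eval_at_def)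
qed

lemma span_point_gens_line:
  assumes "y = l * x + m"
  shows "idl.span (point_gens (Fin (x, y))) = idl.span {CF [:- x, 1:] 0, CF [:- m, - l:] 1}"
proof -
  define A where "A = CF [:- x, 1:] 0"
  define B where "B = CF [:- y:] 1"
  define L where "L = CF [:- m, - l:] 1"
  have 1: "L = (- CF [:l:] 0) * A + 1 * B" and 2: "B = CF [:l:] 0 * A + 1 * L"
    by (simp_all add: A_def B_def L_def curve_fun_defs assms)
  have sp: "a * f + c * g \<in> idl.span {f, g}" for a c f g :: curve_fun
    by (intro idl.span_add idl.span_scale idl.span_base) auto
  have "L \<in> idl.span {A, B}" "B \<in> idl.span {A, L}"
    by (subst 1, rule sp) (subst 2, rule sp)
  then have "idl.span {A, B} = idl.span {A, L}"
    by (intro idl.span_eq[THEN iffD2]) (auto intro: idl.span_base)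
  then show ?thesis
    by (simp add: A_def B_def L_def)
qed

lemma cubic_no_double_root:
  assumes "poly cubic x = 0" "poly (pderiv cubic) x = 0"
  shows False
proof -
  have 1: "x * (1 + x * x) = 0" and "1 + x * (x * 3) = 0"
    using assms by (simp_all add: cubic_def pderiv_pCons)
  then have 2: "1 + 3 * (x * x) = 0"
    by (simp only: ac_simps)
  from 1 consider "x = 0" | "1 + x * x = 0"
    unfolding mult_eq_0_iff by blast
  then show False
  proof cases
    case 1
    with 2 show False
      by simp
  next
    case 2
    then have "x * x = -1"
      by (metis add.commute eq_neg_iff_add_eq_0)
    with \<open>1 + 3 * (x * x) = 0\<close> show False
      by simp
  qed
qed

text \<open>
  The elements listed in \<open>mem\<close> are the products of the generators of the ideals of three collinear
  points, divided by the equation of the line and reduced modulo its conjugate to polynomials in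
  \<open>X\<close>. That they generate
  the unit ideal is where the smoothness of the curve enters: a common zero would be a point of
  order two at which the line meets the curve twice, hence a double zero of \<open>X\<^sup>3 + X\<close>.
\<close>

lemma chord_ideal_one:
  fixes x1 x2 x3 l m :: complex and K :: "curve_fun set"
  defines "A \<equiv> \<lambda>x. CF [:- x, 1:] 0" and "M \<equiv> CF [:m, l:] 0"
  assumes K: "idl.subspace K"
    and vieta: "cubic - [:m, l:] ^ 2 = [:- x1, 1:] * [:- x2, 1:] * [:- x3, 1:]"
    and mem: "A x1 * A x2 \<in> K" "A x1 * A x3 \<in> K" "A x2 * A x3 \<in> K"
      "A x1 * M \<in> K" "A x2 * M \<in> K" "A x3 * M \<in> K" "M * M \<in> K"
  shows "1 \<in> K"
proof -
  have unit: "1 \<in> K" if "CF [:c:] 0 \<in> K" "c \<noteq> 0" for c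
    using idl.subspace_scale[OF K that(1), of "CF [:1 / c:] 0"] that(2)
    by (simp add: curve_fun_defs one_pCons)
  have cancel: "f \<in> K" if "CF [:c:] 0 * f \<in> K" "c \<noteq> 0" for f c
    using idl.subspace_scale[OF K that(1), of "CF [:1 / c:] 0"] that(2)
    by (cases f) (simp add: curve_fun_defs)
  have M: "M = CF [:l:] 0 * A x + CF [:l * x + m:] 0" for x
    by (simp add: A_def M_def curve_fun_defs)
  have AA: "A x = A x' + CF [:x' - x:] 0" for x x'
    by (simp add: A_def curve_fun_defs)
  have double: "l * x + m \<noteq> 0" if "cubic = [:m, l:] ^ 2 + [:- x, 1:] ^ 2 * [:- x', 1:]" for x x'
  proof
    assume "l * x + m = 0"
    then have 0: "poly [:m, l:] x = 0"
      by (simp add: algebra_simps)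
    have "poly cubic x = 0"
      by (subst that) (simp only: poly_add poly_mult poly_power 0, simp)
    moreover have "poly (pderiv cubic) x = 0"
      by (subst that) (simp only: power2_eq_square pderiv_mult pderiv_add poly_add poly_mult 0, simp)
    ultimately have "poly cubic x = 0" "poly (pderiv cubic) x = 0"
      by blast+
    then show False
      by (rule cubic_no_double_root)
  qed
  have distinct: "1 \<in> K"
    if ne: "a \<noteq> b" and v: "cubic - [:m, l:] ^ 2 = [:- a, 1:] * [:- b, 1:] * [:- c, 1:]"
      and mem: "A a * A b \<in> K" "A a * A c \<in> K" "A b * A c \<in> K" "A a * M \<in> K" "A b * M \<in> K"
    for a b c
  proof -
    have "CF [:b - a:] 0 * A c = A a * A c - A b * A c" "CF [:b - a:] 0 * M = A a * M - A b * M"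
      by (subst AA[of a b]; simp add: algebra_simps)+
    then have Kc: "A c \<in> K" and KM: "M \<in> K"
      using cancel[of "b - a"] ne idl.subspace_diff[OF K mem(2) mem(3)]
        idl.subspace_diff[OF K mem(4) mem(5)] by simp_all
    have y: "CF [:l * c + m:] 0 \<in> K"
      using idl.subspace_diff[OF K KM idl.subspace_scale[OF K Kc, of "CF [:l:] 0"]]
      by (subst (asm) M[of c]) simp
    have "A a * A b - (A b + CF [:c - a:] 0) * A c = CF [:(c - a) * (c - b):] 0"
      by (simp add: A_def curve_fun_defs algebra_simps)
    then have z: "CF [:(c - a) * (c - b):] 0 \<in> K"
      using idl.subspace_diff[OF K mem(1) idl.subspace_scale[OF K Kc]] by metis
    show ?thesis
    proof (cases "c = a \<or> c = b")
      case True
      then obtain x' where "[:- a, 1:] * [:- b, 1:] * [:- c, 1:] = [:- c, 1:] ^ 2 * [:- x', 1:]"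
      proof
        assume "c = a"
        then show ?thesis
          by (intro that[of b]) (simp only: power2_eq_square ac_simps)
      next
        assume "c = b"
        then show ?thesis
          by (intro that[of a]) (simp only: power2_eq_square ac_simps)
      qed
      then have "cubic = [:m, l:] ^ 2 + [:- c, 1:] ^ 2 * [:- x', 1:]"
        using v by (simp only: diff_eq_eq add.commute)
      then show ?thesis
        using unit[OF y] double by blast
    qed (use unit[OF z] in auto)
  qed
  consider "x1 \<noteq> x2" | "x1 \<noteq> x3" | "x1 = x2" "x1 = x3"
    by blast
  then show ?thesis
  proof cases
    case 1
    then show ?thesis
      using distinct[OF 1 vieta] mem by (simp add: mult.commute)
  next
    case 2
    have v: "cubic - [:m, l:] ^ 2 = [:- x1, 1:] * [:- x3, 1:] * [:- x2, 1:]"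
      using vieta by (simp only: mult.assoc mult.commute[of "[:- x3, 1:]"])
    show ?thesis
      using distinct[OF 2 v] mem by (simp add: mult.commute)
  next
    case 3
    have "cubic = [:m, l:] ^ 2 + [:- x1, 1:] ^ 2 * [:- x1, 1:]"
      using vieta unfolding diff_eq_eq 3[symmetric] power2_eq_square[of "[:- x1, 1:]"]
      by (simp only: add.commute)
    then have ne: "l * x1 + m \<noteq> 0"
      by (rule double)
    have "CF [:l * x1 + m:] 0 * A x1 = A x1 * M - CF [:l:] 0 * (A x1 * A x1)"
      unfolding M[of x1] distrib_left
      by (simp only: ac_simps add_diff_cancel_left' add_diff_cancel_right')
    then have KA: "A x1 \<in> K"
      using cancel[OF _ ne, of "A x1"] mem(1,4) 3(1) K
      by (simp add: idl.subspace_diff idl.subspace_scale)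
    have "CF [:(l * x1 + m) * (l * x1 + m):] 0
        = M * M - (M + CF [:l * x1 + m:] 0) * CF [:l:] 0 * A x1"
      by (simp add: A_def M_def curve_fun_defs algebra_simps)
    then have "CF [:(l * x1 + m) * (l * x1 + m):] 0 \<in> K"
      using KA mem(7) K by (metis idl.subspace_diff idl.subspace_scale)
    then show ?thesis
      using unit ne by (meson mult_eq_0_iff)
  qed
qed

text \<open>
  The divisor of a line: the ideals of its three intersection points multiply to the principal ideal
  of its equation. All products of generators are multiples of the equation \<open>L\<close>, since
  \<open>(X - x\<^sub>1) (X - x\<^sub>2) (X - x\<^sub>3) = L' L\<close> with the conjugate \<open>L'\<close> of \<open>L\<close>; the quotients generate the
  unit ideal by the preceding lemma.
\<close>

lemma span_collinear_points:
  assumes y: "y1 = l * x1 + m" "y2 = l * x2 + m" "y3 = l * x3 + m"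
    and vieta: "cubic - [:m, l:] ^ 2 = [:- x1, 1:] * [:- x2, 1:] * [:- x3, 1:]"
  shows "idl.span (point_gens (Fin (x1, y1)) * point_gens (Fin (x2, y2)) * point_gens (Fin (x3, y3)))
     = idl.span {CF [:- m, - l:] 1}"
proof -
  define A where "A = (\<lambda>x. CF [:- x, 1:] 0)"
  define L where "L = CF [:- m, - l:] 1"
  define L' where "L' = CF [:m, l:] 1"
  define M where "M = CF [:m, l:] 0"
  define G where "G = {A x1, L} * {A x2, L} * {A x3, L}"
  have "idl.span (point_gens (Fin (x1, y1)) * point_gens (Fin (x2, y2)) * point_gens (Fin (x3, y3)))
     = idl.span G"
  proof -
    have "idl.span (point_gens (Fin (x, y)) * B) = idl.span ({A x, L} * B)" if "y = l * x + m" for x y B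
      unfolding A_def L_def by (rule span_times_cong[OF span_point_gens_line[OF that]])
    note swap = this[OF y(1)] this[OF y(2)] this[OF y(3)]
    have "idl.span (point_gens (Fin (x1, y1)) * point_gens (Fin (x2, y2)) * point_gens (Fin (x3, y3)))
        = idl.span (point_gens (Fin (x2, y2)) * ({A x1, L} * point_gens (Fin (x3, y3))))"
      using swap(1)[of "point_gens (Fin (x2, y2)) * point_gens (Fin (x3, y3))"] by (simp only: ac_simps)
    also have "\<dots> = idl.span (point_gens (Fin (x3, y3)) * ({A x1, L} * {A x2, L}))"
      unfolding swap(2) by (simp only: ac_simps)
    also have "\<dots> = idl.span G"
      unfolding swap(3) G_def by (simp only: ac_simps)
    finally show ?thesis .
  qed
  also have "\<dots> = idl.span {L}"
  proof
    have "A x1 * A x2 * A x3 = CF ([:- x1, 1:] * [:- x2, 1:] * [:- x3, 1:]) 0"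
      by (simp only: A_def curve_fun_defs) simp
    also have "\<dots> = L' * L"
      by (simp add: vieta[symmetric] L_def L'_def curve_fun_defs power2_eq_square del: mult_pCons_left mult_pCons_right)
        (simp add: algebra_simps)
    finally have LL: "A x1 * A x2 * A x3 = L' * L" .
    have in_L: "k * L \<in> idl.span {L}" for k
      by (simp add: idl.span_base idl.span_scale)
    show "idl.span G \<subseteq> idl.span {L}"
    proof (rule idl.span_minimal)
      have "a * b * c \<in> idl.span {L}" if "a \<in> {A x1, L}" "b \<in> {A x2, L}" "c \<in> {A x3, L}" for a b c
      proof -
        have "a * b * c = b * c * a" "a * b * c = a * c * b"
          by (simp_all only: ac_simps)
        then show ?thesis
          using that in_L by (metis LL insertE singletonD)
      qed
      then show "G \<subseteq> idl.span {L}"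
        unfolding G_def set_times_def by blast
    qed simp
    define K where "K = {k. k * L \<in> idl.span G}"
    have K: "idl.subspace K"
      unfolding K_def by (rule idl.subspaceI)
        (auto simp: idl.span_zero distrib_right idl.span_add mult.assoc idl.span_scale)
    have GI: "a * b * c \<in> idl.span G" if "a \<in> {A x1, L}" "b \<in> {A x2, L}" "c \<in> {A x3, L}" for a b c
      using that by (intro idl.span_base) (auto simp: G_def set_times_def)
    have prods: "A x1 * A x2 \<in> K" "A x1 * A x3 \<in> K" "A x2 * A x3 \<in> K"
      "A x1 * L \<in> K" "A x2 * L \<in> K" "A x3 * L \<in> K" "L * L \<in> K" "L' \<in> K"
      unfolding K_def
      using GI[of "A x1" "A x2" L] GI[of "A x1" L "A x3"] GI[of L "A x2" "A x3"]
        GI[of "A x1" L L] GI[of L "A x2" L] GI[of L L "A x3"] GI[of L L L] GI[of "A x1" "A x2" "A x3"] LL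
      by (auto simp: ac_simps)
    have MM: "M = CF [:1/2:] 0 * (L' - L)"
      by (simp add: M_def L_def L'_def curve_fun_defs)
    have half: "CF [:1/2:] 0 * f \<in> K" if "f \<in> K" for f
      using that K by (simp add: idl.subspace_scale)
    have AM: "a * M \<in> K" if "a * L \<in> K" for a
    proof -
      have "a * L' - a * L \<in> K"
        using that prods(8) K by (simp add: idl.subspace_diff idl.subspace_scale)
      from half[OF this] show ?thesis
        by (simp add: MM algebra_simps)
    qed
    have "L * M \<in> K"
      by (rule AM) (rule prods)
    then have "M * M \<in> K"
      by (intro AM) (simp add: mult.commute)
    with prods AM have "1 \<in> K"
      by (intro chord_ideal_one[OF K vieta]) (auto simp: A_def M_def)
    then show "idl.span {L} \<subseteq> idl.span G"
      by (intro idl.span_minimal) (auto simp: K_def)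
  qed
  finally show ?thesis
    unfolding L_def .
qed

text \<open>
  The divisor of a vertical line; it shows that the ideals of opposite points are inverse to each
  other in the class group.
\<close>

lemma span_opposite_points:
  assumes E: "y ^ 2 = x ^ 3 + x"
  shows "idl.span (point_gens (Fin (x, y)) * point_gens (Fin (x, - y))) = idl.span {CF [:- x, 1:] 0}"
proof -
  define A where "A = CF [:- x, 1:] 0"
  define Y where "Y = (\<lambda>c. CF [:c:] 1)"
  define D where "D = CF [:x ^ 2 + 1, x, 1:] 0"
  define G where "G = {A, Y (- y)} * {A, Y y}"
  have YY: "Y (- y) * Y y = D * A"
    using E by (simp add: A_def Y_def D_def curve_fun_defs cubic_def power2_eq_square
        power3_eq_cube algebra_simps)
  have in_A: "k * A \<in> idl.span {A}" "A * k \<in> idl.span {A}" for k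
    by (simp_all add: idl.span_base idl.span_scale mult.commute[of A])
  have 1: "idl.span G \<subseteq> idl.span {A}"
  proof (rule idl.span_minimal)
    show "G \<subseteq> idl.span {A}"
      unfolding G_def set_times_def using in_A by (auto simp: YY)
  qed simp
  define K where "K = {k. k * A \<in> idl.span G}"
  have K: "idl.subspace K"
    unfolding K_def by (rule idl.subspaceI)
      (auto simp: idl.span_zero distrib_right idl.span_add mult.assoc idl.span_scale)
  have GI: "a * b \<in> idl.span G" if "a \<in> {A, Y (- y)}" "b \<in> {A, Y y}" for a b
    using that by (intro idl.span_base) (auto simp: G_def set_times_def)
  have mem: "A \<in> K" "Y (- y) \<in> K" "Y y \<in> K" "D \<in> K"
    unfolding K_def using GI[of A A] GI[of "Y (- y)" A] GI[of A "Y y"] GI[of "Y (- y)" "Y y"] YY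
    by (auto simp: mult.commute)
  have unit: "1 \<in> K" if "CF [:c:] 0 \<in> K" "c \<noteq> 0" for c
    using idl.subspace_scale[OF K that(1), of "CF [:1 / c:] 0"] that(2)
    by (simp add: curve_fun_defs one_pCons)
  have "1 \<in> K"
  proof (cases "y = 0")
    case False
    have "Y y - Y (- y) = CF [:2 * y:] 0"
      by (simp add: Y_def curve_fun_defs)
    then show ?thesis
      using False unit[of "2 * y"] idl.subspace_diff[OF K mem(3) mem(2)] by simp
  next
    case True
    have "D - CF [:2 * x, 1:] 0 * A = CF [:3 * x ^ 2 + 1:] 0"
      by (simp add: A_def D_def curve_fun_defs power2_eq_square algebra_simps)
    then have "CF [:3 * x ^ 2 + 1:] 0 \<in> K"
      using mem K by (metis idl.subspace_diff idl.subspace_scale)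
    moreover have "3 * x ^ 2 + 1 \<noteq> 0"
      using cubic_no_double_root[of x] E True
      by (auto simp: cubic_def pderiv_pCons power2_eq_square power3_eq_cube algebra_simps)
    ultimately show ?thesis
      by (rule unit)
  qed
  then have "idl.span {A} \<subseteq> idl.span G"
    by (intro idl.span_minimal) (auto simp: K_def)
  with 1 show ?thesis
    by (auto simp: G_def A_def Y_def)
qed

primrec ell_neg :: "ell_point \<Rightarrow> ell_point" where
  "ell_neg (Fin u) = Fin (fst u, - snd u)"
| "ell_neg Infty = Infty"

lemma ell_neg_closed: "P \<in> ell_points b \<Longrightarrow> ell_neg P \<in> ell_points b"
  by (auto simp: ell_points_def)

lemma ell_add_Infty_right [simp]: "ell_add b P Infty = P"
  by (cases P) auto

lemma ell_add_neg [simp]: "ell_add b (ell_neg P) P = Infty" "ell_add b P (ell_neg P) = Infty"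
  by (cases P; auto)+

lemma ell_add_commute:
  assumes "P \<in> ell_points b" "Q \<in> ell_points b"
  shows "ell_add b P Q = ell_add b Q P"
proof (cases "P = Infty \<or> Q = Infty")
  case False
  then obtain x1 y1 x2 y2 where PQ: "P = Fin (x1, y1)" "Q = Fin (x2, y2)"
    using assms by (auto simp: ell_points_def)
  show ?thesis
  proof (cases "x1 = x2")
    case True
    then have "y1\<^sup>2 = y2\<^sup>2"
      using assms by (auto simp: PQ ell_points_def)
    then have "y1 = y2 \<or> y1 = - y2"
      by (simp add: power2_eq_iff)
    then show ?thesis
      using True by (auto simp: PQ)
  next
    case False
    define l where "l = (y2 - y1) / (x2 - x1)"
    have l: "l = (y1 - y2) / (x1 - x2)" "l * (x2 - x1) = y2 - y1"
      using False by (simp_all add: l_def field_simps)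
    have "l * (x1 - (l\<^sup>2 - x1 - x2)) - y1 = l * (x2 - (l\<^sup>2 - x2 - x1)) - y2"
      using l(2) by (simp add: algebra_simps)
    then show ?thesis
      using False by (simp add: PQ Let_def l_def[symmetric] l(1)[symmetric])
  qed
qed auto

lemma ell_add_eq_Infty:
  assumes "P \<in> ell_points b" "Q \<in> ell_points b" "ell_add b P Q = Infty"
  shows "P = ell_neg Q"
  using assms by (cases P; cases Q) (auto simp: Let_def split: if_splits)

text \<open>
  The difference of the two monic cubics is a polynomial \<open>c\<^sub>1 X + c\<^sub>0\<close>, since the choice of \<open>x\<^sub>3\<close> matches the
  coefficients of \<open>X\<^sup>2\<close>. It vanishes at \<open>x\<^sub>1\<close>, and a second condition is given by \<open>x\<^sub>2\<close> or, in the tangent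
  case, by the derivative.
\<close>

lemma chord_vieta:
  fixes x1 y1 x2 y2 :: complex
  assumes E: "y1\<^sup>2 = x1 ^ 3 + x1" "y2\<^sup>2 = x2 ^ 3 + x2" and ne: "\<not> (x1 = x2 \<and> y1 = - y2)"
    and l: "l = (if x1 = x2 then (3 * x1\<^sup>2 + 1) / (2 * y1) else (y2 - y1) / (x2 - x1))"
    and x3: "x3 = l\<^sup>2 - x1 - x2" and m: "m = y1 - l * x1"
  shows "y2 = l * x2 + m" "cubic - [:m, l:] ^ 2 = [:- x1, 1:] * [:- x2, 1:] * [:- x3, 1:]"
proof -
  define c1 where "c1 = 1 - 2 * l * m - (x1 * x2 + x1 * x3 + x2 * x3)"
  define c0 where "c0 = x1 * x2 * x3 - m\<^sup>2"
  have r1: "c1 * x1 + c0 = 0"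
    using E(1) unfolding c1_def c0_def x3 m by algebra
  have "y2 = l * x2 + m \<and> c1 = 0"
  proof (cases "x1 = x2")
    case True
    have "(y2 - y1) * (y2 + y1) = 0"
      using E True by (simp add: algebra_simps power2_eq_square)
    then have y: "y2 = y1" "y1 \<noteq> 0"
      using ne True by (auto simp: add_eq_0_iff)
    then have l2: "2 * l * y1 = 3 * x1\<^sup>2 + 1"
      using l True by simp
    have "c1 = 0"
      using l2 True unfolding c1_def x3 m by algebra
    then show ?thesis
      using y True m by simp
  next
    case False
    then have l': "l * (x2 - x1) = y2 - y1"
      using l by simp
    have "c1 * x2 + c0 = 0"
      using E(2) l' unfolding c1_def c0_def x3 m by algebra
    then have "c1 * (x2 - x1) = 0"
      using r1 by algebra
    moreover have "y2 = l * x2 + m"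
      using l' m by algebra
    ultimately show ?thesis
      using False by simp
  qed
  then show "y2 = l * x2 + m" and "cubic - [:m, l:] ^ 2 = [:- x1, 1:] * [:- x2, 1:] * [:- x3, 1:]"
  proof -
    assume *: "y2 = l * x2 + m \<and> c1 = 0"
    then have "c0 = 0"
      using r1 by simp
    with * have "m * m = x1 * (x2 * x3)" "x1 * x2 + (x1 * x3 + (x2 * x3 + l * (m * 2))) = 1"
      "x1 + (x2 + x3) = l * l"
      unfolding c1_def c0_def x3 by (simp_all add: power2_eq_square algebra_simps)
    then show "cubic - [:m, l:] ^ 2 = [:- x1, 1:] * [:- x2, 1:] * [:- x3, 1:]"
      by (simp add: cubic_def power2_eq_square algebra_simps)
  qed simp
qed

lemma same_class_refl: "same_class A A"
  unfolding same_class_def by (metis zero_neq_one)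

lemma same_class_opposite:
  assumes "P \<in> ell_points 1"
  shows "same_class (point_gens P * point_gens (ell_neg P)) {1}"
proof (cases P)
  case (Fin u)
  have "{1} * point_gens P * point_gens (ell_neg P) = point_gens P * point_gens (ell_neg P)"
    "{CF [:- fst u, 1:] 0} * {1} = {CF [:- fst u, 1:] 0}"
    by (auto simp: set_times_def)
  moreover have "idl.span (point_gens P * point_gens (ell_neg P)) = idl.span {CF [:- fst u, 1:] 0}"
    using span_opposite_points[of "snd u" "fst u"] assms
    by (auto simp: Fin ell_points_def)
  moreover have "CF [:- fst u, 1:] 0 \<noteq> 0"
    by (simp add: zero_curve_fun_def)
  ultimately show ?thesis
    unfolding same_class_def by (metis mult.assoc zero_neq_one)
next
  case Infty
  then show ?thesis
    using same_class_refl[of "{1}"] by (simp add: set_times_def)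
qed

text \<open>
  If \<open>S\<close> is the third point on the line through \<open>P\<close> and \<open>Q\<close>, then the class of \<open>S\<close> is inverse both
  to the product of the classes of \<open>P\<close> and \<open>Q\<close> and to the class of \<open>-S = P + Q\<close>.
\<close>

lemma same_class_ell_add:
  assumes "P \<in> ell_points 1" "Q \<in> ell_points 1"
  shows "ell_add 1 P Q \<in> ell_points 1"
    and "same_class (point_gens P * point_gens Q) (point_gens (ell_add 1 P Q))"
proof -
  have one: "{1} * A = A" "A * {1} = A" for A :: "curve_fun set"
    by (auto simp: set_times_def)
  have "ell_add 1 P Q \<in> ell_points 1 \<and>
    same_class (point_gens P * point_gens Q) (point_gens (ell_add 1 P Q))"
  proof (cases "ell_add 1 P Q = Infty")
    case True
    then show ?thesis
      using ell_add_eq_Infty[OF assms True] same_class_opposite[OF assms(2)]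
      by (simp add: mult.commute) (simp add: ell_points_def)
  next
    case ninf: False
    show ?thesis
    proof (cases "P = Infty \<or> Q = Infty")
      case True
      then show ?thesis
        using assms same_class_refl by (auto simp: one)
    next
      case False
      then obtain x1 y1 x2 y2 where PQ: "P = Fin (x1, y1)" "Q = Fin (x2, y2)"
        and E: "y1\<^sup>2 = x1 ^ 3 + x1" "y2\<^sup>2 = x2 ^ 3 + x2"
        using assms by (auto simp: ell_points_def)
      have ne: "\<not> (x1 = x2 \<and> y1 = - y2)"
        using ninf by (auto simp: PQ)
      define l where "l = (if x1 = x2 then (3 * x1\<^sup>2 + 1) / (2 * y1) else (y2 - y1) / (x2 - x1))"
      define x3 where "x3 = l\<^sup>2 - x1 - x2"
      define m where "m = y1 - l * x1"
      define S where "S = Fin (x3, l * x3 + m)"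
      have add: "ell_add 1 P Q = ell_neg S"
        using ne by (simp add: PQ Let_def l_def[symmetric] x3_def S_def m_def algebra_simps)
      note v = chord_vieta[OF E ne l_def x3_def m_def]
      have "(l * x3 + m)\<^sup>2 = x3 ^ 3 + x3"
        using arg_cong[OF v(2), of "\<lambda>p. poly p x3"]
        by (simp add: cubic_def power2_eq_square power3_eq_cube algebra_simps)
      then have S: "S \<in> ell_points 1"
        by (simp add: S_def ell_points_def)
      define L where "L = CF [:- m, - l:] 1"
      have "idl.span (point_gens P * point_gens Q * point_gens S) = idl.span {L}"
        unfolding PQ S_def L_def
        by (rule span_collinear_points) (use v in \<open>simp_all add: m_def\<close>)
      then have "idl.span ({1} * (point_gens P * point_gens Q * point_gens S)) = idl.span ({L} * {1})"
        by (simp only: one)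
      moreover have "L \<noteq> 0"
        by (simp add: L_def zero_curve_fun_def)
      ultimately have "same_class (point_gens P * point_gens Q * point_gens S) {1}"
        unfolding same_class_def by (metis zero_neq_one)
      from same_class_mult[OF this, of "point_gens (ell_neg S)"]
      have "same_class (point_gens P * point_gens Q * (point_gens S * point_gens (ell_neg S)))
              (point_gens (ell_neg S))"
        by (simp only: mult.assoc one)
      moreover have "same_class (point_gens P * point_gens Q)
          (point_gens P * point_gens Q * (point_gens S * point_gens (ell_neg S)))"
        using same_class_mult[OF same_class_sym[OF same_class_opposite[OF S]], of "point_gens P * point_gens Q"]
        by (simp only: one mult.commute)
      ultimately show ?thesis
        unfolding add using ell_neg_closed[OF S] same_class_trans by blast
    qed
  qed
  then show "ell_add 1 P Q \<in> ell_points 1"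
    and "same_class (point_gens P * point_gens Q) (point_gens (ell_add 1 P Q))"
    by auto
qed

lemma same_class_point_gens_inj:
  assumes "P \<in> ell_points 1" "Q \<in> ell_points 1" "same_class (point_gens P) (point_gens Q)"
  shows "P = Q"
proof -
  note nQ = ell_neg_closed[OF assms(2)]
  have "same_class (point_gens (ell_add 1 P (ell_neg Q))) {1}"
    using same_class_mult[OF assms(3), of "point_gens (ell_neg Q)"]
      same_class_opposite[OF assms(2)] same_class_ell_add(2)[OF assms(1) nQ]
    by (meson same_class_sym same_class_trans)
  then have "ell_add 1 P (ell_neg Q) = Infty"
    by (intro same_class_point_gens_one same_class_ell_add assms nQ)
  then have "P = ell_neg (ell_neg Q)"
    by (rule ell_add_eq_Infty[OF assms(1) nQ])
  then show ?thesis
    by (cases Q) auto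
qed

lemma ell_add_assoc_one:
  assumes "P \<in> ell_points 1" "Q \<in> ell_points 1" "R \<in> ell_points 1"
  shows "ell_add 1 (ell_add 1 P Q) R = ell_add 1 P (ell_add 1 Q R)"
proof (rule same_class_point_gens_inj)
  note [simp] = assms same_class_ell_add(1)
  let ?g = point_gens
  have "same_class (?g P * ?g Q * ?g R) (?g (ell_add 1 (ell_add 1 P Q) R))"
    using same_class_mult[OF same_class_ell_add(2)[of P Q], of "?g R"]
      same_class_ell_add(2)[of "ell_add 1 P Q" R] by (auto intro: same_class_trans)
  moreover have "same_class (?g P * ?g Q * ?g R) (?g (ell_add 1 P (ell_add 1 Q R)))"
    using same_class_mult[OF same_class_ell_add(2)[of Q R], of "?g P"]
      same_class_ell_add(2)[of P "ell_add 1 Q R"] by (simp add: ac_simps) (blast intro: same_class_trans)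
  ultimately show "same_class (?g (ell_add 1 (ell_add 1 P Q) R)) (?g (ell_add 1 P (ell_add 1 Q R)))"
    by (blast intro: same_class_trans same_class_sym)
  show "ell_add 1 (ell_add 1 P Q) R \<in> ell_points 1" "ell_add 1 P (ell_add 1 Q R) \<in> ell_points 1"
    by simp_all
qed

text \<open>
  The isomorphism from the curve for \<open>b\<close> to the curve for \<open>t\<^sup>4 b\<close>; for \<open>t\<^sup>4 = 1\<close> these are the
  automorphisms fixing the point at infinity, with \<open>t = -1\<close> the inversion and \<open>t = -\<i>\<close> the map \<open>\<phi>\<^sub>4\<close>.
\<close>

primrec ell_scale :: "complex \<Rightarrow> ell_point \<Rightarrow> ell_point" where
  "ell_scale t (Fin u) = Fin (t\<^sup>2 * fst u, t ^ 3 * snd u)"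
| "ell_scale t Infty = Infty"

lemma ell_scale_scale [simp]: "ell_scale s (ell_scale t P) = ell_scale (s * t) P"
  by (cases P) (auto simp: power_mult_distrib)

lemma ell_scale_1 [simp]: "ell_scale 1 P = P"
  by (cases P) auto

lemma ell_scale_closed:
  assumes "P \<in> ell_points b" "b' = t ^ 4 * b"
  shows "ell_scale t P \<in> ell_points b'"
proof (cases P)
  case (Fin u)
  then have "(snd u)\<^sup>2 = fst u ^ 3 + b * fst u"
    using assms by (auto simp: ell_points_def)
  then have "(t ^ 3 * snd u)\<^sup>2 = (t\<^sup>2 * fst u) ^ 3 + t ^ 4 * b * (t\<^sup>2 * fst u)"
    by algebra
  then show ?thesis
    by (simp add: Fin ell_points_def assms)
qed (simp add: ell_points_def)

lemma ell_scale_add: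
  assumes "t \<noteq> 0" "b' = t ^ 4 * b"
  shows "ell_scale t (ell_add b P Q) = ell_add b' (ell_scale t P) (ell_scale t Q)"
proof (cases "P = Infty \<or> Q = Infty")
  case False
  then obtain x1 y1 x2 y2 where PQ: "P = Fin (x1, y1)" "Q = Fin (x2, y2)"
    by (metis surj_pair with_infty.exhaust)
  define l where "l = (if x1 = x2 then (3 * x1\<^sup>2 + b) / (2 * y1) else (y2 - y1) / (x2 - x1))"
  have l: "(if t\<^sup>2 * x1 = t\<^sup>2 * x2 then (3 * (t\<^sup>2 * x1)\<^sup>2 + b') / (2 * (t ^ 3 * y1))
    else (t ^ 3 * y2 - t ^ 3 * y1) / (t\<^sup>2 * x2 - t\<^sup>2 * x1)) = t * l"
  proof (cases "x1 = x2")
    case True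
    have "(3 * (t\<^sup>2 * x1)\<^sup>2 + b') / (2 * (t ^ 3 * y1))
        = (t ^ 3 * (t * (3 * x1\<^sup>2 + b))) / (t ^ 3 * (2 * y1))"
      unfolding assms by (intro arg_cong2[of _ _ _ _ "(/)"]) algebra+
    then show ?thesis
      using True assms(1) by (simp add: l_def)
  next
    case False
    have "(t ^ 3 * y2 - t ^ 3 * y1) / (t\<^sup>2 * x2 - t\<^sup>2 * x1)
        = (t\<^sup>2 * (t * (y2 - y1))) / (t\<^sup>2 * (x2 - x1))"
      by (intro arg_cong2[of _ _ _ _ "(/)"]) algebra+
    then show ?thesis
      using False assms(1) by (simp add: l_def)
  qed
  have c: "t\<^sup>2 * x1 = t\<^sup>2 * x2 \<and> t ^ 3 * y1 = - (t ^ 3 * y2) \<longleftrightarrow> x1 = x2 \<and> y1 = - y2"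
    using assms(1) by (metis mult_cancel_left mult_minus_right power_not_zero)
  show ?thesis
    unfolding PQ ell_add.simps ell_scale.simps fst_conv snd_conv l c l_def[symmetric] Let_def
    by (simp add: power2_eq_square power3_eq_cube algebra_simps)
qed auto

lemma ell_neg_scale: "ell_neg P = ell_scale (- 1) P"
  by (cases P) auto

lemma exists_fourth_root:
  fixes b :: complex
  obtains t where "t ^ 4 = b"
  by (metis power2_csqrt power_mult numeral_Bit0 mult_2 numeral_times_numeral power_even_eq)

lemma group_ell_group:
  assumes "b \<noteq> 0"
  shows "group (ell_group b)"
proof -
  obtain t where t: "t ^ 4 = b"
    by (rule exists_fourth_root)
  with assms have t0: "t \<noteq> 0"
    by auto
  have down: "ell_scale (1 / t) P \<in> ell_points 1" if "P \<in> ell_points b" for P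
    by (rule ell_scale_closed[OF that]) (use t assms in \<open>simp add: power_divide\<close>)
  have up: "ell_scale t P \<in> ell_points b" if "P \<in> ell_points 1" for P
    by (rule ell_scale_closed[OF that]) (use t in simp)
  have up_down: "ell_scale t (ell_scale (1 / t) P) = P" for P
    using t0 by simp
  have add: "ell_add b P Q = ell_scale t (ell_add 1 (ell_scale (1 / t) P) (ell_scale (1 / t) Q))" for P Q
    by (subst ell_scale_add[of t b]) (use t t0 in simp_all)
  have down_up: "ell_scale (1 / t) (ell_scale t P) = P" for P
    using t0 by simp
  show ?thesis
  proof (rule groupI)
    fix P Q R
    assume PQR: "P \<in> carrier (ell_group b)" "Q \<in> carrier (ell_group b)" "R \<in> carrier (ell_group b)"
    then show "P \<otimes>\<^bsub>ell_group b\<^esub> Q \<otimes>\<^bsub>ell_group b\<^esub> R = P \<otimes>\<^bsub>ell_group b\<^esub> (Q \<otimes>\<^bsub>ell_group b\<^esub> R)"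
      by (simp add: ell_group_def add down_up ell_add_assoc_one down del: ell_scale_scale)
  next
    fix P Q
    assume "P \<in> carrier (ell_group b)" "Q \<in> carrier (ell_group b)"
    then show "P \<otimes>\<^bsub>ell_group b\<^esub> Q \<in> carrier (ell_group b)"
      by (simp add: ell_group_def add up down same_class_ell_add(1))
  next
    fix P
    assume "P \<in> carrier (ell_group b)"
    then show "\<exists>Q\<in>carrier (ell_group b). Q \<otimes>\<^bsub>ell_group b\<^esub> P = \<one>\<^bsub>ell_group b\<^esub>"
      by (intro bexI[of _ "ell_neg P"]) (simp_all add: ell_group_def ell_neg_closed)
  qed (simp_all add: ell_group_def ell_points_def)
qed

section \<open>The defining polynomial and its homogenization\<close>

text \<open>
  With the variables of weight 1 and \<open>b\<close> of weight -1, every term of \<open>p4\<close> has weight 4. So the coefficient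
  of \<open>z\<^sup>i x\<^sup>j y\<^sup>k\<close> is an integer, listed here, times \<open>b\<close> to the power \<open>i + j + k - 4\<close>; it is zero if
  that exponent is negative.
\<close>

definition p4_coeffs :: "complex list list list" where
  "p4_coeffs =
    [[[0, 0, 0, 0, 1], [0, 0, 0, -4, 0], [0, 0, 6, 0, 0], [0, -4, 0, 0, 0], [1, 0, 0, 0, 0]],
     [[0, 0, 0, -4, 0], [0, 0, -124, -112, -4], [0, -124, -288, -124, 0], [-4, -112, -124, 0, 0], [0, -4, 0, 0, 0]],
     [[0, 0, 6, 0, 0], [0, -124, -288, -124, 0], [6, -288, -424, -288, 6], [0, -124, -288, -124, 0], [0, 0, 6, 0, 0]],
     [[0, -4, 0, 0, 0], [-4, -112, -124, 0, 0], [0, -124, -288, -124, 0], [0, 0, -124, -112, -4], [0, 0, 0, -4, 0]],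
     [[1, 0, 0, 0, 0], [0, -4, 0, 0, 0], [0, 0, 6, 0, 0], [0, 0, 0, -4, 0], [0, 0, 0, 0, 1]]]"

definition p4_coeff :: "complex \<Rightarrow> nat \<Rightarrow> nat \<Rightarrow> nat \<Rightarrow> complex" where
  "p4_coeff b i j k = (p4_coeffs ! i ! j ! k) * b ^ (i + j + k - 4)"

text \<open>
  The homogenization of \<open>p4\<close> in each of its three arguments, where \<open>s0, \<dots>, s3\<close> are the homogenized
  elementary symmetric functions. Each term is completed by a power of \<open>s0\<close> to degree 4 in these.
\<close>

definition p4_hom :: "complex \<Rightarrow> complex \<Rightarrow> complex \<Rightarrow> complex \<Rightarrow> complex \<Rightarrow> complex \<Rightarrow> complex \<Rightarrow> complex" where
  "p4_hom b z1 z0 x1 x0 y1 y0 =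
     (let s0 = x0 * y0 * z0; s1 = x1 * y0 * z0 + x0 * y1 * z0 + x0 * y0 * z1;
          s2 = x1 * y1 * z0 + x0 * y1 * z1 + x1 * y0 * z1; s3 = x1 * y1 * z1 in
        s1^4 - 8 * s0 * s1^2 * s2 + 16 * s0^2 * s2^2 - 128 * s0^2 * s1 * s3 - 112 * b * s0 * s1^2 * s3
        - 4 * b^2 * s1^3 * s3 - 64 * b * s0^2 * s2 * s3 - 112 * b^2 * s0 * s1 * s2 * s3
        - 64 * b^2 * s0^2 * s3^2 - 288 * b^3 * s0 * s1 * s3^2 + 6 * b^4 * s1^2 * s3^2
        - 136 * b^4 * s0 * s2 * s3^2 - 112 * b^5 * s0 * s3^3 - 4 * b^6 * s1 * s3^3 + b^8 * s3^4)"

lemma p4_hom_expand: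
  "(\<Sum>i\<le>4. \<Sum>j\<le>4. \<Sum>k\<le>4. p4_coeff b i j k * (z1^i * z0^(4 - i)) *
     (x1^j * x0^(4 - j)) * (y1^k * y0^(4 - k))) = p4_hom b z1 z0 x1 x0 y1 y0"
proof -
  have four: "{..4} = {0, 1, 2, 3, 4 :: nat}"
    by auto
  show ?thesis
    unfolding p4_hom_def Let_def
    by (simp add: four p4_coeff_def p4_coeffs_def, simp add: algebra_simps eval_nat_numeral)
qed

text \<open>
  This and the next lemma split the identity \<open>p4_hom_squares\<close>: the product over the sign changes is even
  in each of \<open>P, Q, R\<close> up to the term with \<open>P Q R\<close>, so it is a polynomial in the squares of the
  original variables.
\<close>

lemma sign_product:
  fixes M P Q R :: complex
  shows "(M - 2 * (P + Q + R)) * (M - 2 * (P - Q - R)) * (M - 2 * (Q - P - R)) * (M - 2 * (R - P - Q))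
    = M^4 - 8 * M^2 * (P^2 + Q^2 + R^2) - 64 * M * (P * Q * R)
      + 16 * ((P^2)^2 + (Q^2)^2 + (R^2)^2 - 2 * (P^2 * Q^2 + P^2 * R^2 + Q^2 * R^2))"
  by (simp add: algebra_simps eval_nat_numeral)

lemma p4_hom_symmetric_form:
  fixes b z1 z0 x1 x0 y1 y0 :: complex
  defines "M \<equiv> x1 * y0 * z0 + x0 * y1 * z0 + x0 * y0 * z1 + b^2 * x1 * y1 * z1"
    and "P2 \<equiv> x0 * x1 * y0 * y1 * (z0 + b * z1)^2"
    and "Q2 \<equiv> x0 * x1 * z0 * z1 * (y0 + b * y1)^2"
    and "R2 \<equiv> y0 * y1 * z0 * z1 * (x0 + b * x1)^2"
    and "PQR \<equiv> x0 * x1 * y0 * y1 * z0 * z1 * (x0 + b * x1) * (y0 + b * y1) * (z0 + b * z1)"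
  shows "p4_hom b z1 z0 x1 x0 y1 y0 =
    M^4 - 8 * M^2 * (P2 + Q2 + R2) - 64 * M * PQR
      + 16 * (P2^2 + Q2^2 + R2^2 - 2 * (P2 * Q2 + P2 * R2 + Q2 * R2))"
  unfolding p4_hom_def Let_def M_def P2_def Q2_def R2_def PQR_def by (simp add: algebra_simps eval_nat_numeral)

section \<open>The group of automorphisms of the curve\<close>

definition fourth_roots :: "complex set" where
  "fourth_roots = {u. u ^ 4 = 1}"

lemma fourth_roots_eq: "fourth_roots = {1, -1, \<i>, -\<i>}"
proof -
  have "u ^ 4 - 1 = (u - 1) * (u + 1) * ((u - \<i>) * (u + \<i>))" for u :: complex
    by (simp add: algebra_simps power4_eq_xxxx)
  then have "u ^ 4 = 1 \<longleftrightarrow> (u = 1 \<or> u = -1) \<or> (u = \<i> \<or> u = -\<i>)" for u :: complex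
    by (metis add_eq_0_iff2 eq_iff_diff_eq_0 mult_eq_0_iff)
  then show ?thesis
    by (auto simp: fourth_roots_def)
qed

lemma finite_fourth_roots [simp]: "finite fourth_roots"
  by (simp add: fourth_roots_eq)

lemma fourth_roots_nonzero: "u \<in> fourth_roots \<Longrightarrow> u \<noteq> 0"
  by (auto simp: fourth_roots_eq)

lemma fourth_roots_mult: "u \<in> fourth_roots \<Longrightarrow> v \<in> fourth_roots \<Longrightarrow> u * v \<in> fourth_roots"
  by (simp add: fourth_roots_def power_mult_distrib)

lemma fourth_roots_inverse: "u \<in> fourth_roots \<Longrightarrow> 1 / u \<in> fourth_roots"
  by (simp add: fourth_roots_def power_divide)

lemma fourth_roots_divide: "u \<in> fourth_roots \<Longrightarrow> v \<in> fourth_roots \<Longrightarrow> u / v \<in> fourth_roots"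
  by (simp add: fourth_roots_def power_divide)

lemma bij_fourth_roots_mult: "u \<in> fourth_roots \<Longrightarrow> bij_betw ((*) u) fourth_roots fourth_roots"
  by (rule bij_betwI[where g = "(*) (1 / u)"])
    (auto simp: fourth_roots_mult fourth_roots_divide fourth_roots_nonzero)

lemma ell_scale_unit_closed:
  "P \<in> ell_points b \<Longrightarrow> u \<in> fourth_roots \<Longrightarrow> ell_scale u P \<in> ell_points b"
  by (rule ell_scale_closed) (auto simp: fourth_roots_def)

lemma ell_scale_unit_add:
  "u \<in> fourth_roots \<Longrightarrow> ell_scale u (ell_add b P Q) = ell_add b (ell_scale u P) (ell_scale u Q)"
  by (rule ell_scale_add) (auto simp: fourth_roots_def)

lemma fourth_root_square: "u \<in> fourth_roots \<Longrightarrow> u\<^sup>2 = 1 \<or> u\<^sup>2 = -1"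
  by (auto simp: fourth_roots_eq)

lemma orbit_map_scale:
  assumes "u \<in> fourth_roots"
  shows "orbit_map (ell_scale u P) = orbit_map P"
proof (cases P)
  case (Fin v)
  have "u\<^sup>2 * fst v = fst v \<or> u\<^sup>2 * fst v = - fst v"
    using fourth_root_square[OF assms] by auto
  then have "(u\<^sup>2 * fst v)\<^sup>2 = (fst v)\<^sup>2"
    by auto
  then show ?thesis
    using fourth_roots_nonzero[OF assms] by (simp add: Fin)
qed simp

text \<open>
  Equal images mean \<open>\<zeta>' = \<zeta>\<close> or \<open>\<zeta>' = -\<zeta>\<close>; then \<open>\<eta>'\<^sup>2 = \<eta>\<^sup>2\<close> or \<open>\<eta>'\<^sup>2 = -\<eta>\<^sup>2\<close>, and the two square roots
  in each case give all four automorphisms.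
\<close>

lemma orbit_map_eq_iff:
  assumes "P \<in> ell_points b" "Q \<in> ell_points b"
  shows "orbit_map P = orbit_map Q \<longleftrightarrow> (\<exists>u\<in>fourth_roots. Q = ell_scale u P)"
proof
  assume eq: "orbit_map P = orbit_map Q"
  show "\<exists>u\<in>fourth_roots. Q = ell_scale u P"
  proof (cases "P = Infty \<or> Q = Infty")
    case True
    then have "P = Infty" "Q = Infty"
      using eq by (cases P; cases Q; auto split: if_splits)+
    then show ?thesis
      by (auto simp: fourth_roots_eq)
  next
    case False
    then obtain x y x' y' where PQ: "P = Fin (x, y)" "Q = Fin (x', y')"
      and E: "y\<^sup>2 = x ^ 3 + b * x" "y'\<^sup>2 = x' ^ 3 + b * x'"
      using assms by (auto simp: ell_points_def)
    have "x\<^sup>2 = x'\<^sup>2"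
      using eq by (auto simp: PQ split: if_splits)
    then consider "x' = x" | "x' = - x"
      by (metis power2_eq_iff)
    then show ?thesis
    proof cases
      case 1
      then have "y'\<^sup>2 = y\<^sup>2"
        using E by simp
      then have "y' = y \<or> y' = - y"
        by (simp add: power2_eq_iff)
      then show ?thesis
        using 1 by (auto simp: PQ fourth_roots_eq)
    next
      case 2
      then have "y'\<^sup>2 = (\<i> * y)\<^sup>2"
        using E by (simp add: power_mult_distrib)
      then have "y' = \<i> * y \<or> y' = - (\<i> * y)"
        by (simp only: power2_eq_iff)
      then show ?thesis
        using 2 by (auto simp: PQ fourth_roots_eq power3_eq_cube)
    qed
  qed
qed (use orbit_map_scale in auto)

lemma orbit_map_surj:
  obtains P where "P \<in> ell_points b" "orbit_map P = x"
proof (cases x)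
  case Infty
  have "Fin (0, 0) \<in> ell_points b"
    by (simp add: ell_points_def)
  then show thesis
    using that[of "Fin (0, 0)"] Infty by simp
next
  case (Fin a)
  show thesis
  proof (cases "a = 0")
    case True
    then show thesis
      using that[of Infty] Fin by (simp add: ell_points_def)
  next
    case False
    let ?x = "csqrt (1 / a)"
    have "Fin (?x, csqrt (?x ^ 3 + b * ?x)) \<in> ell_points b"
      by (simp add: ell_points_def)
    then show thesis
      using that[of "Fin (?x, csqrt (?x ^ 3 + b * ?x))"] Fin False by simp
  qed
qed

section \<open>The coset multiplication\<close>

definition coset_mult :: "complex \<Rightarrow> ell_point \<Rightarrow> ell_point \<Rightarrow> complex with_infty multiset" where
  "coset_mult b P Q = {#orbit_map (ell_add b P (ell_scale u Q)). u \<in># mset_set fourth_roots#}"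

lemma image_mset_as_sum: "{#f u. u \<in># mset_set A#} = (\<Sum>u\<in>A. {#f u#})"
  by (induction A rule: infinite_finite_induct) auto

lemma coset_mult_sum: "coset_mult b P Q = (\<Sum>u\<in>fourth_roots. {#orbit_map (ell_add b P (ell_scale u Q))#})"
  unfolding coset_mult_def by (rule image_mset_as_sum)

lemma coset_mult_scale:
  assumes "s \<in> fourth_roots" "t \<in> fourth_roots"
  shows "coset_mult b (ell_scale s P) (ell_scale t Q) = coset_mult b P Q"
proof -
  have "1 / s * t \<in> fourth_roots"
    using assms by (intro fourth_roots_mult fourth_roots_inverse)
  note bij = bij_fourth_roots_mult[OF this]
  have "orbit_map (ell_add b (ell_scale s P) (ell_scale u (ell_scale t Q)))
      = orbit_map (ell_add b P (ell_scale (1 / s * t * u) Q))" for u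
  proof -
    have "ell_add b (ell_scale s P) (ell_scale u (ell_scale t Q))
        = ell_scale s (ell_add b P (ell_scale (1 / s * t * u) Q))"
      unfolding ell_scale_unit_add[OF assms(1)]
      using fourth_roots_nonzero[OF assms(1)] by (simp add: mult.commute)
    then show ?thesis
      by (simp only: orbit_map_scale[OF assms(1)])
  qed
  then show ?thesis
    unfolding coset_mult_sum using sum.reindex_bij_betw[OF bij] by simp
qed

lemma coset_mult_cong:
  assumes "P \<in> ell_points b" "Q \<in> ell_points b" "P' \<in> ell_points b" "Q' \<in> ell_points b"
    and "orbit_map P' = orbit_map P" "orbit_map Q' = orbit_map Q"
  shows "coset_mult b P' Q' = coset_mult b P Q"
  using assms by (metis coset_mult_scale orbit_map_eq_iff)

definition point_over :: "complex \<Rightarrow> complex with_infty \<Rightarrow> ell_point" where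
  "point_over b x = (SOME P. P \<in> ell_points b \<and> orbit_map P = x)"

lemma point_over: "point_over b x \<in> ell_points b" "orbit_map (point_over b x) = x"
proof -
  obtain P where "P \<in> ell_points b" "orbit_map P = x"
    by (rule orbit_map_surj)
  then have "point_over b x \<in> ell_points b \<and> orbit_map (point_over b x) = x"
    unfolding point_over_def by (intro someI[of "\<lambda>P. P \<in> ell_points b \<and> orbit_map P = x"]) auto
  then show "point_over b x \<in> ell_points b" "orbit_map (point_over b x) = x"
    by auto
qed

definition G4 :: "complex \<Rightarrow> complex with_infty nvgroup" where
  "G4 b = \<lparr>nmult = \<lambda>x y. coset_mult b (point_over b x) (point_over b y),
           neutral = Fin 0, ninv = \<lambda>x. x\<rparr>"

lemma G4_mult:
  assumes "P \<in> ell_points b" "Q \<in> ell_points b"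
  shows "nmult (G4 b) (orbit_map P) (orbit_map Q) = coset_mult b P Q"
  unfolding G4_def nvgroup.simps by (rule coset_mult_cong[OF assms]) (simp_all add: point_over)

context
  fixes b :: complex
  assumes b: "b \<noteq> 0"
begin

interpretation E: group "ell_group b"
  by (rule group_ell_group[OF b])

lemma ell_add_closed: "P \<in> ell_points b \<Longrightarrow> Q \<in> ell_points b \<Longrightarrow> ell_add b P Q \<in> ell_points b"
  using E.m_closed by (simp add: ell_group_def)

lemma ell_add_assoc:
  "P \<in> ell_points b \<Longrightarrow> Q \<in> ell_points b \<Longrightarrow> R \<in> ell_points b \<Longrightarrow>
    ell_add b (ell_add b P Q) R = ell_add b P (ell_add b Q R)"
  using E.m_assoc by (simp add: ell_group_def)

text \<open>
  Both sides are the multiset of all \<open>P + s Q + t R\<close>: on the left, \<open>t = s u\<close> for the automorphism \<open>u\<close>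
  used in the inner product, and for fixed \<open>s\<close> this runs through the group.
\<close>

lemma coset_mult_assoc:
  assumes "P \<in> ell_points b" "Q \<in> ell_points b" "R \<in> ell_points b"
  shows "(\<Sum>w\<in>#coset_mult b Q R. nmult (G4 b) (orbit_map P) w)
    = (\<Sum>w\<in>#coset_mult b P Q. nmult (G4 b) w (orbit_map R))"
proof -
  let ?p = "\<lambda>s t. orbit_map (ell_add b (ell_add b P (ell_scale s Q)) (ell_scale t R))"
  have "(\<Sum>w\<in>#coset_mult b Q R. nmult (G4 b) (orbit_map P) w)
      = (\<Sum>u\<in>fourth_roots. nmult (G4 b) (orbit_map P) (orbit_map (ell_add b Q (ell_scale u R))))"
    by (simp add: coset_mult_def sum_unfold_sum_mset multiset.map_comp o_def)
  also have "\<dots> = (\<Sum>u\<in>fourth_roots. \<Sum>s\<in>fourth_roots. {#?p s (s * u)#})"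
  proof (rule sum.cong[OF refl])
    fix u assume u: "u \<in> fourth_roots"
    then have "nmult (G4 b) (orbit_map P) (orbit_map (ell_add b Q (ell_scale u R)))
        = coset_mult b P (ell_add b Q (ell_scale u R))"
      using assms by (intro G4_mult ell_add_closed ell_scale_unit_closed)
    also have "\<dots> = (\<Sum>s\<in>fourth_roots. {#?p s (s * u)#})"
      unfolding coset_mult_sum using assms u
      by (intro sum.cong refl) (simp add: ell_scale_unit_add ell_add_assoc ell_scale_unit_closed fourth_roots_mult)
    finally show "nmult (G4 b) (orbit_map P) (orbit_map (ell_add b Q (ell_scale u R)))
        = (\<Sum>s\<in>fourth_roots. {#?p s (s * u)#})" .
  qed
  also have "\<dots> = (\<Sum>s\<in>fourth_roots. \<Sum>u\<in>fourth_roots. {#?p s (s * u)#})"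
    by (rule sum.swap)
  also have "\<dots> = (\<Sum>s\<in>fourth_roots. \<Sum>t\<in>fourth_roots. {#?p s t#})"
    by (rule sum.cong[OF refl], rule sum.reindex_bij_betw[OF bij_fourth_roots_mult, of _ "\<lambda>t. {#?p _ t#}"])
  also have "\<dots> = (\<Sum>s\<in>fourth_roots. nmult (G4 b) (orbit_map (ell_add b P (ell_scale s Q))) (orbit_map R))"
    using assms by (intro sum.cong refl)
      (simp add: G4_mult ell_add_closed ell_scale_unit_closed coset_mult_sum)
  also have "\<dots> = (\<Sum>w\<in>#coset_mult b P Q. nmult (G4 b) w (orbit_map R))"
    by (simp add: coset_mult_def sum_unfold_sum_mset multiset.map_comp o_def)
  finally show ?thesis .
qed

lemma coset_mult_commute:
  assumes "P \<in> ell_points b" "Q \<in> ell_points b"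
  shows "coset_mult b P Q = coset_mult b Q P"
proof -
  have bij: "bij_betw (\<lambda>u. 1 / u) fourth_roots fourth_roots"
    by (rule bij_betwI[where g = "\<lambda>u. 1 / u"]) (auto simp: fourth_roots_inverse)
  have "orbit_map (ell_add b P (ell_scale (1 / u) Q)) = orbit_map (ell_add b Q (ell_scale u P))"
    if u: "u \<in> fourth_roots" for u
  proof -
    have "ell_scale u (ell_add b P (ell_scale (1 / u) Q)) = ell_add b (ell_scale u P) Q"
      using fourth_roots_nonzero[OF u] by (simp add: ell_scale_unit_add[OF u])
    also have "\<dots> = ell_add b Q (ell_scale u P)"
      using assms u by (intro ell_add_commute ell_scale_unit_closed)
    finally show ?thesis
      by (metis orbit_map_scale[OF u])
  qed
  then show ?thesis
    unfolding coset_mult_sum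
    by (subst sum.reindex_bij_betw[OF bij, symmetric]) simp
qed

text \<open>
  Inversion is itself one of the automorphisms, so every orbit is its own inverse.
\<close>

lemma zero_in_coset_mult_iff:
  assumes "P \<in> ell_points b" "Q \<in> ell_points b"
  shows "Fin 0 \<in># coset_mult b P Q \<longleftrightarrow> orbit_map P = orbit_map Q"
proof
  assume "Fin 0 \<in># coset_mult b P Q"
  then obtain u where u: "u \<in> fourth_roots" "orbit_map (ell_add b P (ell_scale u Q)) = Fin 0"
    by (auto simp: coset_mult_def)
  then have "ell_add b P (ell_scale u Q) = Infty"
    by (cases "ell_add b P (ell_scale u Q)") (auto split: if_splits)
  then have "P = ell_neg (ell_scale u Q)"
    using assms u by (intro ell_add_eq_Infty ell_scale_unit_closed)
  also have "\<dots> = ell_scale (- u) Q"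
    by (simp add: ell_neg_scale)
  finally show "orbit_map P = orbit_map Q"
    using u(1) orbit_map_scale[of "- u" Q] by (simp add: fourth_roots_def)
next
  assume "orbit_map P = orbit_map Q"
  then obtain u where u: "u \<in> fourth_roots" "Q = ell_scale u P"
    using orbit_map_eq_iff[OF assms] by blast
  have v: "- (1 / u) \<in> fourth_roots"
    using fourth_roots_inverse[OF u(1)] by (simp add: fourth_roots_def)
  have "ell_scale (- (1 / u)) Q = ell_neg P"
    using fourth_roots_nonzero[OF u(1)] by (simp add: u(2) ell_neg_scale)
  then have "orbit_map (ell_add b P (ell_scale (- (1 / u)) Q)) = Fin 0"
    by simp
  then show "Fin 0 \<in># coset_mult b P Q"
    using v by (force simp: coset_mult_def)
qed

end

section \<open>The zeros of the defining polynomial\<close>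

text \<open>
  Homogeneous \<open>\<zeta>\<close>-coordinate of a point, \<open>(1:0)\<close> at infinity.
\<close>

primrec xnum :: "ell_point \<Rightarrow> complex" where
  "xnum (Fin u) = fst u"
| "xnum Infty = 1"

primrec xden :: "ell_point \<Rightarrow> complex" where
  "xden (Fin u) = 1"
| "xden Infty = 0"

text \<open>
  The quadratic form in \<open>T1, T0\<close> whose zeros are the \<open>\<zeta>\<close>-coordinates of \<open>P + Q\<close> and \<open>P - Q\<close>, if
  \<open>(X1:Z1)\<close> and \<open>(X2:Z2)\<close> are those of \<open>P\<close> and \<open>Q\<close>.
\<close>

definition xquad :: "complex \<Rightarrow> complex \<Rightarrow> complex \<Rightarrow> complex \<Rightarrow> complex \<Rightarrow> complex \<Rightarrow> complex \<Rightarrow> complex" where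
  "xquad b X1 Z1 X2 Z2 T1 T0 =
     (X1 * Z2 - X2 * Z1)^2 * T1^2 - 2 * (X1 * X2 + b * Z1 * Z2) * (X1 * Z2 + X2 * Z1) * T1 * T0
     + (X1 * X2 - b * Z1 * Z2)^2 * T0^2"

text \<open>
  For two chords this is the computation of the sum and the product of the \<open>\<zeta>\<close>-coordinates. If
  \<open>P = Q\<close> or \<open>P = -Q\<close>, the leading coefficient vanishes and one of the zeros is the point at infinity;
  the other one comes from the duplication formula. If \<open>P\<close> moreover has order two, both zeros are
  infinite, and \<open>b \<noteq> 0\<close> ensures that the form does not vanish identically.
\<close>

lemma xquad_sum_difference:
  assumes b: "b \<noteq> 0" and P: "P \<in> ell_points b" and Q: "Q \<in> ell_points b"
  shows "\<exists>c. c \<noteq> 0 \<and> (\<forall>T1 T0. xquad b (xnum P) (xden P) (xnum Q) (xden Q) T1 T0 =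
    c * (T1 * xden (ell_add b P Q) - T0 * xnum (ell_add b P Q)) *
        (T1 * xden (ell_add b P (ell_neg Q)) - T0 * xnum (ell_add b P (ell_neg Q))))"
proof (cases "P = Infty \<or> Q = Infty")
  case True
  then show ?thesis
  proof
    assume P: "P = Infty"
    show ?thesis
      by (cases Q; intro exI[of _ 1] conjI allI)
        (simp_all add: P xquad_def power2_eq_square algebra_simps)
  next
    assume Q: "Q = Infty"
    show ?thesis
      by (cases P; intro exI[of _ 1] conjI allI)
        (simp_all add: Q xquad_def power2_eq_square algebra_simps)
  qed
next
  case False
  then obtain x1 y1 x2 y2 where PQ: "P = Fin (x1, y1)" "Q = Fin (x2, y2)"
    and E: "y1\<^sup>2 = x1 ^ 3 + b * x1" "y2\<^sup>2 = x2 ^ 3 + b * x2"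
    using P Q by (auto simp: ell_points_def)
  have quad: "xquad b (xnum P) (xden P) (xnum Q) (xden Q) T1 T0
      = (x1 - x2)^2 * T1^2 - 2 * (x1 * x2 + b) * (x1 + x2) * T1 * T0 + (x1 * x2 - b)^2 * T0^2" for T1 T0
    by (simp add: PQ xquad_def)
  show ?thesis
  proof (cases "x1 = x2")
    case False
    define l where "l = (y2 - y1) / (x2 - x1)"
    define l' where "l' = (- y2 - y1) / (x2 - x1)"
    define X where "X = l\<^sup>2 - x1 - x2"
    define X' where "X' = l'\<^sup>2 - x1 - x2"
    have c0: "(x1 - x2)\<^sup>2 \<noteq> 0"
      using False by simp
    have l: "(x2 - x1) * l = y2 - y1" "(x2 - x1) * l' = - y2 - y1"
      using False by (simp_all add: l_def l'_def)
    have cX: "(x1 - x2)\<^sup>2 * X = y1\<^sup>2 + y2\<^sup>2 - 2 * y1 * y2 - (x1 + x2) * (x1 - x2)\<^sup>2"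
      "(x1 - x2)\<^sup>2 * X' = y1\<^sup>2 + y2\<^sup>2 + 2 * y1 * y2 - (x1 + x2) * (x1 - x2)\<^sup>2"
    proof -
      have "(x1 - x2)\<^sup>2 * (k\<^sup>2 - x1 - x2) = ((x2 - x1) * k)\<^sup>2 - (x1 + x2) * (x1 - x2)\<^sup>2" for k
        by (simp add: power2_eq_square algebra_simps)
      note square = this[of l, unfolded l] this[of l', unfolded l]
      show "(x1 - x2)\<^sup>2 * X = y1\<^sup>2 + y2\<^sup>2 - 2 * y1 * y2 - (x1 + x2) * (x1 - x2)\<^sup>2"
        "(x1 - x2)\<^sup>2 * X' = y1\<^sup>2 + y2\<^sup>2 + 2 * y1 * y2 - (x1 + x2) * (x1 - x2)\<^sup>2"
        unfolding X_def X'_def square by (simp_all add: power2_eq_square algebra_simps)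
    qed
    have sum: "(x1 - x2)\<^sup>2 * (X + X') = 2 * (x1 * x2 + b) * (x1 + x2)"
    proof -
      have "(x1 - x2)\<^sup>2 * (X + X') = 2 * y1\<^sup>2 + 2 * y2\<^sup>2 - 2 * (x1 + x2) * (x1 - x2)\<^sup>2"
        unfolding distrib_left cX by (simp add: algebra_simps)
      then show ?thesis
        unfolding E by (simp add: power2_eq_square power3_eq_cube algebra_simps)
    qed
    have "(x1 - x2)\<^sup>2 * ((x1 - x2)\<^sup>2 * (X * X')) = (x1 - x2)\<^sup>2 * (x1 * x2 - b)\<^sup>2"
    proof -
      have "(x1 - x2)\<^sup>2 * ((x1 - x2)\<^sup>2 * (X * X')) = ((x1 - x2)\<^sup>2 * X) * ((x1 - x2)\<^sup>2 * X')"
        by (simp add: mult_ac)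
      also have "\<dots> = (y1\<^sup>2 + y2\<^sup>2 - (x1 + x2) * (x1 - x2)\<^sup>2)\<^sup>2 - 4 * y1\<^sup>2 * y2\<^sup>2"
        unfolding cX by (simp add: power2_eq_square algebra_simps)
      also have "\<dots> = (x1 - x2)\<^sup>2 * (x1 * x2 - b)\<^sup>2"
        unfolding E by (simp add: power2_eq_square power3_eq_cube algebra_simps)
      finally show ?thesis .
    qed
    then have prod: "(x1 - x2)\<^sup>2 * (X * X') = (x1 * x2 - b)\<^sup>2"
      unfolding mult_cancel_left using c0 by blast
    have add: "xnum (ell_add b P Q) = X" "xden (ell_add b P Q) = 1"
      "xnum (ell_add b P (ell_neg Q)) = X'" "xden (ell_add b P (ell_neg Q)) = 1"
      using False by (simp_all add: PQ Let_def X_def X'_def l_def l'_def)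
    show ?thesis
    proof (intro exI[of _ "(x1 - x2)\<^sup>2"] conjI allI c0)
      fix T1 T0
      show "xquad b (xnum P) (xden P) (xnum Q) (xden Q) T1 T0 = (x1 - x2)\<^sup>2 *
          (T1 * xden (ell_add b P Q) - T0 * xnum (ell_add b P Q)) *
          (T1 * xden (ell_add b P (ell_neg Q)) - T0 * xnum (ell_add b P (ell_neg Q)))"
      proof -
        have "(x1 - x2)\<^sup>2 * (T1 * 1 - T0 * X) * (T1 * 1 - T0 * X')
            = (x1 - x2)\<^sup>2 * T1\<^sup>2 - (x1 - x2)\<^sup>2 * (X + X') * T1 * T0 + (x1 - x2)\<^sup>2 * (X * X') * T0\<^sup>2"
          by (simp add: power2_eq_square algebra_simps)
        then show ?thesis
          unfolding quad add sum prod by simp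
      qed
    qed
  next
    case x: True
    then have "y1\<^sup>2 = y2\<^sup>2"
      using E by simp
    then have y: "y2 = y1 \<or> y2 = - y1"
      by (auto simp: power2_eq_iff)
    show ?thesis
    proof (cases "y1 = 0")
      case True
      have "x1\<^sup>2 - b \<noteq> 0"
      proof
        assume "x1\<^sup>2 - b = 0"
        moreover have "x1 * (x1\<^sup>2 + b) = 0"
          using E True by (simp add: power2_eq_square power3_eq_cube algebra_simps)
        ultimately show False
          using b by auto
      qed
      moreover have "x1 * (x1\<^sup>2 + b) = 0"
        using E True by (simp add: power2_eq_square power3_eq_cube algebra_simps)
      moreover have "(x1 - x2)\<^sup>2 * T1\<^sup>2 - 2 * (x1 * x2 + b) * (x1 + x2) * T1 * T0 + (x1 * x2 - b)\<^sup>2 * T0\<^sup>2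
          = - 4 * (x1 * (x1\<^sup>2 + b)) * T1 * T0 + (x1\<^sup>2 - b)\<^sup>2 * T0\<^sup>2" for T1 T0
        unfolding x[symmetric] by (simp add: power2_eq_square algebra_simps)
      moreover have "ell_add b P Q = Infty" "ell_add b P (ell_neg Q) = Infty"
        using x y True by (auto simp: PQ)
      ultimately show ?thesis
        unfolding quad
        by (intro exI[of _ "(x1\<^sup>2 - b)\<^sup>2"] conjI allI) (simp_all add: power2_eq_square)
    next
      case False
      define l where "l = (3 * x1\<^sup>2 + b) / (2 * y1)"
      define X where "X = l\<^sup>2 - x1 - x1"
      have l: "2 * y1 * l = 3 * x1\<^sup>2 + b"
        using False by (simp add: l_def)
      have X: "4 * y1\<^sup>2 * X = (x1\<^sup>2 - b)\<^sup>2"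
      proof -
        have "4 * y1\<^sup>2 * X = (2 * y1 * l)\<^sup>2 - 8 * x1 * y1\<^sup>2"
          by (simp add: X_def power2_eq_square algebra_simps)
        then show ?thesis
          unfolding l E(1) by (simp add: power2_eq_square power3_eq_cube algebra_simps)
      qed
      have sums: "(xnum (ell_add b P Q) = X \<and> xden (ell_add b P Q) = 1 \<and>
          xnum (ell_add b P (ell_neg Q)) = 1 \<and> xden (ell_add b P (ell_neg Q)) = 0) \<or>
        (xnum (ell_add b P Q) = 1 \<and> xden (ell_add b P Q) = 0 \<and>
          xnum (ell_add b P (ell_neg Q)) = X \<and> xden (ell_add b P (ell_neg Q)) = 1)"
        using x y False by (auto simp: PQ Let_def X_def l_def)
      have q: "(x1 - x2)^2 * T1^2 - 2 * (x1 * x2 + b) * (x1 + x2) * T1 * T0 + (x1 * x2 - b)^2 * T0^2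
          = - (4 * y1\<^sup>2) * (T1 - T0 * X) * T0" for T1 T0
      proof -
        have "- (4 * y1\<^sup>2) * (T1 - T0 * X) * T0 = - 4 * y1\<^sup>2 * T1 * T0 + 4 * y1\<^sup>2 * X * T0\<^sup>2"
          by (simp add: power2_eq_square algebra_simps)
        then show ?thesis
          unfolding X unfolding E(1) x[symmetric] by (simp add: power2_eq_square power3_eq_cube algebra_simps)
      qed
      show ?thesis
        unfolding quad q
      proof (intro exI[of _ "4 * y1\<^sup>2"] conjI allI)
        fix T1 T0
        show "- (4 * y1\<^sup>2) * (T1 - T0 * X) * T0 =
            4 * y1\<^sup>2 * (T1 * xden (ell_add b P Q) - T0 * xnum (ell_add b P Q)) *
            (T1 * xden (ell_add b P (ell_neg Q)) - T0 * xnum (ell_add b P (ell_neg Q)))"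
          using sums by (elim disjE conjE) (simp_all only:, simp_all only: algebra_simps, simp_all)
      qed (use False in simp)
    qed
  qed
qed

lemma xquad_scale_i:
  "xquad b X1 Z1 (xnum (ell_scale \<i> Q)) (xden (ell_scale \<i> Q)) T1 T0 = xquad b X1 Z1 (- xnum Q) (xden Q) T1 T0"
  by (cases Q) (simp_all add: xquad_def)

text \<open>
  Since \<open>x = 1 / \<zeta>\<^sup>2\<close>, the arguments of \<open>p4_hom\<close> are squares, with numerators and denominators
  exchanged. The sign of \<open>X2\<close> is changed by the automorphism \<open>\<phi>\<^sub>4\<close> acting on \<open>Q\<close>, and the sign of \<open>w0\<close> is
  the ambiguity of a square root of the variable \<open>z\<close>.
\<close>

lemma p4_hom_squares:
  "p4_hom b (w1^2) (w0^2) (Z1^2) (X1^2) (Z2^2) (X2^2) =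
     xquad b X1 Z1 X2 Z2 w0 w1 * xquad b X1 Z1 X2 Z2 (- w0) w1 *
     xquad b X1 Z1 (- X2) Z2 w0 w1 * xquad b X1 Z1 (- X2) Z2 (- w0) w1"
proof -
  define M where "M = Z1^2 * X2^2 * w0^2 + X1^2 * Z2^2 * w0^2 + X1^2 * X2^2 * w1^2 + b^2 * Z1^2 * Z2^2 * w1^2"
  define P where "P = X1 * X2 * Z1 * Z2 * (w0^2 + b * w1^2)"
  define Q where "Q = X1 * Z1 * w0 * w1 * (X2^2 + b * Z2^2)"
  define R where "R = X2 * Z2 * w0 * w1 * (X1^2 + b * Z1^2)"
  have x: "xquad b X1 Z1 X2 Z2 w0 w1 = M - 2 * (P + Q + R)"
    "xquad b X1 Z1 X2 Z2 (- w0) w1 = M - 2 * (P - Q - R)"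
    "xquad b X1 Z1 (- X2) Z2 w0 w1 = M - 2 * (Q - P - R)"
    "xquad b X1 Z1 (- X2) Z2 (- w0) w1 = M - 2 * (R - P - Q)"
    unfolding xquad_def M_def P_def Q_def R_def by (simp_all add: power2_eq_square algebra_simps)
  have "P^2 = X1^2 * Z1^2 * X2^2 * Z2^2 * (w0^2 + b * w1^2)^2"
    "Q^2 = X1^2 * Z1^2 * w0^2 * w1^2 * (X2^2 + b * Z2^2)^2"
    "R^2 = X2^2 * Z2^2 * w0^2 * w1^2 * (X1^2 + b * Z1^2)^2"
    "P * Q * R = X1^2 * Z1^2 * X2^2 * Z2^2 * w0^2 * w1^2 * (X1^2 + b * Z1^2) * (X2^2 + b * Z2^2) * (w0^2 + b * w1^2)"
    unfolding P_def Q_def R_def by (simp_all add: power_mult_distrib) (simp add: power2_eq_square mult_ac)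
  then show ?thesis
    unfolding x sign_product by (simp add: p4_hom_symmetric_form M_def)
qed

lemma p4_hom_scale:
  "p4_hom b z1 z0 (l * x1) (l * x0) (m * y1) (m * y0) = l^4 * m^4 * p4_hom b z1 z0 x1 x0 y1 y0"
proof -
  have s: "(l * x1)^j * (l * x0)^(4 - j) = l^4 * (x1^j * x0^(4 - j))" if "j \<le> 4" for l x1 x0 :: complex and j
    using that by (simp add: power_mult_distrib mult_ac flip: power_add)
  show ?thesis
    unfolding p4_hom_expand[symmetric] sum_distrib_left
    by (intro sum.cong refl) (simp add: s mult_ac)
qed

lemma orbit_map_coords:
  "\<exists>l. l \<noteq> 0 \<and> (xden P)^2 = l * coord1 (orbit_map P) \<and> (xnum P)^2 = l * coord0 (orbit_map P)"
proof (cases P)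
  case (Fin u)
  then show ?thesis
    by (intro exI[of _ "if fst u = 0 then 1 else (fst u)^2"]) auto
qed auto

text \<open>
  The four automorphisms form two pairs \<open>\<plusminus>u\<close>; \<open>xquad\<close> treats the pair \<open>\<plusminus>1\<close> for \<open>Q\<close> and the pair \<open>\<plusminus>\<i>\<close>
  for \<open>\<i>Q\<close>. Its linear factors at \<open>w0\<close> and \<open>-w0\<close> combine to one in \<open>z = (w1\<^sup>2 : w0\<^sup>2)\<close> that vanishes at
  the image under the orbit map.
\<close>

lemma p4_hom_zeros:
  assumes b: "b \<noteq> 0" and P: "P \<in> ell_points b" and Q: "Q \<in> ell_points b"
  shows "\<exists>c. c \<noteq> 0 \<and> (\<forall>z1 z0. p4_hom b z1 z0 (coord1 (orbit_map P)) (coord0 (orbit_map P))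
      (coord1 (orbit_map Q)) (coord0 (orbit_map Q)) =
      c * (\<Prod>a\<in>#coset_mult b P Q. z1 * coord0 a - z0 * coord1 a))"
proof -
  let ?S = "\<lambda>u. ell_add b P (ell_scale u Q)"
  have "\<i> \<in> fourth_roots"
    by (simp add: fourth_roots_eq)
  then have Qi: "ell_scale \<i> Q \<in> ell_points b"
    by (rule ell_scale_unit_closed[OF Q])
  obtain c1 where c1: "c1 \<noteq> 0" "\<And>T1 T0. xquad b (xnum P) (xden P) (xnum Q) (xden Q) T1 T0 =
      c1 * (T1 * xden (?S 1) - T0 * xnum (?S 1)) * (T1 * xden (?S (-1)) - T0 * xnum (?S (-1)))"
    using xquad_sum_difference[OF b P Q] by (auto simp: ell_neg_scale)
  obtain c2 where c2: "c2 \<noteq> 0" "\<And>T1 T0. xquad b (xnum P) (xden P) (- xnum Q) (xden Q) T1 T0 =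
      c2 * (T1 * xden (?S \<i>) - T0 * xnum (?S \<i>)) * (T1 * xden (?S (-\<i>)) - T0 * xnum (?S (-\<i>)))"
    using xquad_sum_difference[OF b P Qi] unfolding xquad_scale_i by (auto simp: ell_neg_scale)
  obtain lam where lam: "\<And>R. lam R \<noteq> 0" "\<And>R. (xden R)^2 = lam R * coord1 (orbit_map R)"
    "\<And>R. (xnum R)^2 = lam R * coord0 (orbit_map R)"
    using orbit_map_coords by metis
  define \<Lambda> where "\<Lambda> = lam (?S 1) * lam (?S (-1)) * lam (?S \<i>) * lam (?S (-\<i>))"
  have mset: "(\<Prod>a\<in>#coset_mult b P Q. f a)
      = f (orbit_map (?S 1)) * f (orbit_map (?S (-1))) * f (orbit_map (?S \<i>)) * f (orbit_map (?S (-\<i>)))"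
    for f :: "complex with_infty \<Rightarrow> complex"
    by (simp add: coset_mult_def fourth_roots_eq complex_eq_iff mult_ac)
  show ?thesis
  proof (intro exI[of _ "c1^2 * c2^2 * \<Lambda> / (lam P^4 * lam Q^4)"] conjI allI)
    show "c1^2 * c2^2 * \<Lambda> / (lam P^4 * lam Q^4) \<noteq> 0"
      using c1 c2 lam(1) by (simp add: \<Lambda>_def)
    fix z1 z0
    define w1 where "w1 = csqrt z1"
    define w0 where "w0 = csqrt z0"
    have w: "z1 = w1^2" "z0 = w0^2"
      by (simp_all add: w1_def w0_def)
    have factor: "(w0 * xden R - w1 * xnum R) * (- w0 * xden R - w1 * xnum R)
        = lam R * (z1 * coord0 (orbit_map R) - z0 * coord1 (orbit_map R))" for R
    proof -
      have "(w0 * xden R - w1 * xnum R) * (- w0 * xden R - w1 * xnum R) = z1 * (xnum R)^2 - z0 * (xden R)^2"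
        by (simp add: w power2_eq_square algebra_simps)
      then show ?thesis
        by (simp add: lam(2,3) algebra_simps)
    qed
    have "lam P^4 * lam Q^4 * p4_hom b z1 z0 (coord1 (orbit_map P)) (coord0 (orbit_map P))
        (coord1 (orbit_map Q)) (coord0 (orbit_map Q))
        = p4_hom b (w1^2) (w0^2) ((xden P)^2) ((xnum P)^2) ((xden Q)^2) ((xnum Q)^2)"
      unfolding lam(2,3) p4_hom_scale w ..
    also have "\<dots> = c1^2 * c2^2 *
        ((w0 * xden (?S 1) - w1 * xnum (?S 1)) * (- w0 * xden (?S 1) - w1 * xnum (?S 1))) *
        ((w0 * xden (?S (-1)) - w1 * xnum (?S (-1))) * (- w0 * xden (?S (-1)) - w1 * xnum (?S (-1)))) *
        ((w0 * xden (?S \<i>) - w1 * xnum (?S \<i>)) * (- w0 * xden (?S \<i>) - w1 * xnum (?S \<i>))) *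
        ((w0 * xden (?S (-\<i>)) - w1 * xnum (?S (-\<i>))) * (- w0 * xden (?S (-\<i>)) - w1 * xnum (?S (-\<i>))))"
      unfolding p4_hom_squares c1(2) c2(2) by (simp only: power2_eq_square mult_ac)
    also have "\<dots> = c1^2 * c2^2 * \<Lambda> * (\<Prod>a\<in>#coset_mult b P Q. z1 * coord0 a - z0 * coord1 a)"
      unfolding factor mset \<Lambda>_def by (simp only: mult_ac)
    finally show "p4_hom b z1 z0 (coord1 (orbit_map P)) (coord0 (orbit_map P))
        (coord1 (orbit_map Q)) (coord0 (orbit_map Q)) =
        c1^2 * c2^2 * \<Lambda> / (lam P^4 * lam Q^4) * (\<Prod>a\<in>#coset_mult b P Q. z1 * coord0 a - z0 * coord1 a)"
      using lam(1) by (simp add: field_simps)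
  qed
qed

lemma size_coset_mult: "size (coset_mult b P Q) = 4"
  by (simp add: coset_mult_def fourth_roots_eq complex_eq_iff)

lemma G4_mult_zeros:
  assumes "b \<noteq> 0"
  shows "\<exists>c. c \<noteq> 0 \<and> (\<forall>z1 z0. p4_hom b z1 z0 (coord1 x) (coord0 x) (coord1 y) (coord0 y) =
      c * (\<Prod>a\<in>#nmult (G4 b) x y. z1 * coord0 a - z0 * coord1 a))"
  using p4_hom_zeros[OF assms point_over(1) point_over(1), of x y] by (simp add: G4_def point_over(2))

lemma multiplication_defined_by_p4:
  assumes "b \<noteq> 0"
  shows "multiplication_defined_by 4 (p4 b) (nmult (G4 b))"
  unfolding multiplication_defined_by_def
proof (intro exI[of _ "p4_coeff b"] conjI allI)
  fix z x y
  have "p4 b z x y = p4_hom b z 1 x 1 y 1"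
    by (simp add: p4_def p4_hom_def Let_def mult_ac)
  then show "p4 b z x y = (\<Sum>i\<le>4. \<Sum>j\<le>4. \<Sum>k\<le>4. p4_coeff b i j k * z^i * x^j * y^k)"
    unfolding p4_hom_expand[symmetric] by simp
next
  fix x y
  show "zeros_mset 4 (\<lambda>z1 z0. \<Sum>i\<le>4. \<Sum>j\<le>4. \<Sum>k\<le>4. p4_coeff b i j k * (z1^i * z0^(4 - i)) *
      (coord1 x^j * coord0 x^(4 - j)) * (coord1 y^k * coord0 y^(4 - k))) (nmult (G4 b) x y)"
    unfolding p4_hom_expand zeros_mset_def using G4_mult_zeros[OF assms]
    by (auto simp: G4_def size_coset_mult)
qed

section \<open>The varieties and their morphisms\<close>

lemma projective_variety_CP1: "projective_variety CP1"
  unfolding projective_variety_def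
proof (intro conjI ballI impI)
  fix p :: "complex with_infty"
  show "hcoord CP1 p \<noteq> 0"
    by (cases p) (auto simp: vec_eq_iff forall_2 CP1_coords)
next
  fix p q :: "complex with_infty"
  assume "\<exists>c. hcoord CP1 p = c *s hcoord CP1 q"
  then show "p = q"
    by (intro CP1_proportional) (auto simp: vec_eq_iff forall_2 CP1_coords)
next
  have "v \<in> {c *s hcoord CP1 p |c p. c \<noteq> 0 \<and> p \<in> pset CP1}" if "v \<noteq> 0" for v :: "complex^2"
  proof (cases "v $ 2 = 0")
    case True
    then have v: "v = v $ 1 *s hcoord CP1 Infty" "v $ 1 \<noteq> 0"
      using that by (auto simp: vec_eq_iff forall_2 CP1_coords)
    show ?thesis
      by (intro CollectI exI[of _ "v $ 1"] exI[of _ Infty] conjI v) (simp add: CP1_def)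
  next
    case False
    then have v: "v = v $ 2 *s hcoord CP1 (Fin (v $ 1 / v $ 2))"
      by (auto simp: vec_eq_iff forall_2 CP1_coords)
    show ?thesis
      by (intro CollectI exI[of _ "v $ 2"] exI[of _ "Fin (v $ 1 / v $ 2)"] conjI v False)
        (simp add: CP1_def)
  qed
  moreover have "c *s hcoord CP1 p \<noteq> 0" if "c \<noteq> 0" for c p
    using that by (cases p) (auto simp: vec_eq_iff forall_2 CP1_coords)
  ultimately have "{v. v \<noteq> 0 \<and> (\<forall>F\<in>{}. F v = 0)} = {c *s hcoord CP1 p |c p. c \<noteq> 0 \<and> p \<in> pset CP1}"
    by auto
  then show "\<exists>\<F>. (\<forall>F\<in>\<F>. \<exists>d. form d F) \<and>
      {v. v \<noteq> 0 \<and> (\<forall>F\<in>\<F>. F v = 0)} = {c *s hcoord CP1 p |c p. c \<noteq> 0 \<and> p \<in> pset CP1}"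
    by (intro exI[of _ "{}"]) simp
qed

lemma projective_variety_ell_curve: "projective_variety (ell_curve b)"
  unfolding projective_variety_def
proof (intro conjI ballI impI)
  fix p
  show "hcoord (ell_curve b) p \<noteq> 0"
    by (cases p) (auto simp: ell_curve_def vec_eq_iff forall_3)
next
  fix p q
  assume "\<exists>c. hcoord (ell_curve b) p = c *s hcoord (ell_curve b) q"
  then show "p = q"
    by (cases p; cases q) (auto simp: ell_curve_def vec_eq_iff forall_3 prod_eq_iff)
next
  define F :: "complex^3 \<Rightarrow> complex" where
    "F = (\<lambda>v. v $ 2 ^ 2 * v $ 3 + ((-1) * v $ 1 ^ 3 + (- b) * (v $ 1 * v $ 3 ^ 2)))"
  have "form (1 * 2 + 1) (\<lambda>v :: complex^3. v $ 2 ^ 2 * v $ 3)" "form (1 * 3) (\<lambda>v :: complex^3. v $ 1 ^ 3)"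
    "form (1 + 1 * 2) (\<lambda>v :: complex^3. v $ 1 * v $ 3 ^ 2)"
    by (intro form_mult form_power form_coord)+
  then have "form 3 F"
    unfolding F_def by (intro form_add form_cmult) (simp_all add: eval_nat_numeral)
  moreover have "{v. v \<noteq> 0 \<and> (\<forall>F\<in>{F}. F v = 0)}
      = {c *s hcoord (ell_curve b) p |c p. c \<noteq> 0 \<and> p \<in> pset (ell_curve b)}" (is "?L = ?R")
  proof (intro Set.set_eqI iffI)
    fix v assume "v \<in> ?L"
    then have v: "v \<noteq> 0" "F v = 0"
      by auto
    show "v \<in> ?R"
    proof (cases "v $ 3 = 0")
      case True
      then have "v $ 1 = 0"
        using v(2) by (simp add: F_def)
      then have v2: "v = v $ 2 *s hcoord (ell_curve b) Infty" "v $ 2 \<noteq> 0"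
        using v(1) True by (auto simp: ell_curve_def vec_eq_iff forall_3)
      show ?thesis
        by (intro CollectI exI[of _ "v $ 2"] exI[of _ Infty] conjI v2) (simp add: ell_curve_def ell_points_def)
    next
      case False
      let ?x = "v $ 1 / v $ 3" and ?y = "v $ 2 / v $ 3"
      have "v $ 2 ^ 2 * v $ 3 = v $ 1 ^ 3 + b * (v $ 1 * v $ 3 ^ 2)"
        using v(2) by (simp add: F_def algebra_simps)
      then have "?y ^ 2 = ?x ^ 3 + b * ?x"
        using False by (simp add: field_simps power2_eq_square power3_eq_cube)
      then have p: "Fin (?x, ?y) \<in> pset (ell_curve b)"
        by (simp add: ell_curve_def ell_points_def)
      have v3: "v = v $ 3 *s hcoord (ell_curve b) (Fin (?x, ?y))"
        using False by (simp add: ell_curve_def vec_eq_iff forall_3)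
      show ?thesis
        by (intro CollectI exI[of _ "v $ 3"] exI[of _ "Fin (?x, ?y)"] conjI v3 False p)
    qed
  next
    fix v assume "v \<in> ?R"
    then obtain c p where cp: "v = c *s ell_hcoord p" "c \<noteq> 0" "p \<in> ell_points b"
      by (auto simp: ell_curve_def)
    have "F (ell_hcoord p) = 0 \<and> ell_hcoord p \<noteq> 0"
      using cp(3) by (cases p) (auto simp: F_def ell_points_def vec_eq_iff forall_3)
    moreover have "F v = c ^ 3 * F (ell_hcoord p)"
      unfolding cp(1) by (rule form_homogeneous[OF \<open>form 3 F\<close>])
    ultimately show "v \<in> ?L"
      using cp by auto
  qed
  ultimately show "\<exists>\<F>. (\<forall>F\<in>\<F>. \<exists>d. form d F) \<and>
      {v. v \<noteq> 0 \<and> (\<forall>F\<in>\<F>. F v = 0)} = {c *s hcoord (ell_curve b) p |c p. c \<noteq> 0 \<and> p \<in> pset (ell_curve b)}"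
    by (intro exI[of _ "{F}"] conjI) auto
qed

lemma morphism_ell_scale:
  assumes t: "t \<noteq> 0" "b' = t ^ 4 * b" and f: "\<And>P. P \<in> ell_points b \<Longrightarrow> f P = ell_scale t P"
  shows "morphism (variety_space (ell_curve b)) (variety_space (ell_curve b')) f"
proof (rule morphism_by_forms)
  show "f \<in> pset (ell_curve b) \<rightarrow> pset (ell_curve b')"
    using f ell_scale_closed[OF _ t(2)] by (auto simp: ell_curve_def)
  fix p
  define k :: "complex^3" where "k = vector [t\<^sup>2, t ^ 3, 1]"
  show "\<exists>e A. (\<forall>i. form e (A i)) \<and> (\<exists>i. A i (hcoord (ell_curve b) p) \<noteq> 0) \<and>
       (\<forall>q\<in>pset (ell_curve b). \<exists>c. \<forall>i. A i (hcoord (ell_curve b) q) = c * hcoord (ell_curve b') (f q) $ i)"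
  proof (intro exI[of _ "1 :: nat"] exI[of _ "\<lambda>i v. k $ i * v $ i"] conjI allI ballI)
    show "form 1 (\<lambda>v :: complex^3. k $ i * v $ i)" for i
      by (intro form_cmult form_coord)
    show "\<exists>i. k $ i * hcoord (ell_curve b) p $ i \<noteq> 0"
      using t(1) by (cases p) (auto simp: ell_curve_def k_def intro: exI[of _ 3] exI[of _ 2])
    fix q assume "q \<in> pset (ell_curve b)"
    then have "f q = ell_scale t q"
      by (simp add: ell_curve_def f)
    then show "\<exists>c. \<forall>i. k $ i * hcoord (ell_curve b) q $ i = c * hcoord (ell_curve b') (f q) $ i"
      by (cases q) (auto simp: ell_curve_def forall_3 k_def)
  qed
qed

lemma isomorphism_ell_scale:
  assumes t: "t \<noteq> 0" "b' = t ^ 4 * b" and f: "\<And>P. P \<in> ell_points b \<Longrightarrow> f P = ell_scale t P"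
  shows "isomorphism (variety_space (ell_curve b)) (variety_space (ell_curve b')) f"
  unfolding isomorphism_def
proof (intro conjI exI[of _ "ell_scale (1 / t)"])
  have t': "1 / t \<noteq> 0" "b = (1 / t) ^ 4 * b'"
    using t by (simp_all add: power_divide)
  show "morphism (variety_space (ell_curve b)) (variety_space (ell_curve b')) f"
    by (rule morphism_ell_scale[OF assms])
  show "morphism (variety_space (ell_curve b')) (variety_space (ell_curve b)) (ell_scale (1 / t))"
    by (rule morphism_ell_scale[OF t']) simp
  have pts: "points (variety_space (ell_curve c)) = ell_points c" for c
    by (simp add: variety_space_def zariski_space_def ell_curve_def)
  show "\<forall>x\<in>points (variety_space (ell_curve b)). ell_scale (1 / t) (f x) = x"
    using f t(1) by (simp add: pts)
  show "\<forall>y\<in>points (variety_space (ell_curve b')). f (ell_scale (1 / t) y) = y"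
    using f ell_scale_closed[OF _ t'(2)] t(1) by (simp add: pts)
qed

text \<open>
  In the coordinates \<open>(X:Y:Z)\<close> the map is \<open>(Z\<^sup>2 : X\<^sup>2)\<close>, which is undefined at infinity. There the equation
  \<open>Z (Y\<^sup>2 - bXZ) = X\<^sup>3\<close> of the curve turns it into \<open>(X\<^sup>4 : (Y\<^sup>2 - bXZ)\<^sup>2)\<close>.
\<close>

lemma morphism_orbit_map: "morphism (variety_space (ell_curve b)) (variety_space CP1) orbit_map"
proof (rule morphism_by_forms)
  show "orbit_map \<in> pset (ell_curve b) \<rightarrow> pset CP1"
    by (auto simp: CP1_def)
  fix p assume p: "p \<in> pset (ell_curve b)"
  have pow: "form n (\<lambda>v :: complex^3. v $ j ^ n)" for n j
    using form_power[OF form_coord[of j], of n] by simp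
  show "\<exists>e A. (\<forall>i. form e (A i)) \<and> (\<exists>i. A i (hcoord (ell_curve b) p) \<noteq> 0) \<and>
       (\<forall>q\<in>pset (ell_curve b). \<exists>c. \<forall>i. A i (hcoord (ell_curve b) q) = c * hcoord CP1 (orbit_map q) $ i)"
  proof (cases p)
    case (Fin u)
    define A :: "2 \<Rightarrow> complex^3 \<Rightarrow> complex" where "A = (\<lambda>i v. if i = 1 then v $ 3 ^ 2 else v $ 1 ^ 2)"
    have "form 2 (A i)" for i
      unfolding A_def by (cases "i = 1") (simp_all add: pow)
    moreover have "A 1 (hcoord (ell_curve b) p) \<noteq> 0"
      by (simp add: A_def Fin ell_curve_def)
    moreover have "\<exists>c. \<forall>i. A i (hcoord (ell_curve b) q) = c * hcoord CP1 (orbit_map q) $ i" for q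
      using orbit_map_coords[of q] by (cases q) (auto simp: A_def ell_curve_def forall_2 CP1_coords)
    ultimately show ?thesis
      by (intro exI[of _ "2 :: nat"] exI[of _ A] conjI allI ballI) auto
  next
    case Infty
    define B :: "complex^3 \<Rightarrow> complex" where "B = (\<lambda>v. v $ 2 ^ 2 + (- b) * (v $ 1 * v $ 3))"
    define A :: "2 \<Rightarrow> complex^3 \<Rightarrow> complex" where "A = (\<lambda>i v. if i = 1 then v $ 1 ^ 4 else B v ^ 2)"
    have "form 2 B"
      unfolding B_def using form_mult[OF form_coord[of "1 :: 3"] form_coord[of "3 :: 3"]]
      by (intro form_add form_cmult pow) (simp add: numeral_2_eq_2)
    then have "form 4 (A i)" for i
      unfolding A_def using form_power[of 2 B 2] by (cases "i = 1") (simp_all add: pow)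
    moreover have "A 2 (hcoord (ell_curve b) p) \<noteq> 0"
      by (simp add: A_def B_def Infty ell_curve_def)
    moreover have "\<exists>c. \<forall>i. A i (hcoord (ell_curve b) q) = c * hcoord CP1 (orbit_map q) $ i"
      if "q \<in> pset (ell_curve b)" for q
    proof (cases q)
      case (Fin u)
      then have "(snd u)\<^sup>2 = fst u ^ 3 + b * fst u"
        using that by (auto simp: ell_curve_def ell_points_def)
      then have "B (hcoord (ell_curve b) q) = fst u ^ 3"
        by (simp add: B_def Fin ell_curve_def)
      then show ?thesis
        by (intro exI[of _ "fst u ^ 6"])
          (auto simp: A_def Fin ell_curve_def forall_2 CP1_coords simp flip: power_mult power_diff)
    qed (auto simp: A_def B_def ell_curve_def forall_2 CP1_coords intro!: exI[of _ 1])
    ultimately show ?thesis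
      by (intro exI[of _ "4 :: nat"] exI[of _ A] conjI allI ballI) auto
  qed
qed

primrec line_scale :: "complex \<Rightarrow> complex with_infty \<Rightarrow> complex with_infty" where
  "line_scale k (Fin x) = Fin (k * x)"
| "line_scale k Infty = Infty"

lemma morphism_line_scale:
  assumes "k \<noteq> 0"
  shows "morphism (variety_space CP1) (variety_space CP1) (line_scale k)"
proof (rule morphism_by_forms)
  fix p
  define h :: "complex^2" where "h = vector [k, 1]"
  show "\<exists>e A. (\<forall>i. form e (A i)) \<and> (\<exists>i. A i (hcoord CP1 p) \<noteq> 0) \<and>
       (\<forall>q\<in>pset CP1. \<exists>c. \<forall>i. A i (hcoord CP1 q) = c * hcoord CP1 (line_scale k q) $ i)"
  proof (intro exI[of _ "1 :: nat"] exI[of _ "\<lambda>i v. h $ i * v $ i"] conjI allI ballI)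
    show "form 1 (\<lambda>v :: complex^2. h $ i * v $ i)" for i
      by (intro form_cmult form_coord)
    show "\<exists>i. h $ i * hcoord CP1 p $ i \<noteq> 0"
      using assms by (cases p) (auto simp: CP1_coords h_def intro: exI[of _ 2] exI[of _ 1])
    show "\<exists>c. \<forall>i. h $ i * hcoord CP1 q $ i = c * hcoord CP1 (line_scale k q) $ i" for q
      by (cases q) (auto simp: forall_2 CP1_coords h_def)
  qed
qed (simp add: CP1_def)

lemma isomorphism_line_scale:
  assumes "k \<noteq> 0"
  shows "isomorphism (variety_space CP1) (variety_space CP1) (line_scale k)"
  unfolding isomorphism_def
proof (intro conjI exI[of _ "line_scale (1 / k)"] ballI)
  show "line_scale (1 / k) (line_scale k x) = x" "line_scale k (line_scale (1 / k) x) = x" for x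
    using assms by (cases x; simp)+
qed (rule morphism_line_scale, use assms in simp)+

lemma morphism_G4_mult:
  assumes "b \<noteq> 0"
  shows "morphism (power_space 2 CP1) (sym_space 4 CP1) (\<lambda>p. nmult (G4 b) (p ! 0) (p ! 1))"
  unfolding power_space_def
proof (rule morphism_to_sym_CP1[where \<epsilon> = "\<lambda>_. 4" and
      L = "\<lambda>z w. p4_hom b (z $ 1) (z $ 2) (w 0 $ 1) (w 0 $ 2) (w 1 $ 1) (w 1 $ 2)"])
  fix z :: "complex^2"
  have mono: "form 4 (\<lambda>v :: complex^2. v $ 1 ^ j * v $ 2 ^ (4 - j))" if "j \<in> {..4}" for j
    using form_mult[OF form_power[OF form_coord[of "1 :: 2"], of j] form_power[OF form_coord[of "2 :: 2"], of "4 - j"]]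
      that by simp
  have "multiform 2 (\<lambda>_. 4) (\<lambda>w :: nat \<Rightarrow> complex^2.
      (p4_coeff b i j k * (z $ 1 ^ i * z $ 2 ^ (4 - i)) * (w 0 $ 1 ^ j * w 0 $ 2 ^ (4 - j))) *
        (w 1 $ 1 ^ k * w 1 $ 2 ^ (4 - k)))"
    if "j \<in> {..4}" "k \<in> {..4}" for i j k
    by (rule multiform_cong[OF multiform_mult[OF
          multiform_component[OF form_cmult[OF mono[OF that(1)]], of 0 2]
          multiform_component[OF mono[OF that(2)], of 1 2]]]) (auto simp: less_2_cases_iff)
  then show "multiform 2 (\<lambda>_. 4)
      (\<lambda>w :: nat \<Rightarrow> complex^2. p4_hom b (z $ 1) (z $ 2) (w 0 $ 1) (w 0 $ 2) (w 1 $ 1) (w 1 $ 2))"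
    unfolding p4_hom_expand[symmetric] by (intro multiform_sum)
next
  fix p :: "complex with_infty list"
  show "size (nmult (G4 b) (p ! 0) (p ! 1)) = 4"
    by (simp add: G4_def size_coset_mult)
  show "\<exists>c. c \<noteq> 0 \<and> (\<forall>z :: complex^2. p4_hom b (z $ 1) (z $ 2) (hcoord CP1 (p ! 0) $ 1) (hcoord CP1 (p ! 0) $ 2)
      (hcoord CP1 (p ! 1) $ 1) (hcoord CP1 (p ! 1) $ 2) =
      c * (\<Prod>a\<in>#nmult (G4 b) (p ! 0) (p ! 1). z $ 1 * coord0 a - z $ 2 * coord1 a))"
    using G4_mult_zeros[OF assms] unfolding CP1_coords by blast
qed simp

section \<open>The four-valued group and its coset structure\<close>

lemma card_fourth_roots: "card fourth_roots = 4"
  by (simp add: fourth_roots_eq complex_eq_iff)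

lemma coset_mult_Infty: "coset_mult b P Infty = replicate_mset 4 (orbit_map P)"
  by (simp add: coset_mult_def image_mset_const_eq card_fourth_roots)

lemma regular_algebraic_G4:
  assumes b: "b \<noteq> 0"
  shows "regular_algebraic_nvgroup 4 CP1 (G4 b)"
  unfolding regular_algebraic_nvgroup_def
proof (intro conjI ballI)
  fix x y z :: "complex with_infty"
  note over = point_over(1)[of b]
  show "(\<Sum>w\<in>#nmult (G4 b) y z. nmult (G4 b) x w) = (\<Sum>w\<in>#nmult (G4 b) x y. nmult (G4 b) w z)"
    using coset_mult_assoc[OF b over[of x] over[of y] over[of z]]
    by (simp add: point_over(2)) (simp add: G4_def)
  have inf: "Infty \<in> ell_points b"
    by (simp add: ell_points_def)
  have zero: "neutral (G4 b) = Fin 0"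
    by (simp add: G4_def)
  have "nmult (G4 b) x (Fin 0) = coset_mult b (point_over b x) Infty"
    using G4_mult[OF over[of x] inf] by (simp add: point_over(2))
  then show right: "nmult (G4 b) x (neutral (G4 b)) = replicate_mset 4 x"
    by (simp add: zero coset_mult_Infty point_over(2))
  have "nmult (G4 b) (Fin 0) x = coset_mult b Infty (point_over b x)"
    using G4_mult[OF inf over[of x]] by (simp add: point_over(2))
  also have "\<dots> = coset_mult b (point_over b x) Infty"
    by (rule coset_mult_commute[OF b inf over])
  also have "\<dots> = nmult (G4 b) x (Fin 0)"
    using G4_mult[OF over[of x] inf] by (simp add: point_over(2))
  finally show "nmult (G4 b) (neutral (G4 b)) x = replicate_mset 4 x"
    using right by (simp add: zero)
  show "neutral (G4 b) \<in># nmult (G4 b) x (ninv (G4 b) x)" "neutral (G4 b) \<in># nmult (G4 b) (ninv (G4 b) x) x"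
    using zero_in_coset_mult_iff[OF b over[of x] over[of x]] by (simp_all add: G4_def)
  show "neutral (G4 b) \<in> pset CP1"
    by (simp add: CP1_def)
  have "line_scale 1 = ninv (G4 b)"
  proof
    show "line_scale 1 x = ninv (G4 b) x" for x
      by (cases x) (simp_all add: G4_def)
  qed
  then show "morphism (variety_space CP1) (variety_space CP1) (ninv (G4 b))"
    using morphism_line_scale[of 1] by simp
qed (rule projective_variety_CP1 morphism_G4_mult[OF b])+

lemma commutative_G4: "b \<noteq> 0 \<Longrightarrow> nv_commutative CP1 (G4 b)"
  unfolding nv_commutative_def by (simp add: G4_def coset_mult_commute point_over(1))

lemma involutive_G4:
  assumes b: "b \<noteq> 0"
  shows "nv_involutive CP1 (G4 b)"
proof -
  have "Fin 0 \<in># nmult (G4 b) x y \<longleftrightarrow> x = y" for x y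
    using zero_in_coset_mult_iff[OF b point_over(1)[of b x] point_over(1)[of b y]]
    by (simp add: G4_def point_over(2))
  moreover have "neutral (G4 b) = Fin 0" "ninv (G4 b) x = x" for x
    by (simp_all add: G4_def)
  ultimately show ?thesis
    unfolding nv_involutive_def by metis
qed

definition unit_action :: "complex \<Rightarrow> complex \<Rightarrow> ell_point \<Rightarrow> ell_point" where
  "unit_action b u = restrict (ell_scale u) (ell_points b)"

lemma unit_action_mem_auto:
  assumes u: "u \<in> fourth_roots" and b: "b \<noteq> 0"
  shows "unit_action b u \<in> carrier (AutoGroup (ell_group b))"
proof -
  have "bij_betw (ell_scale u) (ell_points b) (ell_points b)"
    by (rule bij_betwI[where g = "ell_scale (1 / u)"])
      (use u fourth_roots_inverse[OF u] fourth_roots_nonzero[OF u] in \<open>auto intro: ell_scale_unit_closed\<close>)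
  then have "bij_betw (unit_action b u) (ell_points b) (ell_points b)"
    by (simp add: unit_action_def cong: bij_betw_cong)
  moreover have "unit_action b u \<in> hom (ell_group b) (ell_group b)"
    by (rule homI)
      (simp_all add: ell_group_def unit_action_def ell_scale_unit_closed u ell_add_closed[OF b] ell_scale_unit_add[OF u])
  ultimately show ?thesis
    by (simp add: AutoGroup_def auto_def Bij_def unit_action_def ell_group_def)
qed

lemma unit_action_mult:
  assumes "u \<in> fourth_roots" "v \<in> fourth_roots" "b \<noteq> 0"
  shows "unit_action b u \<otimes>\<^bsub>AutoGroup (ell_group b)\<^esub> unit_action b v = unit_action b (u * v)"
proof -
  have "unit_action b u \<in> Bij (ell_points b)" "unit_action b v \<in> Bij (ell_points b)"
    using unit_action_mem_auto assms by (auto simp: AutoGroup_def auto_def ell_group_def)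
  then have "unit_action b u \<otimes>\<^bsub>AutoGroup (ell_group b)\<^esub> unit_action b v
      = compose (ell_points b) (unit_action b u) (unit_action b v)"
    by (simp add: AutoGroup_def BijGroup_def ell_group_def)
  also have "\<dots> = unit_action b (u * v)"
    using assms by (auto simp: fun_eq_iff compose_def unit_action_def ell_scale_unit_closed)
  finally show ?thesis .
qed

lemma unit_action_one: "\<one>\<^bsub>AutoGroup (ell_group b)\<^esub> = unit_action b 1"
  by (simp add: AutoGroup_def BijGroup_def ell_group_def unit_action_def fun_eq_iff)

lemma phi4_eq_scale: "phi4 = ell_scale (- \<i>)"
proof
  show "phi4 P = ell_scale (- \<i>) P" for P
    by (cases P) (simp_all add: power3_eq_cube)
qed

lemma phi4_group_eq:
  assumes b: "b \<noteq> 0"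
  shows "phi4_group b = unit_action b ` fourth_roots"
proof -
  let ?A = "AutoGroup (ell_group b)"
  interpret E: group "ell_group b"
    by (rule group_ell_group[OF b])
  interpret A: group ?A
    by (rule E.AutoGroup)
  have roots: "1 \<in> fourth_roots" "-1 \<in> fourth_roots" "\<i> \<in> fourth_roots" "-\<i> \<in> fourth_roots"
    by (auto simp: fourth_roots_eq)
  have phi: "phi4_group b = generate ?A {unit_action b (- \<i>)}"
    by (simp add: phi4_group_def unit_action_def phi4_eq_scale)
  have inv: "m_inv ?A (unit_action b (- \<i>)) = unit_action b \<i>"
    by (rule A.inv_equality) (simp_all add: unit_action_mult unit_action_mem_auto unit_action_one b roots)
  show ?thesis
  proof
    show "phi4_group b \<subseteq> unit_action b ` fourth_roots"
    proof
      fix h assume "h \<in> phi4_group b"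
      then have "h \<in> generate ?A {unit_action b (- \<i>)}"
        by (simp add: phi)
      then show "h \<in> unit_action b ` fourth_roots"
        by (induction rule: generate.induct)
          (use inv roots b in \<open>auto simp: unit_action_one unit_action_mult fourth_roots_mult\<close>)
    qed
    have 1: "unit_action b (- \<i>) \<in> phi4_group b"
      unfolding phi by (simp add: generate.incl)
    have mult: "unit_action b (u * v) \<in> phi4_group b"
      if "unit_action b u \<in> phi4_group b" "unit_action b v \<in> phi4_group b" "u \<in> fourth_roots" "v \<in> fourth_roots"
      for u v
      using generate.eng[OF that(1,2)[unfolded phi]] that(3,4) b by (simp add: unit_action_mult phi)
    have 2: "unit_action b (- 1) \<in> phi4_group b"
      using mult[OF 1 1] roots by simp
    have "unit_action b 1 \<in> phi4_group b" "unit_action b \<i> \<in> phi4_group b"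
      using mult[OF 2 2] mult[OF 1 2] roots by simp_all
    with 1 2 show "unit_action b ` fourth_roots \<subseteq> phi4_group b"
      by (auto simp: fourth_roots_eq)
  qed
qed

text \<open>
  The automorphisms are told apart by a point with both coordinates nonzero; \<open>\<zeta> = \<surd>b\<close> yields one,
  since then \<open>\<zeta>\<^sup>3 + b\<zeta> = 2b\<zeta>\<close>.
\<close>

lemma inj_on_unit_action:
  assumes b: "b \<noteq> 0"
  shows "inj_on (unit_action b) fourth_roots"
proof -
  define x where "x = csqrt b"
  define y where "y = csqrt (x ^ 3 + b * x)"
  have x: "x \<noteq> 0" "x ^ 3 + b * x = 2 * b * x"
    using b by (simp_all add: x_def power3_eq_cube flip: power2_eq_square)
  then have y: "y \<noteq> 0" "y\<^sup>2 = x ^ 3 + b * x"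
    using b by (simp_all add: y_def)
  have P: "Fin (x, y) \<in> ell_points b"
    using y by (simp add: ell_points_def)
  show ?thesis
  proof (rule inj_onI)
    fix u v assume uv: "u \<in> fourth_roots" "v \<in> fourth_roots" "unit_action b u = unit_action b v"
    have "ell_scale u (Fin (x, y)) = ell_scale v (Fin (x, y))"
      using fun_cong[OF uv(3), of "Fin (x, y)"] P by (simp add: unit_action_def)
    then have "u\<^sup>2 = v\<^sup>2" "u ^ 3 = v ^ 3"
      using x y by simp_all
    then have "u\<^sup>2 * u = u\<^sup>2 * v"
      by (metis power2_eq_square power3_eq_cube)
    then show "u = v"
      using fourth_roots_nonzero[OF uv(1)] by simp
  qed
qed

lemma phi4_group_mset:
  assumes b: "b \<noteq> 0" and Q: "Q \<in> ell_points b"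
  shows "{#f (h Q). h \<in># mset_set (phi4_group b)#} = {#f (ell_scale u Q). u \<in># mset_set fourth_roots#}"
  unfolding phi4_group_eq[OF b] image_mset_mset_set[OF inj_on_unit_action[OF b], symmetric]
  using Q by (simp add: multiset.map_comp o_def unit_action_def)

lemma ell_group_inv:
  assumes b: "b \<noteq> 0" and P: "P \<in> ell_points b"
  shows "inv\<^bsub>ell_group b\<^esub> P = ell_neg P"
proof -
  interpret E: group "ell_group b"
    by (rule group_ell_group[OF b])
  show ?thesis
    by (rule E.inv_equality) (use P in \<open>simp_all add: ell_group_def ell_neg_closed\<close>)
qed

lemma coset_G4:
  assumes b: "b \<noteq> 0"
  shows "coset_nvgroup 4 (ell_group b) (ell_curve b) (phi4_group b) orbit_map CP1 (G4 b)"
  unfolding coset_nvgroup_def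
proof (intro conjI ballI)
  have carrier: "carrier (ell_group b) = ell_points b"
    by (simp add: ell_group_def)
  interpret E: group "ell_group b"
    by (rule group_ell_group[OF b])
  interpret A: group "AutoGroup (ell_group b)"
    by (rule E.AutoGroup)
  show "group (ell_group b)" ..
  show "projective_variety (ell_curve b)"
    by (rule projective_variety_ell_curve)
  show "pset (ell_curve b) = carrier (ell_group b)"
    by (simp add: ell_curve_def carrier)
  show "subgroup (phi4_group b) (AutoGroup (ell_group b))"
    unfolding phi4_group_def
    by (rule A.generate_is_subgroup)
      (use unit_action_mem_auto[OF _ b, of "- \<i>"] in \<open>simp add: unit_action_def phi4_eq_scale fourth_roots_eq\<close>)
  show "finite (phi4_group b)"
    by (simp add: phi4_group_eq[OF b])
  show "card (phi4_group b) = 4"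
    unfolding phi4_group_eq[OF b] card_image[OF inj_on_unit_action[OF b]]
    by (simp add: fourth_roots_eq complex_eq_iff)
  show "isomorphism (variety_space (ell_curve b)) (variety_space (ell_curve b)) h" if "h \<in> phi4_group b" for h
  proof -
    obtain u where u: "u \<in> fourth_roots" "h = unit_action b u"
      using \<open>h \<in> phi4_group b\<close> unfolding phi4_group_eq[OF b] by blast
    show ?thesis
      by (rule isomorphism_ell_scale[of u])
        (use u fourth_roots_nonzero[OF u(1)] in \<open>simp_all add: unit_action_def fourth_roots_def\<close>)
  qed
  show "orbit_map ` carrier (ell_group b) = pset CP1"
    unfolding carrier using orbit_map_surj[of b] by (auto simp: CP1_def image_iff) metis
  show "morphism (variety_space (ell_curve b)) (variety_space CP1) orbit_map"
    by (rule morphism_orbit_map)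
  show "neutral (G4 b) = orbit_map \<one>\<^bsub>ell_group b\<^esub>"
    by (simp add: G4_def ell_group_def)
  fix P assume "P \<in> carrier (ell_group b)"
  then have P: "P \<in> ell_points b"
    by (simp add: carrier)
  show "ninv (G4 b) (orbit_map P) = orbit_map (inv\<^bsub>ell_group b\<^esub> P)"
    using orbit_map_scale[of "- 1" P] by (simp add: G4_def ell_group_inv[OF b P] ell_neg_scale fourth_roots_eq)
  fix Q assume "Q \<in> carrier (ell_group b)"
  then have Q: "Q \<in> ell_points b"
    by (simp add: carrier)
  show "(orbit_map P = orbit_map Q) = (\<exists>h\<in>phi4_group b. Q = h P)"
    unfolding orbit_map_eq_iff[OF P Q] phi4_group_eq[OF b] using P by (simp add: unit_action_def)
  show "nmult (G4 b) (orbit_map P) (orbit_map Q) =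
      {#orbit_map (P \<otimes>\<^bsub>ell_group b\<^esub> h Q). h \<in># mset_set (phi4_group b)#}"
    unfolding G4_mult[OF P Q] coset_mult_def
    using phi4_group_mset[OF b Q, of "\<lambda>R. orbit_map (ell_add b P R)"] by (simp add: ell_group_def)
qed

lemma coset_isomorphic_G4:
  assumes b: "b \<noteq> 0" and b': "b' \<noteq> 0"
  shows "coset_isomorphic
         (ell_group b) (ell_curve b) (phi4_group b) orbit_map CP1 (G4 b)
         (ell_group b') (ell_curve b') (phi4_group b') orbit_map CP1 (G4 b')"
proof -
  obtain t where "t ^ 4 = b' / b"
    by (rule exists_fourth_root)
  then have t: "t \<noteq> 0" "b' = t ^ 4 * b"
    using b b' by auto
  have t': "b = (1 / t) ^ 4 * b'"
    using t by (simp add: power_divide)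
  have closed: "ell_scale t P \<in> ell_points b'" if "P \<in> ell_points b" for P
    by (rule ell_scale_closed[OF that t(2)])
  have orbit: "line_scale (1 / t ^ 4) (orbit_map P) = orbit_map (ell_scale t P)" for P
    using t(1) by (cases P) (auto simp: field_simps power2_eq_square eval_nat_numeral)
  have add: "ell_scale t (ell_add b P Q) = ell_add b' (ell_scale t P) (ell_scale t Q)" for P Q
    by (rule ell_scale_add[OF t])
  have action: "{#ell_scale t (ell_add b P (ell_scale u Q)). u \<in># mset_set fourth_roots#}
      = {#ell_add b' (ell_scale t P) (ell_scale u (ell_scale t Q)). u \<in># mset_set fourth_roots#}" for P Q
    by (simp add: add mult.commute)
  have carrier: "carrier (ell_group c) = ell_points c" for c
    by (simp add: ell_group_def)
  show ?thesis
    unfolding coset_isomorphic_def carrier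
  proof (intro exI[of _ "ell_scale t"] exI[of _ "line_scale (1 / t ^ 4)"] conjI ballI)
    have "bij_betw (ell_scale t) (ell_points b) (ell_points b')"
      by (rule bij_betwI[where g = "ell_scale (1 / t)"])
        (use t(1) closed ell_scale_closed[OF _ t'] in auto)
    moreover have "ell_scale t \<in> hom (ell_group b) (ell_group b')"
      by (rule homI) (simp_all add: ell_group_def closed add)
    ultimately show "ell_scale t \<in> iso (ell_group b) (ell_group b')"
      by (simp add: iso_def carrier)
    show "isomorphism (variety_space (ell_curve b)) (variety_space (ell_curve b')) (ell_scale t)"
      by (rule isomorphism_ell_scale[OF t]) simp
    show "isomorphism (variety_space CP1) (variety_space CP1) (line_scale (1 / t ^ 4))"
      by (rule isomorphism_line_scale) (use t in simp)
    fix P assume P: "P \<in> ell_points b"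
    show "line_scale (1 / t ^ 4) (orbit_map P) = orbit_map (ell_scale t P)"
      by (rule orbit)
    fix Q assume Q: "Q \<in> ell_points b"
    show "image_mset (ell_scale t) {#P \<otimes>\<^bsub>ell_group b\<^esub> a Q. a \<in># mset_set (phi4_group b)#} =
        {#ell_scale t P \<otimes>\<^bsub>ell_group b'\<^esub> a (ell_scale t Q). a \<in># mset_set (phi4_group b')#}"
      using action[of P Q] phi4_group_mset[OF b Q, of "\<lambda>R. ell_scale t (ell_add b P R)"]
        phi4_group_mset[OF b' closed[OF Q], of "ell_add b' (ell_scale t P)"]
      by (simp add: ell_group_def multiset.map_comp o_def)
  next
    fix x y :: "complex with_infty"
    obtain P where P: "P \<in> ell_points b" "orbit_map P = x"
      by (rule orbit_map_surj)
    obtain Q where Q: "Q \<in> ell_points b" "orbit_map Q = y"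
      by (rule orbit_map_surj)
    have "image_mset (line_scale (1 / t ^ 4)) (nmult (G4 b) x y)
        = image_mset orbit_map {#ell_scale t (ell_add b P (ell_scale u Q)). u \<in># mset_set fourth_roots#}"
      using G4_mult[OF P(1) Q(1)] by (simp add: P(2) Q(2) coset_mult_def multiset.map_comp o_def orbit)
    also have "\<dots> = coset_mult b' (ell_scale t P) (ell_scale t Q)"
      unfolding action by (simp add: coset_mult_def multiset.map_comp o_def)
    also have "\<dots> = nmult (G4 b') (line_scale (1 / t ^ 4) x) (line_scale (1 / t ^ 4) y)"
      using G4_mult[OF closed closed, OF P(1) Q(1)] by (simp add: orbit P(2)[symmetric] Q(2)[symmetric])
    finally show "image_mset (line_scale (1 / t ^ 4)) (nmult (G4 b) x y) =
        nmult (G4 b') (line_scale (1 / t ^ 4) x) (line_scale (1 / t ^ 4) y)" .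
  qed
qed

theorem theorem4:
  shows "\<exists>\<GG> :: complex \<Rightarrow> complex with_infty nvgroup.
    (\<forall>b. b \<noteq> 0 \<longrightarrow>
       regular_algebraic_nvgroup 4 CP1 (\<GG> b) \<and>
       nv_commutative CP1 (\<GG> b) \<and>
       nv_involutive CP1 (\<GG> b) \<and>
       neutral (\<GG> b) = Fin 0 \<and>
       multiplication_defined_by 4 (p4 b) (nmult (\<GG> b)) \<and>
       coset_nvgroup 4 (ell_group b) (ell_curve b) (phi4_group b) orbit_map CP1 (\<GG> b)) \<and>
    (\<forall>b b'. b \<noteq> 0 \<longrightarrow> b' \<noteq> 0 \<longrightarrow>
       coset_isomorphic
         (ell_group b) (ell_curve b) (phi4_group b) orbit_map CP1 (\<GG> b)
         (ell_group b') (ell_curve b') (phi4_group b') orbit_map CP1 (\<GG> b'))"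
proof (intro exI[of _ G4] conjI allI impI)
  show "neutral (G4 b) = Fin 0" for b
    by (simp add: G4_def)
qed (rule regular_algebraic_G4 commutative_G4 involutive_G4 multiplication_defined_by_p4
      coset_G4 coset_isomorphic_G4; assumption)+

end
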